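(* Let $G$ be a finite group, $H\subset G$ a subgroup, and $R$ a $G$-Tambara functor. If the $G$-ring $R(G/e)$ is isomorphic to $\mathrm{Coind}_H^G S$ for some $H$-ring $S$, then there is an isomorphism of $G$-Tambara functors $R\cong \mathrm{Coind}_H^G T$ for some $H$-Tambara functor $T$ with $T(H/e)\cong S$.
   Context: Rings are commutative with unit; a $G$-ring is a ring with an action of $G$ by ring automorphisms. Let $\mathrm{bispan}(G\text{-}\mathrm{Set}^{\mathrm{fin}})$ be the category whose objects are finite $G$-sets and whose morphisms from $X$ to $Y$ are isomorphism classes of diagrams $X\leftarrow A\to B\to Y$ of finite $G$-sets, with the usual composition of bispans (polynomials), defined via pullbacks and exponential diagrams. A $G$-Tambara functor is a product-preserving functor $R:\mathrm{bispan}(G\text{-}\mathrm{Set}^{\mathrm{fin}})\to \mathrm{Set}$ such that the additive monoid $R(X)$ is a group for each finite $G$-set $X$; morphisms are natural transformations. For $f:X\to Y$ the restriction, norm and transfer along $f$ are the images of $Y\xleftarrow{f} X= X= X$, of $X= X\xrightarrow{f} Y= Y$, and of $X= X= X\xrightarrow{f} Y$. Transfer and norm along the fold map $X\sqcup X\to X$ give addition and multiplication, making $R(X)$ a commutative ring. $R(G/e)$ is a $G$-ring via $\mathrm{Aut}_G(G/e)\cong G$. The same definitions apply to every finite group. For $H\subset G$ and an $H$-Tambara functor $T$, the coinduction is the $G$-Tambara functor $\mathrm{Coind}_H^G T := T\circ \mathrm{res}_H^G$, i.e. $(\mathrm{Coind}_H^G T)(X)=T(\mathrm{res}_H^G X)$,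 where $\mathrm{res}_H^G$ sends a $G$-set to its underlying $H$-set. For an $H$-ring $S$, the coinduction $\mathrm{Coind}_H^G S$ is the $G$-ring $(\mathrm{Coind}_H^G \mathrm{FP}(S))(G/e)$, where $\mathrm{FP}(S)$ is the fixed-point $H$-Tambara functor $H/K\mapsto S^K$; concretely it is the ring of $H$-equivariant functions $G\to S$ (as a ring, $\mathrm{Fun}(G/H,S)$), with $G$ acting by $(\gamma f)(x)=f(x\gamma)$. *)

theory Defs
  imports "HOL-Algebra.Group_Action" "HOL-Algebra.QuotRing" "HOL-Library.Countable_Set" "HOL-Library.Nat_Bijection"
begin

section \<open>Finite \<open>G\<close>-sets\<close>

text \<open>
  Underlying sets of finite \<open>G\<close>-sets are taken to be finite sets of natural numbers: every finite
  \<open>G\<close>-set is isomorphic to one of these, so this is a small model of the category of all finite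
  \<open>G\<close>-sets.  The values of an action outside the carrier of the group are irrelevant.  In
  particular a \<open>G\<close>-set, read over the group \<open>G\<lparr>carrier := H\<rparr>\<close> for a subgroup \<open>H\<close>, is its own
  restriction to an \<open>H\<close>-set.
\<close>

record 'g gset =
  pts :: "nat set"
  act :: "'g \<Rightarrow> nat \<Rightarrow> nat"

definition fin_gset :: "('g, 'm) monoid_scheme \<Rightarrow> 'g gset \<Rightarrow> bool" where
  "fin_gset G X \<longleftrightarrow> finite (pts X) \<and> group_action G (pts X) (act X)"

definition gset_map :: "('g, 'm) monoid_scheme \<Rightarrow> 'g gset \<Rightarrow> 'g gset \<Rightarrow> (nat \<Rightarrow> nat) \<Rightarrow> bool" where
  "gset_map G X Y f \<longleftrightarrow> f \<in> pts X \<rightarrow> pts Y \<and>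
     (\<forall>g\<in>carrier G. \<forall>x\<in>pts X. f (act X g x) = act Y g (f x))"

definition gset_empty :: "'g gset" where
  "gset_empty = \<lparr>pts = {}, act = (\<lambda>g. \<lambda>x\<in>{}. x)\<rparr>"

definition inl :: "nat \<Rightarrow> nat" where "inl x = sum_encode (Inl x)"

definition inr :: "nat \<Rightarrow> nat" where "inr x = sum_encode (Inr x)"

definition gset_sum :: "'g gset \<Rightarrow> 'g gset \<Rightarrow> 'g gset" where
  "gset_sum X Y = \<lparr>pts = inl ` pts X \<union> inr ` pts Y,
     act = (\<lambda>g. \<lambda>n\<in>inl ` pts X \<union> inr ` pts Y.
       case sum_decode n of Inl x \<Rightarrow> inl (act X g x) | Inr y \<Rightarrow> inr (act Y g y))\<rparr>"

definition fold_map :: "nat \<Rightarrow> nat" where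
  "fold_map n = (case sum_decode n of Inl x \<Rightarrow> x | Inr x \<Rightarrow> x)"

text \<open>The free orbit \<open>G/e\<close>, with the elements of the group numbered, and its automorphism
  \<open>x \<mapsto> x\<gamma>\<close>.\<close>

definition free_orbit :: "('g, 'm) monoid_scheme \<Rightarrow> 'g gset" where
  "free_orbit G = \<lparr>pts = to_nat_on (carrier G) ` carrier G,
     act = (\<lambda>g. \<lambda>n\<in>to_nat_on (carrier G) ` carrier G.
       to_nat_on (carrier G) (g \<otimes>\<^bsub>G\<^esub> from_nat_into (carrier G) n))\<rparr>"

definition right_mult :: "('g, 'm) monoid_scheme \<Rightarrow> 'g \<Rightarrow> nat \<Rightarrow> nat" where
  "right_mult G \<gamma> n = to_nat_on (carrier G) (from_nat_into (carrier G) n \<otimes>\<^bsub>G\<^esub> \<gamma>)"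


section \<open>The category of bispans\<close>

text \<open>\<open>pullback G P u v A f B g C\<close>: the square with \<open>u : P \<rightarrow> A\<close>, \<open>v : P \<rightarrow> B\<close>, \<open>f : A \<rightarrow> C\<close>,
  \<open>g : B \<rightarrow> C\<close> commutes and identifies \<open>P\<close> with the fibre product.\<close>

definition pullback ::
  "('g, 'm) monoid_scheme \<Rightarrow> 'g gset \<Rightarrow> (nat \<Rightarrow> nat) \<Rightarrow> (nat \<Rightarrow> nat) \<Rightarrow>
   'g gset \<Rightarrow> (nat \<Rightarrow> nat) \<Rightarrow> 'g gset \<Rightarrow> (nat \<Rightarrow> nat) \<Rightarrow> 'g gset \<Rightarrow> bool" where
  "pullback G P u v A f B g C \<longleftrightarrow>
     fin_gset G P \<and> fin_gset G A \<and> fin_gset G B \<and> fin_gset G C \<and>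
     gset_map G P A u \<and> gset_map G P B v \<and> gset_map G A C f \<and> gset_map G B C g \<and>
     bij_betw (\<lambda>p. (u p, v p)) (pts P) {(a, b). a \<in> pts A \<and> b \<in> pts B \<and> f a = g b}"

text \<open>
  \<open>exponential G P g A f B E e f' D r\<close>: the diagram formed by \<open>g : P \<rightarrow> A\<close>, \<open>f : A \<rightarrow> B\<close>,
  \<open>e : E \<rightarrow> P\<close>, \<open>f' : E \<rightarrow> D\<close>, \<open>r : D \<rightarrow> B\<close> is exponential.  The set \<open>D\<close> is
  identified with the dependent product \<open>\<Pi>\<^sub>f P\<close> of pairs \<open>(b, s)\<close> of a point \<open>b\<close> of \<open>B\<close> and a section \<open>s\<close>
  of \<open>g\<close> over the fibre of \<open>f\<close> at \<open>b\<close>, the set \<open>E\<close> with the pullback of \<open>A\<close> and \<open>D\<close> over \<open>B\<close>, and \<open>e\<close>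
  with the evaluation map \<open>(a, (b, s)) \<mapsto> s a\<close>.
\<close>

definition exponential ::
  "('g, 'm) monoid_scheme \<Rightarrow> 'g gset \<Rightarrow> (nat \<Rightarrow> nat) \<Rightarrow> 'g gset \<Rightarrow> (nat \<Rightarrow> nat) \<Rightarrow> 'g gset \<Rightarrow>
   'g gset \<Rightarrow> (nat \<Rightarrow> nat) \<Rightarrow> (nat \<Rightarrow> nat) \<Rightarrow> 'g gset \<Rightarrow> (nat \<Rightarrow> nat) \<Rightarrow> bool" where
  "exponential G P g A f B E e f' D r \<longleftrightarrow>
     fin_gset G P \<and> gset_map G P A g \<and> gset_map G E P e \<and>
     pullback G E (\<lambda>x. g (e x)) f' A f D r B \<and>
     (\<forall>b\<in>pts B. \<forall>s. (\<forall>a\<in>pts A. f a = b \<longrightarrow> s a \<in> pts P \<and> g (s a) = a) \<longrightarrow>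
       (\<exists>!d. d \<in> pts D \<and> r d = b \<and> (\<forall>x\<in>pts E. f' x = d \<longrightarrow> e x = s (g (e x)))))"

text \<open>The bispan \<open>X \<leftarrow> A \<rightarrow> B \<rightarrow> Y\<close> has legs \<open>p : A \<rightarrow> X\<close>, \<open>f : A \<rightarrow> B\<close>, \<open>q : B \<rightarrow> Y\<close>.\<close>

record 'g bispan =
  src :: "'g gset"
  apexA :: "'g gset"
  apexB :: "'g gset"
  tgt :: "'g gset"
  legp :: "nat \<Rightarrow> nat"
  legf :: "nat \<Rightarrow> nat"
  legq :: "nat \<Rightarrow> nat"

definition is_bispan :: "('g, 'm) monoid_scheme \<Rightarrow> 'g bispan \<Rightarrow> bool" where
  "is_bispan G b \<longleftrightarrow>
     fin_gset G (src b) \<and> fin_gset G (apexA b) \<and> fin_gset G (apexB b) \<and> fin_gset G (tgt b) \<and>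
     gset_map G (apexA b) (src b) (legp b) \<and> gset_map G (apexA b) (apexB b) (legf b) \<and>
     gset_map G (apexB b) (tgt b) (legq b)"

definition bispan_iso :: "('g, 'm) monoid_scheme \<Rightarrow> 'g bispan \<Rightarrow> 'g bispan \<Rightarrow> bool" where
  "bispan_iso G b b' \<longleftrightarrow> src b = src b' \<and> tgt b = tgt b' \<and>
     (\<exists>\<alpha> \<beta>. gset_map G (apexA b) (apexA b') \<alpha> \<and> bij_betw \<alpha> (pts (apexA b)) (pts (apexA b')) \<and>
            gset_map G (apexB b) (apexB b') \<beta> \<and> bij_betw \<beta> (pts (apexB b)) (pts (apexB b')) \<and>
            (\<forall>a\<in>pts (apexA b). legp b' (\<alpha> a) = legp b a \<and> legf b' (\<alpha> a) = \<beta> (legf b a)) \<and>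
            (\<forall>x\<in>pts (apexB b). legq b' (\<beta> x) = legq b x))"

definition bispan_class :: "('g, 'm) monoid_scheme \<Rightarrow> 'g bispan \<Rightarrow> 'g bispan set" where
  "bispan_class G b = {b'. is_bispan G b' \<and> bispan_iso G b b'}"

text \<open>
  Composite of \<open>X \<leftarrow> A\<^sub>1 \<rightarrow> B\<^sub>1 \<rightarrow> Y\<close> and \<open>Y \<leftarrow> A\<^sub>2 \<rightarrow> B\<^sub>2 \<rightarrow> Z\<close>.  Let \<open>P\<close> be the pullback of \<open>B\<^sub>1\<close> and \<open>A\<^sub>2\<close> over \<open>Y\<close>,
  complete \<open>P \<rightarrow> A\<^sub>2 \<rightarrow> B\<^sub>2\<close> to an exponential diagram with \<open>E \<rightarrow> P\<close> and \<open>E \<rightarrow> D \<rightarrow> B\<^sub>2\<close>, and let \<open>N\<close> be the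
  pullback of \<open>A\<^sub>1\<close> and \<open>E\<close> over \<open>B\<^sub>1\<close>.  The composite is \<open>X \<leftarrow> N \<rightarrow> D \<rightarrow> Z\<close>.
\<close>

definition bispan_composite ::
  "('g, 'm) monoid_scheme \<Rightarrow> 'g bispan \<Rightarrow> 'g bispan \<Rightarrow> 'g bispan \<Rightarrow> bool" where
  "bispan_composite G b1 b2 c \<longleftrightarrow>
     is_bispan G b1 \<and> is_bispan G b2 \<and> is_bispan G c \<and>
     tgt b1 = src b2 \<and> src c = src b1 \<and> tgt c = tgt b2 \<and>
     (\<exists>P u v E e f' r n m.
        pullback G P u v (apexB b1) (legq b1) (apexA b2) (legp b2) (tgt b1) \<and>
        exponential G P v (apexA b2) (legf b2) (apexB b2) E e f' (apexB c) r \<and>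
        pullback G (apexA c) n m (apexA b1) (legf b1) E (\<lambda>x. u (e x)) (apexB b1) \<and>
        (\<forall>x\<in>pts (apexA c). legp c x = legp b1 (n x) \<and> legf c x = f' (m x)) \<and>
        (\<forall>x\<in>pts (apexB c). legq c x = legq b2 (r x)))"

text \<open>Composition of isomorphism classes, in diagrammatic order.\<close>

definition bispan_comp ::
  "('g, 'm) monoid_scheme \<Rightarrow> 'g bispan set \<Rightarrow> 'g bispan set \<Rightarrow> 'g bispan set" where
  "bispan_comp G C1 C2 = {c. \<exists>b1\<in>C1. \<exists>b2\<in>C2. bispan_composite G b1 b2 c}"

definition bispan_id :: "'g gset \<Rightarrow> 'g bispan" where
  "bispan_id X = \<lparr>src = X, apexA = X, apexB = X, tgt = X, legp = id, legf = id, legq = id\<rparr>"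

definition res_bispan :: "'g gset \<Rightarrow> 'g gset \<Rightarrow> (nat \<Rightarrow> nat) \<Rightarrow> 'g bispan" where
  "res_bispan X Y f = \<lparr>src = Y, apexA = X, apexB = X, tgt = X, legp = f, legf = id, legq = id\<rparr>"

definition norm_bispan :: "'g gset \<Rightarrow> 'g gset \<Rightarrow> (nat \<Rightarrow> nat) \<Rightarrow> 'g bispan" where
  "norm_bispan X Y f = \<lparr>src = X, apexA = X, apexB = Y, tgt = Y, legp = id, legf = f, legq = id\<rparr>"

definition tr_bispan :: "'g gset \<Rightarrow> 'g gset \<Rightarrow> (nat \<Rightarrow> nat) \<Rightarrow> 'g bispan" where
  "tr_bispan X Y f = \<lparr>src = X, apexA = X, apexB = X, tgt = Y, legp = id, legf = id, legq = f\<rparr>"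

subsection \<open>Composition of isomorphism classes is well defined\<close>

lemma fin_gsetD:
  assumes "fin_gset G X"
  shows "group G" "finite (pts X)"
    and "\<And>g x. g \<in> carrier G \<Longrightarrow> x \<in> pts X \<Longrightarrow> act X g x \<in> pts X"
    and "\<And>x. x \<in> pts X \<Longrightarrow> act X \<one>\<^bsub>G\<^esub> x = x"
    and "\<And>g h x. g \<in> carrier G \<Longrightarrow> h \<in> carrier G \<Longrightarrow> x \<in> pts X \<Longrightarrow>
           act X (g \<otimes>\<^bsub>G\<^esub> h) x = act X g (act X h x)"
proof -
  interpret group_action G "pts X" "act X" using assms by (simp add: fin_gset_def)
  show "group G" using group_hom group_hom.axioms(1) by blast
  show "finite (pts X)" using assms by (simp add: fin_gset_def)
  show "\<And>g x. g \<in> carrier G \<Longrightarrow> x \<in> pts X \<Longrightarrow> act X g x \<in> pts X" by (meson element_image)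
  show "\<And>x. x \<in> pts X \<Longrightarrow> act X \<one>\<^bsub>G\<^esub> x = x" using id_eq_one by (metis restrict_apply')
  show "\<And>g h x. g \<in> carrier G \<Longrightarrow> h \<in> carrier G \<Longrightarrow> x \<in> pts X \<Longrightarrow>
           act X (g \<otimes>\<^bsub>G\<^esub> h) x = act X g (act X h x)" by (rule composition_rule)
qed

lemma fin_gsetI:
  fixes G (structure)
  assumes "group G" and fin: "finite (pts X)"
    and ext: "\<And>g. g \<in> carrier G \<Longrightarrow> act X g \<in> extensional (pts X)"
    and cl: "\<And>g x. g \<in> carrier G \<Longrightarrow> x \<in> pts X \<Longrightarrow> act X g x \<in> pts X"
    and one: "\<And>x. x \<in> pts X \<Longrightarrow> act X \<one> x = x"
    and mult: "\<And>g h x. g \<in> carrier G \<Longrightarrow> h \<in> carrier G \<Longrightarrow> x \<in> pts X \<Longrightarrow>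
           act X (g \<otimes> h) x = act X g (act X h x)"
  shows "fin_gset G X"
proof -
  interpret group G by fact
  have bij: "act X g \<in> Bij (pts X)" if g: "g \<in> carrier G" for g
  proof -
    have "bij_betw (act X g) (pts X) (pts X)"
      by (rule bij_betw_byWitness[where f' = "act X (inv g)"])
        (use g in \<open>auto simp: mult[symmetric] one cl\<close>)
    then show ?thesis using ext[OF g] by (simp add: Bij_def)
  qed
  have "act X (g \<otimes> h) = compose (pts X) (act X g) (act X h)"
    if gh: "g \<in> carrier G" "h \<in> carrier G" for g h
    by (rule extensionalityI[where A = "pts X"])
      (use ext gh mult in \<open>auto simp: compose_def\<close>)
  then have "group_hom G (BijGroup (pts X)) (act X)"
    by (intro group_hom.intro group_hom_axioms.intro homI group_BijGroup)
      (use bij in \<open>auto simp: BijGroup_def is_group\<close>)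
  then show ?thesis using fin by (simp add: fin_gset_def group_action_def)
qed

lemma gset_model:
  fixes G (structure)
  assumes "group G" and fin: "finite E"
    and cl: "\<And>g x. g \<in> carrier G \<Longrightarrow> x \<in> E \<Longrightarrow> \<phi> g x \<in> E"
    and one: "\<And>x. x \<in> E \<Longrightarrow> \<phi> \<one> x = x"
    and mult: "\<And>g h x. g \<in> carrier G \<Longrightarrow> h \<in> carrier G \<Longrightarrow> x \<in> E \<Longrightarrow> \<phi> (g \<otimes> h) x = \<phi> g (\<phi> h x)"
  obtains X e where "fin_gset G X" "bij_betw e (pts X) E"
    "\<And>g n. g \<in> carrier G \<Longrightarrow> n \<in> pts X \<Longrightarrow> e (act X g n) = \<phi> g (e n)"
proof -
  let ?t = "to_nat_on E" and ?e = "from_nat_into E"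
  interpret group G by fact
  have c: "countable E" using fin by (rule countable_finite)
  define X :: "'a gset" where "X = \<lparr>pts = ?t ` E, act = (\<lambda>g. \<lambda>n\<in>?t ` E. ?t (\<phi> g (?e n)))\<rparr>"
  have X: "pts X = ?t ` E" "\<And>g x. x \<in> E \<Longrightarrow> act X g (?t x) = ?t (\<phi> g x)"
    "\<And>g. act X g \<in> extensional (pts X)"
    using c by (auto simp: X_def)
  have "fin_gset G X"
    by (rule fin_gsetI) (use fin c cl one mult X \<open>group G\<close> in auto)
  moreover have "bij_betw ?e (pts X) E"
    by (rule bij_betw_byWitness[where f' = ?t]) (use c X in auto)
  moreover have "?e (act X g n) = \<phi> g (?e n)" if "g \<in> carrier G" "n \<in> pts X" for g n
    using that c X cl by auto
  ultimately show thesis by (rule that)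
qed

lemma gset_mapD:
  assumes "gset_map G X Y f"
  shows "x \<in> pts X \<Longrightarrow> f x \<in> pts Y"
    and "g \<in> carrier G \<Longrightarrow> x \<in> pts X \<Longrightarrow> f (act X g x) = act Y g (f x)"
  using assms by (auto simp: gset_map_def)

lemma gset_map_comp:
  "gset_map G X Y f \<Longrightarrow> gset_map G Y Z h \<Longrightarrow> gset_map G X Z (\<lambda>x. h (f x))"
  by (auto simp: gset_map_def Pi_iff)

lemma gset_map_inv:
  assumes "fin_gset G X" "gset_map G X Y f" "bij_betw f (pts X) (pts Y)"
  shows "gset_map G Y X (inv_into (pts X) f)"
proof -
  have "inv_into (pts X) f (act Y g y) = act X g (inv_into (pts X) f y)"
    if "g \<in> carrier G" "y \<in> pts Y" for g y
  proof -
    have "y \<in> f ` pts X" using that(2) assms(3) by (simp add: bij_betw_imp_surj_on)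
    then obtain x where x: "x \<in> pts X" "y = f x" by blast
    have "act X g x \<in> pts X" using assms(1) that(1) x(1) by (rule fin_gsetD)
    then show ?thesis
      using assms(2,3) x that(1) by (simp add: bij_betw_def gset_mapD(2)[symmetric])
  qed
  then show ?thesis using assms(3)
    by (auto simp: gset_map_def bij_betw_def inv_into_into)
qed

lemma pullback_exists:
  fixes G (structure)
  assumes A: "fin_gset G A" and B: "fin_gset G B" and C: "fin_gset G C"
    and f: "gset_map G A C f" and g: "gset_map G B C g"
  shows "\<exists>P u v. pullback G P u v A f B g C"
proof -
  let ?E = "{(a, b). a \<in> pts A \<and> b \<in> pts B \<and> f a = g b}"
  have "finite ?E"
    by (rule finite_subset[of _ "pts A \<times> pts B"]) (use A B in \<open>auto simp: fin_gset_def\<close>)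
  then obtain P e where P: "fin_gset G P" "bij_betw e (pts P) ?E"
    "\<And>h n. h \<in> carrier G \<Longrightarrow> n \<in> pts P \<Longrightarrow> e (act P h n) = (\<lambda>h (a, b). (act A h a, act B h b)) h (e n)"
    by (rule gset_model[OF fin_gsetD(1)[OF A], where \<phi> = "\<lambda>h (a, b). (act A h a, act B h b)"])
      (use fin_gsetD[OF A] fin_gsetD[OF B] gset_mapD[OF f] gset_mapD[OF g] in \<open>auto; metis\<close>)+
  have e: "e n \<in> ?E" if "n \<in> pts P" for n
    by (rule bspec[OF bij_betwE[OF P(2)] that])
  have "pullback G P (\<lambda>n. fst (e n)) (\<lambda>n. snd (e n)) A f B g C"
    unfolding pullback_def
    using P A B C f g e by (force simp: gset_map_def case_prod_unfold)
  then show ?thesis by blast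
qed

lemma pullbackD:
  assumes "pullback G P u v A f B g C"
  shows "fin_gset G P" "fin_gset G A" "fin_gset G B" "fin_gset G C"
    and "gset_map G P A u" "gset_map G P B v" "gset_map G A C f" "gset_map G B C g"
    and "\<And>p. p \<in> pts P \<Longrightarrow> f (u p) = g (v p)"
    and "\<And>p q. p \<in> pts P \<Longrightarrow> q \<in> pts P \<Longrightarrow> u p = u q \<Longrightarrow> v p = v q \<Longrightarrow> p = q"
    and "\<And>a b. a \<in> pts A \<Longrightarrow> b \<in> pts B \<Longrightarrow> f a = g b \<Longrightarrow> \<exists>p\<in>pts P. u p = a \<and> v p = b"
proof -
  have b: "bij_betw (\<lambda>p. (u p, v p)) (pts P) {(a, b). a \<in> pts A \<and> b \<in> pts B \<and> f a = g b}"
    using assms by (simp add: pullback_def)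
  show "\<And>p. p \<in> pts P \<Longrightarrow> f (u p) = g (v p)" using b by (auto simp: bij_betw_def)
  show "\<And>p q. p \<in> pts P \<Longrightarrow> q \<in> pts P \<Longrightarrow> u p = u q \<Longrightarrow> v p = v q \<Longrightarrow> p = q"
    using b by (auto simp: bij_betw_def inj_on_def)
  show "\<exists>p\<in>pts P. u p = a \<and> v p = b" if "a \<in> pts A" "b \<in> pts B" "f a = g b" for a b
  proof -
    have "(a, b) \<in> (\<lambda>p. (u p, v p)) ` pts P" using b that by (auto simp: bij_betw_def)
    then show ?thesis by auto
  qed
qed (use assms in \<open>auto simp: pullback_def\<close>)

lemma pullbackI:
  assumes "fin_gset G P" "fin_gset G A" "fin_gset G B" "fin_gset G C"
    and "gset_map G P A u" "gset_map G P B v" "gset_map G A C f" "gset_map G B C g"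
    and "\<And>p. p \<in> pts P \<Longrightarrow> f (u p) = g (v p)"
    and "\<And>p q. p \<in> pts P \<Longrightarrow> q \<in> pts P \<Longrightarrow> u p = u q \<Longrightarrow> v p = v q \<Longrightarrow> p = q"
    and "\<And>a b. a \<in> pts A \<Longrightarrow> b \<in> pts B \<Longrightarrow> f a = g b \<Longrightarrow> \<exists>p\<in>pts P. u p = a \<and> v p = b"
  shows "pullback G P u v A f B g C"
  unfolding pullback_def using assms
  by (auto simp: bij_betw_def inj_on_def gset_mapD(1) image_iff) metis

lemma pullback_map:
  assumes p: "pullback G P u v A f B g C" and Q: "fin_gset G Q"
    and a: "gset_map G Q A a" and b: "gset_map G Q B b"
    and eq: "\<And>q. q \<in> pts Q \<Longrightarrow> f (a q) = g (b q)"
  obtains w where "gset_map G Q P w" "\<And>q. q \<in> pts Q \<Longrightarrow> u (w q) = a q \<and> v (w q) = b q"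
proof -
  have "\<forall>q\<in>pts Q. \<exists>x. x \<in> pts P \<and> u x = a q \<and> v x = b q"
    using pullbackD(11)[OF p] gset_mapD[OF a] gset_mapD[OF b] eq by blast
  then obtain w where w: "\<forall>q\<in>pts Q. w q \<in> pts P \<and> u (w q) = a q \<and> v (w q) = b q" by metis
  have "w (act Q h q) = act P h (w q)" if h: "h \<in> carrier G" "q \<in> pts Q" for h q
    by (rule pullbackD(10)[OF p])
      (use w h fin_gsetD[OF Q] fin_gsetD[OF pullbackD(1)[OF p]] gset_mapD[OF a] gset_mapD[OF b]
        gset_mapD[OF pullbackD(5)[OF p]] gset_mapD[OF pullbackD(6)[OF p]] in auto)
  then have "gset_map G Q P w" using w by (auto simp: gset_map_def)
  then show thesis using w that by blast
qed

lemma pullback_cong: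
  assumes p: "pullback G P u v A f B g C" and u: "\<And>x. x \<in> pts P \<Longrightarrow> u' x = u x"
  shows "pullback G P u' v A f B g C"
proof (rule pullbackI)
  show "gset_map G P A u'"
    using pullbackD(5)[OF p] u fin_gsetD(3)[OF pullbackD(1)[OF p]] by (auto simp: gset_map_def)
  show "\<exists>q\<in>pts P. u' q = a \<and> v q = b" if "a \<in> pts A" "b \<in> pts B" "f a = g b" for a b
    using pullbackD(11)[OF p that] u by auto
qed (use u pullbackD[OF p] in auto)

lemma exponential_exists:
  fixes G (structure)
  assumes P: "fin_gset G P" and A: "fin_gset G A" and B: "fin_gset G B"
    and g: "gset_map G P A g" and f: "gset_map G A B f"
  shows "\<exists>E e f' D r. exponential G P g A f B E e f' D r"
proof -
  interpret group G by (rule fin_gsetD(1)[OF P])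
  define F where "F b = {a \<in> pts A. f a = b}" for b
  define sec where "sec b = (\<Pi>\<^sub>E a\<in>F b. {p \<in> pts P. g p = a})" for b
  define S where "S = (SIGMA b:pts B. sec b)"
  define \<phi> where "\<phi> h = (\<lambda>(b, s). (act B h b, \<lambda>a\<in>F (act B h b). act P h (s (act A (inv h) a))))" for h
  note PD = fin_gsetD(3-5)[OF P] and AD = fin_gsetD(3-5)[OF A] and BD = fin_gsetD(3-5)[OF B]
  note gD = gset_mapD[OF g] and fD = gset_mapD[OF f]
  have Finv: "act A (inv h) a \<in> F b" if "h \<in> carrier G" "b \<in> pts B" "a \<in> F (act B h b)" for h a b
    using that by (auto simp: F_def AD fD BD(3)[symmetric] BD(2))
  have sD: "s a \<in> pts P \<and> g (s a) = a" if "s \<in> sec b" "a \<in> F b" for s a b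
    using that by (auto simp: sec_def)
  have "finite S"
    unfolding S_def sec_def F_def using P A B by (auto simp: fin_gset_def intro!: finite_PiE)
  moreover have cl: "\<phi> h x \<in> S" if h: "h \<in> carrier G" and x: "x \<in> S" for h x
  proof -
    obtain b s where bs: "x = (b, s)" "b \<in> pts B" "s \<in> sec b" using x by (auto simp: S_def)
    have "act P h (s (act A (inv h) a)) \<in> pts P \<and> g (act P h (s (act A (inv h) a))) = a"
      if a: "a \<in> F (act B h b)" for a
    proof -
      have "act A h (act A (inv h) a) = a"
        using a h by (auto simp: F_def AD AD(3)[symmetric])
      then show ?thesis using sD[OF bs(3) Finv[OF h bs(2) a]] h by (simp add: PD gD)
    qed
    then show ?thesis using bs h by (auto simp: S_def \<phi>_def sec_def BD)
  qed
  moreover have "\<phi> \<one> x = x" if x: "x \<in> S" for x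
  proof -
    obtain b s where bs: "x = (b, s)" "b \<in> pts B" "s \<in> sec b" using x by (auto simp: S_def)
    have "(\<lambda>a\<in>F b. act P \<one> (s (act A (inv \<one>) a))) = s"
    proof (rule extensionalityI[where A = "F b"])
      show "s \<in> extensional (F b)" using bs(3) by (auto simp: sec_def PiE_def)
      show "(\<lambda>a\<in>F b. act P \<one> (s (act A (inv \<one>) a))) a = s a" if "a \<in> F b" for a
        using that sD[OF bs(3) that] by (auto simp: F_def AD PD)
    qed simp
    then show ?thesis using bs by (simp add: \<phi>_def BD)
  qed
  moreover have "\<phi> (h \<otimes> k) x = \<phi> h (\<phi> k x)"
    if h: "h \<in> carrier G" "k \<in> carrier G" and x: "x \<in> S" for h k x
  proof -
    obtain b s where bs: "x = (b, s)" "b \<in> pts B" "s \<in> sec b" using x by (auto simp: S_def)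
    let ?b = "act B (h \<otimes> k) b"
    have b: "?b = act B h (act B k b)" using h bs by (simp add: BD)
    have "act P (h \<otimes> k) (s (act A (inv (h \<otimes> k)) a)) =
        act P h ((\<lambda>a\<in>F (act B k b). act P k (s (act A (inv k) a))) (act A (inv h) a))"
      if a: "a \<in> F ?b" for a
    proof -
      have 1: "act A (inv h) a \<in> F (act B k b)"
        by (rule Finv) (use a h bs b BD in auto)
      have 2: "act A (inv (h \<otimes> k)) a \<in> F b"
        by (rule Finv) (use a h bs b in auto)
      have 3: "act A (inv (h \<otimes> k)) a = act A (inv k) (act A (inv h) a)"
        using a h by (simp add: F_def inv_mult_group AD)
      show ?thesis using 1 2 3 h sD[OF bs(3) 2] by (simp add: PD)
    qed
    then show ?thesis using bs by (auto simp: \<phi>_def b intro!: restrict_ext)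
  qed
  ultimately obtain D \<epsilon> where D: "fin_gset G D" and \<epsilon>: "bij_betw \<epsilon> (pts D) S"
    and \<epsilon>_act: "\<And>h n. h \<in> carrier G \<Longrightarrow> n \<in> pts D \<Longrightarrow> \<epsilon> (act D h n) = \<phi> h (\<epsilon> n)"
    by (rule gset_model[OF group_axioms]) auto
  define r where "r d = fst (\<epsilon> d)" for d
  have \<epsilon>S: "fst (\<epsilon> d) \<in> pts B" "snd (\<epsilon> d) \<in> sec (fst (\<epsilon> d))" if "d \<in> pts D" for d
    using bij_betwE[OF \<epsilon>] that by (force simp: S_def)+
  have r: "gset_map G D B r"
    using \<epsilon>S \<epsilon>_act by (auto simp: gset_map_def r_def \<phi>_def case_prod_unfold)
  obtain E a f' where E: "pullback G E a f' A f D r B"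
    using pullback_exists[OF A D B f r] by blast
  define e where "e x = snd (\<epsilon> (f' x)) (a x)" for x
  have EF: "a x \<in> F (fst (\<epsilon> (f' x)))" "f' x \<in> pts D" if "x \<in> pts E" for x
    using pullbackD(9)[OF E that] gset_mapD(1)[OF pullbackD(5)[OF E] that]
      gset_mapD(1)[OF pullbackD(6)[OF E] that] by (auto simp: F_def r_def)
  have e: "e x \<in> pts P \<and> g (e x) = a x" if "x \<in> pts E" for x
    unfolding e_def using EF[OF that] \<epsilon>S by (intro sD) auto
  have "e (act E h x) = act P h (e x)" if h: "h \<in> carrier G" and x: "x \<in> pts E" for h x
  proof -
    have 1: "a (act E h x) = act A h (a x)" "f' (act E h x) = act D h (f' x)"
      using gset_mapD(2)[OF pullbackD(5)[OF E] h x] gset_mapD(2)[OF pullbackD(6)[OF E] h x] by auto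
    have "act A h (a x) \<in> F (act B h (fst (\<epsilon> (f' x))))"
      using EF[OF x] h by (auto simp: F_def AD fD)
    moreover have "act A (inv h) (act A h (a x)) = a x"
      using EF[OF x] h by (auto simp: F_def AD AD(3)[symmetric])
    ultimately show ?thesis
      using EF[OF x] h by (simp add: e_def 1 \<epsilon>_act \<phi>_def case_prod_unfold)
  qed
  then have eP: "gset_map G E P e" using e by (auto simp: gset_map_def)
  have "\<exists>!d. d \<in> pts D \<and> r d = b \<and> (\<forall>x\<in>pts E. f' x = d \<longrightarrow> e x = s (g (e x)))"
    if b: "b \<in> pts B" and s: "\<forall>a\<in>pts A. f a = b \<longrightarrow> s a \<in> pts P \<and> g (s a) = a" for b s
  proof -
    have S: "(b, restrict s (F b)) \<in> S" using b s by (auto simp: S_def sec_def F_def)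
    then have "(b, restrict s (F b)) \<in> \<epsilon> ` pts D" using \<epsilon> by (simp add: bij_betw_imp_surj_on)
    then obtain d where d: "d \<in> pts D" "\<epsilon> d = (b, restrict s (F b))" by auto
    show ?thesis
    proof (rule ex1I[of _ d])
      show "d \<in> pts D \<and> r d = b \<and> (\<forall>x\<in>pts E. f' x = d \<longrightarrow> e x = s (g (e x)))"
      proof (intro conjI ballI impI)
        fix x assume x: "x \<in> pts E" "f' x = d"
        then have "a x \<in> F b" using EF(1)[OF x(1)] d by simp
        then have "e x = s (a x)" using x d by (simp add: e_def)
        then show "e x = s (g (e x))" using e[OF x(1)] by simp
      qed (use d in \<open>auto simp: r_def\<close>)
    next
      fix d' assume d': "d' \<in> pts D \<and> r d' = b \<and> (\<forall>x\<in>pts E. f' x = d' \<longrightarrow> e x = s (g (e x)))"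
      have "snd (\<epsilon> d') = restrict s (F b)"
      proof (rule extensionalityI[where A = "F b"])
        show "snd (\<epsilon> d') \<in> extensional (F b)"
          using \<epsilon>S(2)[of d'] d' by (auto simp: sec_def PiE_def r_def)
        show "snd (\<epsilon> d') c = restrict s (F b) c" if c: "c \<in> F b" for c
        proof -
          obtain x where x: "x \<in> pts E" "a x = c" "f' x = d'"
            using pullbackD(11)[OF E, of c d'] c d' by (auto simp: F_def)
          then have "e x = s (g (e x))" using d' by blast
          then show ?thesis using e[OF x(1)] x c by (simp add: e_def)
        qed
      qed simp
      then have "\<epsilon> d' = \<epsilon> d" using d d' by (simp add: r_def prod_eq_iff)
      then show "d' = d" using \<epsilon> d d' by (auto simp: bij_betw_def inj_on_def)
    qed
  qed
  moreover have "pullback G E (\<lambda>x. g (e x)) f' A f D r B"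
    by (rule pullback_cong[OF E]) (use e in auto)
  ultimately have "exponential G P g A f B E e f' D r"
    using P g eP by (simp add: exponential_def)
  then show ?thesis by blast
qed

lemma bispan_composite_exists:
  assumes b1: "is_bispan G b1" and b2: "is_bispan G b2" and t: "tgt b1 = src b2"
  shows "\<exists>c. bispan_composite G b1 b2 c"
proof -
  note D1 = b1[unfolded is_bispan_def] and D2 = b2[unfolded is_bispan_def]
  obtain P u v where P: "pullback G P u v (apexB b1) (legq b1) (apexA b2) (legp b2) (tgt b1)"
    using pullback_exists[of G "apexB b1" "apexA b2" "tgt b1" "legq b1" "legp b2"] D1 D2 t by auto
  obtain E e f' D r where E: "exponential G P v (apexA b2) (legf b2) (apexB b2) E e f' D r"
    using exponential_exists[of G P "apexA b2" "apexB b2" v "legf b2"] D2 pullbackD[OF P] by blast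
  have Ep: "pullback G E (\<lambda>x. v (e x)) f' (apexA b2) (legf b2) D r (apexB b2)"
    and e: "gset_map G E P e" using E by (auto simp: exponential_def)
  have ue: "gset_map G E (apexB b1) (\<lambda>x. u (e x))" by (rule gset_map_comp[OF e pullbackD(5)[OF P]])
  obtain N n m where N: "pullback G N n m (apexA b1) (legf b1) E (\<lambda>x. u (e x)) (apexB b1)"
    using pullback_exists[of G "apexA b1" E "apexB b1" "legf b1" "\<lambda>x. u (e x)"]
      D1 ue pullbackD(1)[OF Ep] by blast
  let ?c = "\<lparr>src = src b1, apexA = N, apexB = D, tgt = tgt b2, legp = (\<lambda>x. legp b1 (n x)),
     legf = (\<lambda>x. f' (m x)), legq = (\<lambda>x. legq b2 (r x))\<rparr>"
  have "is_bispan G ?c"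
    unfolding is_bispan_def using D1 D2 pullbackD(1-8)[OF N] pullbackD(1-8)[OF Ep]
    by (auto intro: gset_map_comp)
  then have "bispan_composite G b1 b2 ?c"
    unfolding bispan_composite_def using b1 b2 t P E N by fastforce
  then show ?thesis by blast
qed

lemma exponential_map:
  assumes X: "exponential G P g A f B E e f' D r"
    and X': "exponential G P' g' A f B E' e' f'' D' r'"
    and w: "gset_map G P P' w" "inj_on w (pts P)"
    and gw: "\<forall>p\<in>pts P. g' (w p) = g p"
  shows "\<exists>\<delta> \<eta>. gset_map G D D' \<delta> \<and> inj_on \<delta> (pts D) \<and> gset_map G E E' \<eta> \<and> inj_on \<eta> (pts E) \<and>
    (\<forall>d\<in>pts D. r' (\<delta> d) = r d) \<and>
    (\<forall>x\<in>pts E. f'' (\<eta> x) = \<delta> (f' x) \<and> e' (\<eta> x) = w (e x))"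
proof -
  have E: "pullback G E (\<lambda>x. g (e x)) f' A f D r B" and E': "pullback G E' (\<lambda>x. g' (e' x)) f'' A f D' r' B"
    and eE: "gset_map G E P e" and eE': "gset_map G E' P' e'"
    and uni: "\<And>b s. b \<in> pts B \<Longrightarrow> (\<forall>a\<in>pts A. f a = b \<longrightarrow> s a \<in> pts P \<and> g (s a) = a) \<Longrightarrow>
       (\<exists>!d. d \<in> pts D \<and> r d = b \<and> (\<forall>x\<in>pts E. f' x = d \<longrightarrow> e x = s (g (e x))))"
    and uni': "\<And>b s. b \<in> pts B \<Longrightarrow> (\<forall>a\<in>pts A. f a = b \<longrightarrow> s a \<in> pts P' \<and> g' (s a) = a) \<Longrightarrow>
       (\<exists>!d. d \<in> pts D' \<and> r' d = b \<and> (\<forall>x\<in>pts E'. f'' x = d \<longrightarrow> e' x = s (g' (e' x))))"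
    using X X' unfolding exponential_def by auto
  note ED = pullbackD[OF E] and ED' = pullbackD[OF E']
  define y where "y a d = (SOME x. x \<in> pts E \<and> g (e x) = a \<and> f' x = d)" for a d
  have y: "y a d \<in> pts E" "g (e (y a d)) = a" "f' (y a d) = d"
    if "a \<in> pts A" "d \<in> pts D" "f a = r d" for a d
  proof -
    have "\<exists>x. x \<in> pts E \<and> g (e x) = a \<and> f' x = d" using ED(11)[OF that] by auto
    then have "y a d \<in> pts E \<and> g (e (y a d)) = a \<and> f' (y a d) = d" unfolding y_def by (rule someI_ex)
    then show "y a d \<in> pts E" "g (e (y a d)) = a" "f' (y a d) = d" by auto
  qed
  have yx: "y (g (e x)) (f' x) = x" if "x \<in> pts E" for x
  proof -
    note yy = y[OF gset_mapD(1)[OF ED(5) that] gset_mapD(1)[OF ED(6) that] ED(9)[OF that]]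
    show ?thesis by (rule ED(10)[OF yy(1) that yy(2,3)])
  qed
  define s where "s d a = w (e (y a d))" for d a
  have s: "s d a \<in> pts P' \<and> g' (s d a) = a" if "a \<in> pts A" "d \<in> pts D" "f a = r d" for a d
    using y[OF that] gset_mapD(1)[OF eE] gset_mapD(1)[OF w(1)] gw by (simp add: s_def)
  have rD: "r d \<in> pts B" if "d \<in> pts D" for d using gset_mapD(1)[OF ED(8) that] .
  let ?Q = "\<lambda>d d'. d' \<in> pts D' \<and> r' d' = r d \<and> (\<forall>x\<in>pts E'. f'' x = d' \<longrightarrow> e' x = s d (g' (e' x)))"
  have ex1: "\<exists>!d'. ?Q d d'" if "d \<in> pts D" for d
    by (rule uni'[OF rD[OF that]]) (use s that in blast)
  define \<delta> where "\<delta> d = (THE d'. ?Q d d')" for d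
  have \<delta>: "?Q d (\<delta> d)" if "d \<in> pts D" for d
    unfolding \<delta>_def by (rule theI') (rule ex1[OF that])
  have \<delta>_in: "\<delta> d \<in> pts D'" and \<delta>_r: "r' (\<delta> d) = r d" if "d \<in> pts D" for d
    using \<delta>[OF that] by blast+
  have \<delta>_eq: "\<delta> d = d'" if "d \<in> pts D" "?Q d d'" for d d'
    using ex1[OF that(1)] \<delta>[OF that(1)] that(2) by blast
  have \<delta>_map: "gset_map G D D' \<delta>"
    unfolding gset_map_def
  proof (intro conjI ballI funcsetI)
    show "\<delta> d \<in> pts D'" if "d \<in> pts D" for d using \<delta>[OF that] by blast
    fix h d assume h: "h \<in> carrier G" and d: "d \<in> pts D"
    have grp: "group G" by (rule fin_gsetD(1)[OF ED(1)])
    have hi: "inv\<^bsub>G\<^esub> h \<in> carrier G" "h \<otimes>\<^bsub>G\<^esub> inv\<^bsub>G\<^esub> h = \<one>\<^bsub>G\<^esub>" "inv\<^bsub>G\<^esub> h \<otimes>\<^bsub>G\<^esub> h = \<one>\<^bsub>G\<^esub>"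
      using h grp by (auto simp: group.r_inv group.l_inv)
    have hd: "act D h d \<in> pts D" using fin_gsetD(3)[OF ED(3) h d] .
    note Q = \<delta>[OF d]
    show "\<delta> (act D h d) = act D' h (\<delta> d)"
    proof (rule \<delta>_eq[OF hd], intro conjI ballI impI)
      show "act D' h (\<delta> d) \<in> pts D'" using fin_gsetD(3)[OF ED'(3) h] Q by blast
      show "r' (act D' h (\<delta> d)) = r (act D h d)"
        using gset_mapD(2)[OF ED'(8) h \<delta>_in[OF d]] gset_mapD(2)[OF ED(8) h d] \<delta>_r[OF d] by simp
      fix x assume x: "x \<in> pts E'" "f'' x = act D' h (\<delta> d)"
      define z where "z = act E' (inv\<^bsub>G\<^esub> h) x"
      have z: "z \<in> pts E'" "act E' h z = x"
        using fin_gsetD(3)[OF ED'(1) hi(1) x(1)] fin_gsetD(5)[OF ED'(1) h hi(1) x(1)]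
          fin_gsetD(4)[OF ED'(1) x(1)] hi by (auto simp: z_def)
      have "f'' z = act D' (inv\<^bsub>G\<^esub> h) (act D' h (\<delta> d))"
        using gset_mapD(2)[OF ED'(6) hi(1) x(1)] x(2) by (simp add: z_def)
      then have fz: "f'' z = \<delta> d"
        using fin_gsetD(5)[OF ED'(3) hi(1) h \<delta>_in[OF d]] fin_gsetD(4)[OF ED'(3) \<delta>_in[OF d]] hi by simp
      let ?a = "g' (e' z)"
      have a: "?a \<in> pts A" "f ?a = r d"
        using gset_mapD(1)[OF ED'(5) z(1)] ED'(9)[OF z(1)] fz \<delta>_r[OF d] by auto
      note ya = y[OF a(1) d a(2)]
      have "e' z = s d ?a" using Q z(1) fz by blast
      then have ez: "e' z = w (e (y ?a d))" by (simp only: s_def)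
      have "g' (e' x) = act A h ?a" using gset_mapD(2)[OF ED'(5) h z(1)] z(2) by simp
      moreover have "g (e (act E h (y ?a d))) = act A h ?a"
        using gset_mapD(2)[OF ED(5) h ya(1)] ya(2) by simp
      moreover have "f' (act E h (y ?a d)) = act D h d"
        using gset_mapD(2)[OF ED(6) h ya(1)] ya(3) by simp
      ultimately have "y (g' (e' x)) (act D h d) = act E h (y ?a d)"
        using yx[OF fin_gsetD(3)[OF ED(1) h ya(1)]] by simp
      then have "s (act D h d) (g' (e' x)) = act P' h (w (e (y ?a d)))"
        using gset_mapD(2)[OF eE h ya(1)] gset_mapD(2)[OF w(1) h gset_mapD(1)[OF eE ya(1)]]
        by (simp add: s_def)
      also have "\<dots> = e' x" using ez gset_mapD(2)[OF eE' h z(1)] z(2) by simp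
      finally show "e' x = s (act D h d) (g' (e' x))" by simp
    qed
  qed
  obtain \<eta> where \<eta>: "gset_map G E E' \<eta>"
    "\<And>x. x \<in> pts E \<Longrightarrow> g' (e' (\<eta> x)) = g (e x) \<and> f'' (\<eta> x) = \<delta> (f' x)"
  proof (rule pullback_map[OF E' ED(1) ED(5) gset_map_comp[OF ED(6) \<delta>_map]])
    show "f (g (e q)) = r' (\<delta> (f' q))" if "q \<in> pts E" for q
      using ED(9)[OF that] \<delta>_r[OF gset_mapD(1)[OF ED(6) that]] by simp
  qed auto
  have \<eta>e: "e' (\<eta> x) = w (e x)" if x: "x \<in> pts E" for x
  proof -
    have "e' (\<eta> x) = s (f' x) (g' (e' (\<eta> x)))"
      using \<delta>[OF gset_mapD(1)[OF ED(6) x]] \<eta>(2)[OF x] gset_mapD(1)[OF \<eta>(1) x] by blast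
    also have "g' (e' (\<eta> x)) = g (e x)" using \<eta>(2)[OF x] by blast
    finally show ?thesis by (simp only: s_def yx[OF x])
  qed
  have inj: "inj_on \<delta> (pts D)"
  proof (rule inj_onI)
    fix d1 d2 assume d: "d1 \<in> pts D" "d2 \<in> pts D" and eq: "\<delta> d1 = \<delta> d2"
    have r12: "r d1 = r d2" using \<delta>_r[OF d(1)] \<delta>_r[OF d(2)] eq by simp
    have e12: "e (y a d1) = e (y a d2)" if a: "a \<in> pts A" "f a = r d1" for a
    proof -
      note y1 = y[OF a(1) d(1) a(2)] and y2 = y[OF a(1) d(2) a(2)[unfolded r12]]
      have "\<eta> (y a d1) = \<eta> (y a d2)"
        by (rule ED'(10)) (use y1 y2 \<eta> eq gset_mapD(1)[OF \<eta>(1)] in auto)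
      then have "w (e (y a d1)) = w (e (y a d2))" using \<eta>e y1 y2 by metis
      then show ?thesis using w(2) y1 y2 gset_mapD(1)[OF eE] by (auto dest: inj_onD)
    qed
    let ?s = "\<lambda>a. e (y a d1)"
    have "\<forall>a\<in>pts A. f a = r d1 \<longrightarrow> ?s a \<in> pts P \<and> g (?s a) = a"
      using y d gset_mapD(1)[OF eE] by auto
    from uni[OF rD[OF d(1)] this]
    have u: "\<And>d d'. d \<in> pts D \<and> r d = r d1 \<and> (\<forall>x\<in>pts E. f' x = d \<longrightarrow> e x = ?s (g (e x))) \<Longrightarrow>
      d' \<in> pts D \<and> r d' = r d1 \<and> (\<forall>x\<in>pts E. f' x = d' \<longrightarrow> e x = ?s (g (e x))) \<Longrightarrow> d = d'"
      by blast
    show "d1 = d2"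
    proof (rule u; intro conjI ballI impI)
      fix x assume x: "x \<in> pts E"
      show "e x = ?s (g (e x))" if "f' x = d1" using yx[OF x] that by simp
      show "e x = ?s (g (e x))" if "f' x = d2"
        using yx[OF x] that e12[of "g (e x)"] gset_mapD(1)[OF ED(5) x] ED(9)[OF x] r12 by simp
    qed (use d r12 in auto)
  qed
  have \<eta>_inj: "inj_on \<eta> (pts E)"
  proof (rule inj_onI)
    fix x1 x2 assume x: "x1 \<in> pts E" "x2 \<in> pts E" "\<eta> x1 = \<eta> x2"
    have "f' x1 = f' x2" "g (e x1) = g (e x2)"
      using x \<eta>(2)[OF x(1)] \<eta>(2)[OF x(2)] inj gset_mapD(1)[OF ED(6)] by (auto dest: inj_onD)
    then show "x1 = x2" using ED(10) x by blast
  qed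
  show ?thesis
    by (rule exI[of _ \<delta>], rule exI[of _ \<eta>]) (intro conjI ballI; (fact | (drule \<eta>(2), blast) | erule \<delta>_r | erule \<eta>e | rule \<eta>(1)))
qed

lemma bispan_composite_map:
  assumes c: "bispan_composite G b1 b2 c" and c': "bispan_composite G b1 b2 c'"
  shows "\<exists>\<alpha> \<beta>. gset_map G (apexA c) (apexA c') \<alpha> \<and> inj_on \<alpha> (pts (apexA c)) \<and>
    gset_map G (apexB c) (apexB c') \<beta> \<and> inj_on \<beta> (pts (apexB c)) \<and>
    (\<forall>a\<in>pts (apexA c). legp c' (\<alpha> a) = legp c a \<and> legf c' (\<alpha> a) = \<beta> (legf c a)) \<and>
    (\<forall>x\<in>pts (apexB c). legq c' (\<beta> x) = legq c x)"
proof -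
  obtain P u v E e f' r n m where
    P: "pullback G P u v (apexB b1) (legq b1) (apexA b2) (legp b2) (tgt b1)" and
    X: "exponential G P v (apexA b2) (legf b2) (apexB b2) E e f' (apexB c) r" and
    N: "pullback G (apexA c) n m (apexA b1) (legf b1) E (\<lambda>x. u (e x)) (apexB b1)" and
    ca: "\<forall>x\<in>pts (apexA c). legp c x = legp b1 (n x) \<and> legf c x = f' (m x)" and
    cb: "\<forall>x\<in>pts (apexB c). legq c x = legq b2 (r x)"
    using c unfolding bispan_composite_def by blast
  obtain P' u' v' E' e' f'' r' n' m' where
    P': "pullback G P' u' v' (apexB b1) (legq b1) (apexA b2) (legp b2) (tgt b1)" and
    X': "exponential G P' v' (apexA b2) (legf b2) (apexB b2) E' e' f'' (apexB c') r'" and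
    N': "pullback G (apexA c') n' m' (apexA b1) (legf b1) E' (\<lambda>x. u' (e' x)) (apexB b1)" and
    ca': "\<forall>x\<in>pts (apexA c'). legp c' x = legp b1 (n' x) \<and> legf c' x = f'' (m' x)" and
    cb': "\<forall>x\<in>pts (apexB c'). legq c' x = legq b2 (r' x)"
    using c' unfolding bispan_composite_def by blast
  note PD = pullbackD[OF P] and ND = pullbackD[OF N]
  obtain w where w: "gset_map G P P' w" "\<And>q. q \<in> pts P \<Longrightarrow> u' (w q) = u q \<and> v' (w q) = v q"
    by (rule pullback_map[OF P' PD(1) PD(5) PD(6) PD(9)]) (assumption, rule that, assumption+)
  have w_inj: "inj_on w (pts P)"
  proof (rule inj_onI)
    fix p q assume pq: "p \<in> pts P" "q \<in> pts P" "w p = w q"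
    show "p = q" by (rule PD(10)[OF pq(1,2)]) (use pq w(2)[OF pq(1)] w(2)[OF pq(2)] in auto)
  qed
  have vw: "\<forall>p\<in>pts P. v' (w p) = v p" using w(2) by simp
  obtain \<delta> \<eta> where \<delta>: "gset_map G (apexB c) (apexB c') \<delta>" "inj_on \<delta> (pts (apexB c))"
    and \<eta>: "gset_map G E E' \<eta>" "inj_on \<eta> (pts E)"
    and r0: "\<forall>d\<in>pts (apexB c). r' (\<delta> d) = r d"
    and fe0: "\<forall>x\<in>pts E. f'' (\<eta> x) = \<delta> (f' x) \<and> e' (\<eta> x) = w (e x)"
    using exponential_map[OF X X' w(1) w_inj vw] by (elim exE conjE)
  note r = bspec[OF r0] and fe = bspec[OF fe0]
  have e: "e x \<in> pts P" if "x \<in> pts E" for x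
    using X that by (auto simp: exponential_def gset_map_def)
  have m: "m x \<in> pts E" if "x \<in> pts (apexA c)" for x using gset_mapD(1)[OF ND(6) that] .
  obtain \<alpha> where \<alpha>: "gset_map G (apexA c) (apexA c') \<alpha>"
    "\<And>x. x \<in> pts (apexA c) \<Longrightarrow> n' (\<alpha> x) = n x \<and> m' (\<alpha> x) = \<eta> (m x)"
  proof (rule pullback_map[OF N' ND(1) ND(5) gset_map_comp[OF ND(6) \<eta>(1)]])
    show "legf b1 (n q) = u' (e' (\<eta> (m q)))" if "q \<in> pts (apexA c)" for q
      using ND(9)[OF that] fe[OF m[OF that]] w(2)[OF e[OF m[OF that]]] by simp
  qed auto
  have \<alpha>_inj: "inj_on \<alpha> (pts (apexA c))"
  proof (rule inj_onI)
    fix x y assume xy: "x \<in> pts (apexA c)" "y \<in> pts (apexA c)" "\<alpha> x = \<alpha> y"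
    then have "n x = n y" "\<eta> (m x) = \<eta> (m y)" using \<alpha>(2) by metis+
    then show "x = y" using ND(10) \<eta>(2) xy m by (metis inj_onD)
  qed
  have ABa: "legp c' (\<alpha> a) = legp c a \<and> legf c' (\<alpha> a) = \<delta> (legf c a)" if "a \<in> pts (apexA c)" for a
    using that ca ca' \<alpha>(2)[OF that] gset_mapD(1)[OF \<alpha>(1) that] fe[OF m[OF that]] by simp
  have Bb: "legq c' (\<delta> x) = legq c x" if "x \<in> pts (apexB c)" for x
    using bspec[OF cb that] bspec[OF cb' gset_mapD(1)[OF \<delta>(1) that]] r[OF that] by simp
  show ?thesis
    by (rule exI[of _ \<alpha>], rule exI[of _ \<delta>])
      (intro conjI \<alpha>(1) \<alpha>_inj \<delta> ballI, simp_all only: ABa Bb)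
qed

lemma bispan_composite_unique:
  assumes c: "bispan_composite G b1 b2 c" and c': "bispan_composite G b1 b2 c'"
  shows "bispan_iso G c c'"
proof -
  have fin: "finite (pts (apexA c))" "finite (pts (apexB c))" "finite (pts (apexA c'))" "finite (pts (apexB c'))"
    and st: "src c = src c'" "tgt c = tgt c'"
    using c c' by (auto simp: bispan_composite_def is_bispan_def fin_gset_def)
  obtain \<alpha> \<beta> where m: "gset_map G (apexA c) (apexA c') \<alpha>" "inj_on \<alpha> (pts (apexA c))"
    "gset_map G (apexB c) (apexB c') \<beta>" "inj_on \<beta> (pts (apexB c))"
    "\<forall>a\<in>pts (apexA c). legp c' (\<alpha> a) = legp c a \<and> legf c' (\<alpha> a) = \<beta> (legf c a)"
    "\<forall>x\<in>pts (apexB c). legq c' (\<beta> x) = legq c x"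
    using bispan_composite_map[OF c c'] by (elim exE conjE)
  obtain \<alpha>' \<beta>' where m': "gset_map G (apexA c') (apexA c) \<alpha>'" "inj_on \<alpha>' (pts (apexA c'))"
    "gset_map G (apexB c') (apexB c) \<beta>'" "inj_on \<beta>' (pts (apexB c'))"
    using bispan_composite_map[OF c' c] by (elim exE conjE)
  have bij: "bij_betw h (pts X) (pts Y)"
    if "gset_map G X Y h" "inj_on h (pts X)" "gset_map G Y X h'" "inj_on h' (pts Y)"
      "finite (pts X)" "finite (pts Y)" for h h' and X Y :: "'a gset"
  proof -
    have 1: "h ` pts X \<subseteq> pts Y" "h' ` pts Y \<subseteq> pts X" using that by (auto simp: gset_map_def)
    then have "card (pts X) = card (pts Y)"
      by (intro antisym card_inj_on_le[OF that(2) 1(1) that(6)] card_inj_on_le[OF that(4) 1(2) that(5)])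
    then have "h ` pts X = pts Y"
      by (intro card_subset_eq that 1) (simp add: card_image that)
    then show ?thesis using that by (simp add: bij_betw_def)
  qed
  show ?thesis
    unfolding bispan_iso_def
    by (rule conjI[OF st(1) conjI[OF st(2)]], rule exI[of _ \<alpha>], rule exI[of _ \<beta>])
      (intro conjI m bij[OF m(1,2) m'(1,2) fin(1,3)] bij[OF m(3,4) m'(3,4) fin(2,4)])
qed

lemma bispan_iso_refl: "is_bispan G b \<Longrightarrow> bispan_iso G b b"
  by (auto simp: bispan_iso_def gset_map_def intro!: exI[of _ id])

lemma bispan_iso_trans:
  assumes "bispan_iso G a b" "bispan_iso G b c"
  shows "bispan_iso G a c"
proof -
  obtain \<alpha> \<beta> where m: "gset_map G (apexA a) (apexA b) \<alpha>" "bij_betw \<alpha> (pts (apexA a)) (pts (apexA b))"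
    "gset_map G (apexB a) (apexB b) \<beta>" "bij_betw \<beta> (pts (apexB a)) (pts (apexB b))"
    "\<forall>x\<in>pts (apexA a). legp b (\<alpha> x) = legp a x \<and> legf b (\<alpha> x) = \<beta> (legf a x)"
    "\<forall>x\<in>pts (apexB a). legq b (\<beta> x) = legq a x"
    using assms(1) by (auto simp: bispan_iso_def)
  obtain \<alpha>' \<beta>' where m': "gset_map G (apexA b) (apexA c) \<alpha>'" "bij_betw \<alpha>' (pts (apexA b)) (pts (apexA c))"
    "gset_map G (apexB b) (apexB c) \<beta>'" "bij_betw \<beta>' (pts (apexB b)) (pts (apexB c))"
    "\<forall>x\<in>pts (apexA b). legp c (\<alpha>' x) = legp b x \<and> legf c (\<alpha>' x) = \<beta>' (legf b x)"
    "\<forall>x\<in>pts (apexB b). legq c (\<beta>' x) = legq b x"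
    using assms(2) by (auto simp: bispan_iso_def)
  show ?thesis
    unfolding bispan_iso_def
  proof (intro conjI exI)
    show "src a = src c" "tgt a = tgt c" using assms by (auto simp: bispan_iso_def)
    show "gset_map G (apexA a) (apexA c) (\<lambda>x. \<alpha>' (\<alpha> x))" "gset_map G (apexB a) (apexB c) (\<lambda>x. \<beta>' (\<beta> x))"
      by (rule gset_map_comp[OF m(1) m'(1)], rule gset_map_comp[OF m(3) m'(3)])
    show "bij_betw (\<lambda>x. \<alpha>' (\<alpha> x)) (pts (apexA a)) (pts (apexA c))"
      "bij_betw (\<lambda>x. \<beta>' (\<beta> x)) (pts (apexB a)) (pts (apexB c))"
      using bij_betw_trans[OF m(2) m'(2)] bij_betw_trans[OF m(4) m'(4)] by (simp_all add: comp_def)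
    show "\<forall>x\<in>pts (apexA a). legp c (\<alpha>' (\<alpha> x)) = legp a x \<and> legf c (\<alpha>' (\<alpha> x)) = \<beta>' (\<beta> (legf a x))"
      "\<forall>x\<in>pts (apexB a). legq c (\<beta>' (\<beta> x)) = legq a x"
      using m(5,6) m'(5,6) gset_mapD(1)[OF m(1)] gset_mapD(1)[OF m(3)] by simp_all
  qed
qed

lemma bispan_iso_sym:
  assumes b: "is_bispan G b" and i: "bispan_iso G b b'"
  shows "bispan_iso G b' b"
proof -
  obtain \<alpha> \<beta> where m: "gset_map G (apexA b) (apexA b') \<alpha>" "bij_betw \<alpha> (pts (apexA b)) (pts (apexA b'))"
    "gset_map G (apexB b) (apexB b') \<beta>" "bij_betw \<beta> (pts (apexB b)) (pts (apexB b'))"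
    "\<forall>x\<in>pts (apexA b). legp b' (\<alpha> x) = legp b x \<and> legf b' (\<alpha> x) = \<beta> (legf b x)"
    "\<forall>x\<in>pts (apexB b). legq b' (\<beta> x) = legq b x"
    using i by (auto simp: bispan_iso_def)
  let ?\<alpha> = "inv_into (pts (apexA b)) \<alpha>" and ?\<beta> = "inv_into (pts (apexB b)) \<beta>"
  have f: "legf b x \<in> pts (apexB b)" if "x \<in> pts (apexA b)" for x
    using b that by (auto simp: is_bispan_def gset_map_def)
  have A: "\<exists>z\<in>pts (apexA b). x = \<alpha> z" if "x \<in> pts (apexA b')" for x
    using m(2) that unfolding bij_betw_def by blast
  have B: "\<exists>z\<in>pts (apexB b). x = \<beta> z" if "x \<in> pts (apexB b')" for x
    using m(4) that unfolding bij_betw_def by blast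
  have invA: "?\<alpha> (\<alpha> z) = z" if "z \<in> pts (apexA b)" for z using m(2) that by (simp add: bij_betw_def)
  have invB: "?\<beta> (\<beta> z) = z" if "z \<in> pts (apexB b)" for z using m(4) that by (simp add: bij_betw_def)
  show ?thesis
    unfolding bispan_iso_def
  proof (intro conjI exI)
    show "src b' = src b" "tgt b' = tgt b" using i by (auto simp: bispan_iso_def)
    show "gset_map G (apexA b') (apexA b) ?\<alpha>" "gset_map G (apexB b') (apexB b) ?\<beta>"
      using gset_map_inv m b by (auto simp: is_bispan_def)
    show "bij_betw ?\<alpha> (pts (apexA b')) (pts (apexA b))" "bij_betw ?\<beta> (pts (apexB b')) (pts (apexB b))"
      using m by (auto simp: bij_betw_inv_into)
    show "\<forall>x\<in>pts (apexA b'). legp b (?\<alpha> x) = legp b' x \<and> legf b (?\<alpha> x) = ?\<beta> (legf b' x)"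
    proof
      fix x assume "x \<in> pts (apexA b')"
      then obtain z where z: "z \<in> pts (apexA b)" "x = \<alpha> z" using A by blast
      have "legp b' x = legp b z" "legf b' x = \<beta> (legf b z)" using bspec[OF m(5) z(1)] z(2) by auto
      then show "legp b (?\<alpha> x) = legp b' x \<and> legf b (?\<alpha> x) = ?\<beta> (legf b' x)"
        using invA[OF z(1)] invB[OF f[OF z(1)]] z(2) by simp
    qed
    show "\<forall>x\<in>pts (apexB b'). legq b (?\<beta> x) = legq b' x"
    proof
      fix x assume "x \<in> pts (apexB b')"
      then obtain z where z: "z \<in> pts (apexB b)" "x = \<beta> z" using B by blast
      show "legq b (?\<beta> x) = legq b' x" using bspec[OF m(6) z(1)] invB[OF z(1)] z(2) by simp
    qed
  qed
qed

lemma bispan_class_eq_iff: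
  assumes "is_bispan G b" "is_bispan G b'"
  shows "bispan_class G b = bispan_class G b' \<longleftrightarrow> bispan_iso G b b'"
proof
  assume "bispan_class G b = bispan_class G b'"
  moreover have "b' \<in> bispan_class G b'"
    using assms by (simp add: bispan_class_def bispan_iso_refl)
  ultimately have "b' \<in> bispan_class G b" by simp
  then show "bispan_iso G b b'" by (simp add: bispan_class_def)
next
  assume i: "bispan_iso G b b'"
  show "bispan_class G b = bispan_class G b'"
    unfolding bispan_class_def
    using bispan_iso_trans[OF i] bispan_iso_trans[OF bispan_iso_sym[OF assms(1) i]] by blast
qed

lemma bispan_composite_iso_factors:
  assumes c: "bispan_composite G b1 b2 c"
    and i1: "is_bispan G b1'" "bispan_iso G b1 b1'" and i2: "is_bispan G b2'" "bispan_iso G b2 b2'"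
  shows "bispan_composite G b1' b2' c"
proof -
  obtain P u v E e f' r n m where
    P: "pullback G P u v (apexB b1) (legq b1) (apexA b2) (legp b2) (tgt b1)" and
    X: "exponential G P v (apexA b2) (legf b2) (apexB b2) E e f' (apexB c) r" and
    N: "pullback G (apexA c) n m (apexA b1) (legf b1) E (\<lambda>x. u (e x)) (apexB b1)" and
    ca: "\<forall>x\<in>pts (apexA c). legp c x = legp b1 (n x) \<and> legf c x = f' (m x)" and
    cb: "\<forall>x\<in>pts (apexB c). legq c x = legq b2 (r x)"
    using c unfolding bispan_composite_def by blast
  obtain \<alpha>1 \<beta>1 where m1: "gset_map G (apexA b1) (apexA b1') \<alpha>1" "bij_betw \<alpha>1 (pts (apexA b1)) (pts (apexA b1'))"
    "gset_map G (apexB b1) (apexB b1') \<beta>1" "bij_betw \<beta>1 (pts (apexB b1)) (pts (apexB b1'))"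
    "\<forall>x\<in>pts (apexA b1). legp b1' (\<alpha>1 x) = legp b1 x \<and> legf b1' (\<alpha>1 x) = \<beta>1 (legf b1 x)"
    "\<forall>x\<in>pts (apexB b1). legq b1' (\<beta>1 x) = legq b1 x" and s1: "src b1' = src b1" "tgt b1' = tgt b1"
    using i1(2) by (auto simp: bispan_iso_def)
  obtain \<alpha>2 \<beta>2 where m2: "gset_map G (apexA b2) (apexA b2') \<alpha>2" "bij_betw \<alpha>2 (pts (apexA b2)) (pts (apexA b2'))"
    "gset_map G (apexB b2) (apexB b2') \<beta>2" "bij_betw \<beta>2 (pts (apexB b2)) (pts (apexB b2'))"
    "\<forall>x\<in>pts (apexA b2). legp b2' (\<alpha>2 x) = legp b2 x \<and> legf b2' (\<alpha>2 x) = \<beta>2 (legf b2 x)"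
    "\<forall>x\<in>pts (apexB b2). legq b2' (\<beta>2 x) = legq b2 x" and s2: "src b2' = src b2" "tgt b2' = tgt b2"
    using i2(2) by (auto simp: bispan_iso_def)
  note D1 = i1(1)[unfolded is_bispan_def] and D2 = i2(1)[unfolded is_bispan_def]
  note PD = pullbackD[OF P] and ND = pullbackD[OF N]
  have Ep: "pullback G E (\<lambda>x. v (e x)) f' (apexA b2) (legf b2) (apexB c) r (apexB b2)"
    and e: "gset_map G E P e" and v: "gset_map G P (apexA b2) v"
    and uni: "\<And>b s. b \<in> pts (apexB b2) \<Longrightarrow> (\<forall>a\<in>pts (apexA b2). legf b2 a = b \<longrightarrow> s a \<in> pts P \<and> v (s a) = a) \<Longrightarrow>
       (\<exists>!d. d \<in> pts (apexB c) \<and> r d = b \<and> (\<forall>x\<in>pts E. f' x = d \<longrightarrow> e x = s (v (e x))))"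
    using X unfolding exponential_def by auto
  note ED = pullbackD[OF Ep]
  have st: "tgt b1 = src b2" using c by (auto simp: bispan_composite_def)
  have A1: "\<exists>z\<in>pts (apexA b1). x = \<alpha>1 z" if "x \<in> pts (apexA b1')" for x
    using m1(2) that unfolding bij_betw_def by blast
  have A2: "\<exists>z\<in>pts (apexA b2). x = \<alpha>2 z" if "x \<in> pts (apexA b2')" for x
    using m2(2) that unfolding bij_betw_def by blast
  have B1: "\<exists>z\<in>pts (apexB b1). x = \<beta>1 z" if "x \<in> pts (apexB b1')" for x
    using m1(4) that unfolding bij_betw_def by blast
  have B2: "\<exists>z\<in>pts (apexB b2). x = \<beta>2 z" if "x \<in> pts (apexB b2')" for x
    using m2(4) that unfolding bij_betw_def by blast
  have inj: "inj_on \<alpha>1 (pts (apexA b1))" "inj_on \<beta>1 (pts (apexB b1))"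
    "inj_on \<alpha>2 (pts (apexA b2))" "inj_on \<beta>2 (pts (apexB b2))"
    using m1 m2 by (auto simp: bij_betw_def)
  have P': "pullback G P (\<lambda>x. \<beta>1 (u x)) (\<lambda>x. \<alpha>2 (v x)) (apexB b1') (legq b1') (apexA b2') (legp b2') (tgt b1')"
  proof (rule pullbackI)
    show "gset_map G P (apexB b1') (\<lambda>x. \<beta>1 (u x))" "gset_map G P (apexA b2') (\<lambda>x. \<alpha>2 (v x))"
      using gset_map_comp PD m1 m2 by blast+
    show "legq b1' (\<beta>1 (u p)) = legp b2' (\<alpha>2 (v p))" if "p \<in> pts P" for p
      using m1(6) m2(5) PD(9)[OF that] gset_mapD(1)[OF PD(5) that] gset_mapD(1)[OF PD(6) that] by simp
    show "p = q" if "p \<in> pts P" "q \<in> pts P" "\<beta>1 (u p) = \<beta>1 (u q)" "\<alpha>2 (v p) = \<alpha>2 (v q)" for p q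
    proof (rule PD(10)[OF that(1,2)])
      show "u p = u q" by (rule inj_onD[OF inj(2) that(3)]) (rule gset_mapD(1)[OF PD(5)], fact)+
      show "v p = v q" by (rule inj_onD[OF inj(3) that(4)]) (rule gset_mapD(1)[OF PD(6)], fact)+
    qed
    show "\<exists>p\<in>pts P. \<beta>1 (u p) = a \<and> \<alpha>2 (v p) = b"
      if ab: "a \<in> pts (apexB b1')" "b \<in> pts (apexA b2')" "legq b1' a = legp b2' b" for a b
    proof -
      obtain a0 b0 where 0: "a0 \<in> pts (apexB b1)" "a = \<beta>1 a0" "b0 \<in> pts (apexA b2)" "b = \<alpha>2 b0"
        using B1[OF ab(1)] A2[OF ab(2)] by blast
      then have "legq b1 a0 = legp b2 b0" using m1(6) m2(5) ab by simp
      then show ?thesis using PD(11)[OF 0(1) 0(3)] 0 by blast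
    qed
  qed (use D1 D2 PD(1) s1 s2 st in auto)
  have E': "pullback G E (\<lambda>x. \<alpha>2 (v (e x))) f' (apexA b2') (legf b2') (apexB c) (\<lambda>x. \<beta>2 (r x)) (apexB b2')"
  proof (rule pullbackI)
    show "gset_map G E (apexA b2') (\<lambda>x. \<alpha>2 (v (e x)))" by (rule gset_map_comp[OF ED(5) m2(1)])
    show "gset_map G (apexB c) (apexB b2') (\<lambda>x. \<beta>2 (r x))" by (rule gset_map_comp[OF ED(8) m2(3)])
    show "legf b2' (\<alpha>2 (v (e p))) = \<beta>2 (r (f' p))" if "p \<in> pts E" for p
      using m2(5) ED(9)[OF that] gset_mapD(1)[OF ED(5) that] by simp
    show "p = q" if "p \<in> pts E" "q \<in> pts E" "\<alpha>2 (v (e p)) = \<alpha>2 (v (e q))" "f' p = f' q" for p q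
    proof (rule ED(10)[OF that(1,2) _ that(4)])
      show "v (e p) = v (e q)" by (rule inj_onD[OF inj(3) that(3)]) (rule gset_mapD(1)[OF ED(5)], fact)+
    qed
    show "\<exists>p\<in>pts E. \<alpha>2 (v (e p)) = a \<and> f' p = d"
      if ad: "a \<in> pts (apexA b2')" "d \<in> pts (apexB c)" "legf b2' a = \<beta>2 (r d)" for a d
    proof -
      obtain a0 where 0: "a0 \<in> pts (apexA b2)" "a = \<alpha>2 a0" using A2[OF ad(1)] by blast
      have "\<beta>2 (legf b2 a0) = \<beta>2 (r d)" using m2(5) 0 ad by simp
      then have "legf b2 a0 = r d"
        by (rule inj_onD[OF inj(4) _ gset_mapD(1)[OF ED(7) 0(1)] gset_mapD(1)[OF ED(8) ad(2)]])
      then show ?thesis using ED(11)[OF 0(1) ad(2)] 0 by blast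
    qed
  qed (use D2 ED in auto)
  have X': "exponential G P (\<lambda>x. \<alpha>2 (v x)) (apexA b2') (legf b2') (apexB b2') E e f' (apexB c) (\<lambda>x. \<beta>2 (r x))"
    unfolding exponential_def
  proof (intro conjI ballI allI impI)
    fix b s assume b: "b \<in> pts (apexB b2')"
      and s: "\<forall>a\<in>pts (apexA b2'). legf b2' a = b \<longrightarrow> s a \<in> pts P \<and> \<alpha>2 (v (s a)) = a"
    obtain b0 where b0: "b0 \<in> pts (apexB b2)" "b = \<beta>2 b0" using B2[OF b] by blast
    have "s (\<alpha>2 a) \<in> pts P \<and> v (s (\<alpha>2 a)) = a" if a: "a \<in> pts (apexA b2)" "legf b2 a = b0" for a
    proof -
      have "\<alpha>2 a \<in> pts (apexA b2')" "legf b2' (\<alpha>2 a) = b"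
        using m2(5) a b0 gset_mapD(1)[OF m2(1) a(1)] by auto
      then have 1: "s (\<alpha>2 a) \<in> pts P" "\<alpha>2 (v (s (\<alpha>2 a))) = \<alpha>2 a" using s by blast+
      have "v (s (\<alpha>2 a)) = a" by (rule inj_onD[OF inj(3) 1(2) gset_mapD(1)[OF v 1(1)] a(1)])
      then show ?thesis using 1 by blast
    qed
    then have "\<exists>!d. d \<in> pts (apexB c) \<and> r d = b0 \<and> (\<forall>x\<in>pts E. f' x = d \<longrightarrow> e x = s (\<alpha>2 (v (e x))))"
      by (intro uni[OF b0(1)]) blast
    moreover have "r d = b0 \<longleftrightarrow> \<beta>2 (r d) = b" if "d \<in> pts (apexB c)" for d
      using inj_onD[OF inj(4) _ gset_mapD(1)[OF ED(8) that] b0(1)] b0(2) by blast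
    ultimately show "\<exists>!d. d \<in> pts (apexB c) \<and> \<beta>2 (r d) = b \<and>
        (\<forall>x\<in>pts E. f' x = d \<longrightarrow> e x = s (\<alpha>2 (v (e x))))"
      by (simp cong: conj_cong)
  qed (fact PD(1) gset_map_comp[OF v m2(1)] e E')+
  have N': "pullback G (apexA c) (\<lambda>x. \<alpha>1 (n x)) m (apexA b1') (legf b1') E (\<lambda>x. \<beta>1 (u (e x))) (apexB b1')"
  proof (rule pullbackI)
    show "gset_map G (apexA c) (apexA b1') (\<lambda>x. \<alpha>1 (n x))" by (rule gset_map_comp[OF ND(5) m1(1)])
    show "gset_map G E (apexB b1') (\<lambda>x. \<beta>1 (u (e x)))" by (rule gset_map_comp[OF ND(8) m1(3)])
    show "legf b1' (\<alpha>1 (n p)) = \<beta>1 (u (e (m p)))" if "p \<in> pts (apexA c)" for p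
      using m1(5) ND(9)[OF that] gset_mapD(1)[OF ND(5) that] by simp
    show "p = q" if "p \<in> pts (apexA c)" "q \<in> pts (apexA c)" "\<alpha>1 (n p) = \<alpha>1 (n q)" "m p = m q" for p q
    proof (rule ND(10)[OF that(1,2) _ that(4)])
      show "n p = n q" by (rule inj_onD[OF inj(1) that(3)]) (rule gset_mapD(1)[OF ND(5)], fact)+
    qed
    show "\<exists>p\<in>pts (apexA c). \<alpha>1 (n p) = a \<and> m p = d"
      if ad: "a \<in> pts (apexA b1')" "d \<in> pts E" "legf b1' a = \<beta>1 (u (e d))" for a d
    proof -
      obtain a0 where 0: "a0 \<in> pts (apexA b1)" "a = \<alpha>1 a0" using A1[OF ad(1)] by blast
      have "\<beta>1 (legf b1 a0) = \<beta>1 (u (e d))" using m1(5) 0 ad by simp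
      then have "legf b1 a0 = u (e d)"
        by (rule inj_onD[OF inj(2) _ gset_mapD(1)[OF ND(7) 0(1)] gset_mapD(1)[OF ND(8) ad(2)]])
      then show ?thesis using ND(11)[OF 0(1) ad(2)] 0 by blast
    qed
  qed (use D1 ND in auto)
  have "\<forall>x\<in>pts (apexA c). legp c x = legp b1' (\<alpha>1 (n x)) \<and> legf c x = f' (m x)"
    using ca m1(5) gset_mapD(1)[OF ND(5)] by simp
  moreover have "\<forall>x\<in>pts (apexB c). legq c x = legq b2' (\<beta>2 (r x))"
    using cb m2(6) gset_mapD(1)[OF ED(8)] by simp
  moreover have "is_bispan G c" "tgt b1' = src b2'" "src c = src b1'" "tgt c = tgt b2'"
    using c s1 s2 by (auto simp: bispan_composite_def)
  ultimately show ?thesis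
    unfolding bispan_composite_def
    by - (intro conjI i1(1) i2(1), assumption+, rule exI[of _ P], rule exI[of _ "\<lambda>x. \<beta>1 (u x)"],
      rule exI[of _ "\<lambda>x. \<alpha>2 (v x)"], rule exI[of _ E], rule exI[of _ e], rule exI[of _ f'],
      rule exI[of _ "\<lambda>x. \<beta>2 (r x)"], rule exI[of _ "\<lambda>x. \<alpha>1 (n x)"], rule exI[of _ m],
      intro conjI P' X' N', assumption+)
qed

lemma bispan_composite_iso:
  assumes c: "bispan_composite G b1 b2 c" and i: "is_bispan G c'" "bispan_iso G c c'"
  shows "bispan_composite G b1 b2 c'"
proof -
  obtain P u v E e f' r n m where
    P: "pullback G P u v (apexB b1) (legq b1) (apexA b2) (legp b2) (tgt b1)" and
    X: "exponential G P v (apexA b2) (legf b2) (apexB b2) E e f' (apexB c) r" and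
    N: "pullback G (apexA c) n m (apexA b1) (legf b1) E (\<lambda>x. u (e x)) (apexB b1)" and
    ca: "\<forall>x\<in>pts (apexA c). legp c x = legp b1 (n x) \<and> legf c x = f' (m x)" and
    cb: "\<forall>x\<in>pts (apexB c). legq c x = legq b2 (r x)" and
    st: "is_bispan G b1" "is_bispan G b2" "is_bispan G c" "tgt b1 = src b2" "src c = src b1" "tgt c = tgt b2"
    using c unfolding bispan_composite_def by blast
  have "bispan_iso G c' c" by (rule bispan_iso_sym[OF st(3) i(2)])
  then obtain \<alpha> \<beta> where m: "gset_map G (apexA c') (apexA c) \<alpha>" "bij_betw \<alpha> (pts (apexA c')) (pts (apexA c))"
    "gset_map G (apexB c') (apexB c) \<beta>" "bij_betw \<beta> (pts (apexB c')) (pts (apexB c))"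
    "\<forall>x\<in>pts (apexA c'). legp c (\<alpha> x) = legp c' x \<and> legf c (\<alpha> x) = \<beta> (legf c' x)"
    "\<forall>x\<in>pts (apexB c'). legq c (\<beta> x) = legq c' x" and s: "src c' = src c" "tgt c' = tgt c"
    by (auto simp: bispan_iso_def)
  note D = i(1)[unfolded is_bispan_def] and ND = pullbackD[OF N]
  have Ep: "pullback G E (\<lambda>x. v (e x)) f' (apexA b2) (legf b2) (apexB c) r (apexB b2)"
    using X unfolding exponential_def by auto
  note ED = pullbackD[OF Ep]
  let ?\<gamma> = "inv_into (pts (apexB c')) \<beta>"
  have \<gamma>: "?\<gamma> d \<in> pts (apexB c') \<and> \<beta> (?\<gamma> d) = d" if "d \<in> pts (apexB c)" for d
    using m(4) that by (metis bij_betw_def f_inv_into_f inv_into_into)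
  have \<gamma>\<beta>: "?\<gamma> (\<beta> d) = d" if "d \<in> pts (apexB c')" for d
    using m(4) that by (simp add: bij_betw_def)
  have \<gamma>m: "gset_map G (apexB c) (apexB c') ?\<gamma>" using D by (intro gset_map_inv m) auto
  have f'D: "f' x \<in> pts (apexB c)" if "x \<in> pts E" for x using gset_mapD(1)[OF ED(6) that] .
  have \<beta>D: "\<beta> d \<in> pts (apexB c)" if "d \<in> pts (apexB c')" for d using gset_mapD(1)[OF m(3) that] .
  have E': "pullback G E (\<lambda>x. v (e x)) (\<lambda>x. ?\<gamma> (f' x)) (apexA b2) (legf b2) (apexB c') (\<lambda>d. r (\<beta> d)) (apexB b2)"
  proof (rule pullbackI)
    show "gset_map G E (apexB c') (\<lambda>x. ?\<gamma> (f' x))" by (rule gset_map_comp[OF ED(6) \<gamma>m])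
    show "gset_map G (apexB c') (apexB b2) (\<lambda>d. r (\<beta> d))" by (rule gset_map_comp[OF m(3) ED(8)])
    show "legf b2 (v (e p)) = r (\<beta> (?\<gamma> (f' p)))" if "p \<in> pts E" for p
      using ED(9)[OF that] \<gamma>[OF f'D[OF that]] by simp
    show "p = q" if "p \<in> pts E" "q \<in> pts E" "v (e p) = v (e q)" "?\<gamma> (f' p) = ?\<gamma> (f' q)" for p q
    proof (rule ED(10)[OF that(1,2,3)])
      have "f' p = \<beta> (?\<gamma> (f' p))" using \<gamma>[OF f'D[OF that(1)]] by (simp only:)
      also have "\<dots> = \<beta> (?\<gamma> (f' q))" by (simp only: that(4))
      also have "\<dots> = f' q" using \<gamma>[OF f'D[OF that(2)]] by (simp only:)
      finally show "f' p = f' q" .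
    qed
    show "\<exists>p\<in>pts E. v (e p) = a \<and> ?\<gamma> (f' p) = d"
      if "a \<in> pts (apexA b2)" "d \<in> pts (apexB c')" "legf b2 a = r (\<beta> d)" for a d
      using ED(11)[OF that(1) \<beta>D[OF that(2)] that(3)] \<gamma>\<beta>[OF that(2)] by auto
  qed (use D ED in auto)
  have X': "exponential G P v (apexA b2) (legf b2) (apexB b2) E e (\<lambda>x. ?\<gamma> (f' x)) (apexB c') (\<lambda>d. r (\<beta> d))"
    unfolding exponential_def
  proof (intro conjI ballI allI impI)
    fix b s assume b: "b \<in> pts (apexB b2)"
      and s: "\<forall>a\<in>pts (apexA b2). legf b2 a = b \<longrightarrow> s a \<in> pts P \<and> v (s a) = a"
    have "\<exists>!d. d \<in> pts (apexB c) \<and> r d = b \<and> (\<forall>x\<in>pts E. f' x = d \<longrightarrow> e x = s (v (e x)))"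
      using X b s unfolding exponential_def by blast
    then obtain d where d: "d \<in> pts (apexB c) \<and> r d = b \<and> (\<forall>x\<in>pts E. f' x = d \<longrightarrow> e x = s (v (e x)))"
      and d_eq: "\<And>d'. d' \<in> pts (apexB c) \<and> r d' = b \<and> (\<forall>x\<in>pts E. f' x = d' \<longrightarrow> e x = s (v (e x))) \<Longrightarrow> d' = d"
      by blast
    show "\<exists>!d. d \<in> pts (apexB c') \<and> r (\<beta> d) = b \<and> (\<forall>x\<in>pts E. ?\<gamma> (f' x) = d \<longrightarrow> e x = s (v (e x)))"
    proof (rule ex1I[of _ "?\<gamma> d"])
      show "?\<gamma> d \<in> pts (apexB c') \<and> r (\<beta> (?\<gamma> d)) = b \<and>
          (\<forall>x\<in>pts E. ?\<gamma> (f' x) = ?\<gamma> d \<longrightarrow> e x = s (v (e x)))"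
      proof (intro conjI ballI impI)
        have dd: "d \<in> pts (apexB c)" "r d = b" using d by blast+
        then show "?\<gamma> d \<in> pts (apexB c')" "r (\<beta> (?\<gamma> d)) = b" using \<gamma>[of d] by simp_all
        fix x assume x: "x \<in> pts E" "?\<gamma> (f' x) = ?\<gamma> d"
        have "f' x = \<beta> (?\<gamma> (f' x))" using \<gamma>[OF f'D[OF x(1)]] by (simp only:)
        also have "\<dots> = d" using \<gamma>[OF dd(1)] by (simp only: x(2))
        finally have "f' x = d" .
        then show "e x = s (v (e x))" using d x(1) by blast
      qed
    next
      fix d' assume d': "d' \<in> pts (apexB c') \<and> r (\<beta> d') = b \<and> (\<forall>x\<in>pts E. ?\<gamma> (f' x) = d' \<longrightarrow> e x = s (v (e x)))"
      have d'D: "d' \<in> pts (apexB c')" using d' by blast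
      have "\<beta> d' = d"
      proof (rule d_eq, intro conjI ballI impI)
        show "\<beta> d' \<in> pts (apexB c)" by (rule \<beta>D[OF d'D])
        show "r (\<beta> d') = b" using d' by blast
        fix x assume x: "x \<in> pts E" "f' x = \<beta> d'"
        then have "?\<gamma> (f' x) = d'" using \<gamma>\<beta>[OF d'D] by simp
        then show "e x = s (v (e x))" using d' x(1) by blast
      qed
      then show "d' = ?\<gamma> d" using \<gamma>\<beta>[OF d'D] by simp
    qed
  next
    show "fin_gset G P" "gset_map G P (apexA b2) v" "gset_map G E P e"
      using X unfolding exponential_def by blast+
  qed (rule E')
  have \<alpha>D: "\<alpha> x \<in> pts (apexA c)" if "x \<in> pts (apexA c')" for x using gset_mapD(1)[OF m(1) that] .
  have N': "pullback G (apexA c') (\<lambda>x. n (\<alpha> x)) (\<lambda>x. m (\<alpha> x)) (apexA b1) (legf b1) E (\<lambda>x. u (e x)) (apexB b1)"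
  proof (rule pullbackI)
    show "gset_map G (apexA c') (apexA b1) (\<lambda>x. n (\<alpha> x))" by (rule gset_map_comp[OF m(1) ND(5)])
    show "gset_map G (apexA c') E (\<lambda>x. m (\<alpha> x))" by (rule gset_map_comp[OF m(1) ND(6)])
    show "legf b1 (n (\<alpha> p)) = u (e (m (\<alpha> p)))" if "p \<in> pts (apexA c')" for p
      using ND(9)[OF \<alpha>D[OF that]] .
    show "p = q" if "p \<in> pts (apexA c')" "q \<in> pts (apexA c')" "n (\<alpha> p) = n (\<alpha> q)" "m (\<alpha> p) = m (\<alpha> q)" for p q
    proof (rule inj_onD[OF bij_betw_imp_inj_on[OF m(2)] _ that(1,2)])
      show "\<alpha> p = \<alpha> q" by (rule ND(10)[OF \<alpha>D[OF that(1)] \<alpha>D[OF that(2)] that(3,4)])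
    qed
    show "\<exists>p\<in>pts (apexA c'). n (\<alpha> p) = a \<and> m (\<alpha> p) = b"
      if ab: "a \<in> pts (apexA b1)" "b \<in> pts E" "legf b1 a = u (e b)" for a b
    proof -
      obtain x where x: "x \<in> pts (apexA c)" "n x = a" "m x = b" using ND(11)[OF ab] by blast
      have "x \<in> \<alpha> ` pts (apexA c')" using m(2) x by (simp add: bij_betw_def)
      then show ?thesis using x by blast
    qed
  qed (use D ND in auto)
  have "legp c' x = legp b1 (n (\<alpha> x)) \<and> legf c' x = ?\<gamma> (f' (m (\<alpha> x)))" if x: "x \<in> pts (apexA c')" for x
  proof -
    have "legf c' x \<in> pts (apexB c')" using D x by (auto simp: gset_map_def)
    then have "legf c' x = ?\<gamma> (\<beta> (legf c' x))" by (rule \<gamma>\<beta>[symmetric])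
    also have "\<beta> (legf c' x) = f' (m (\<alpha> x))"
      using bspec[OF m(5) x] bspec[OF ca \<alpha>D[OF x]] by simp
    finally show ?thesis using bspec[OF m(5) x] bspec[OF ca \<alpha>D[OF x]] by simp
  qed
  then have "\<forall>x\<in>pts (apexA c'). legp c' x = legp b1 (n (\<alpha> x)) \<and> legf c' x = ?\<gamma> (f' (m (\<alpha> x)))"
    by blast
  moreover have "legq c' x = legq b2 (r (\<beta> x))" if "x \<in> pts (apexB c')" for x
    using bspec[OF m(6) that] bspec[OF cb \<beta>D[OF that]] by simp
  then have "\<forall>x\<in>pts (apexB c'). legq c' x = legq b2 (r (\<beta> x))" by blast
  moreover have "src c' = src b1" "tgt c' = tgt b2" using s st by simp_all
  ultimately show ?thesis
    unfolding bispan_composite_def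
    by - (intro conjI st(1,2,4) i(1), assumption+, rule exI[of _ P], rule exI[of _ u],
      rule exI[of _ v], rule exI[of _ E], rule exI[of _ e], rule exI[of _ "\<lambda>x. ?\<gamma> (f' x)"],
      rule exI[of _ "\<lambda>d. r (\<beta> d)"], rule exI[of _ "\<lambda>x. n (\<alpha> x)"], rule exI[of _ "\<lambda>x. m (\<alpha> x)"],
      intro conjI P X' N', assumption+)
qed

theorem bispan_comp_class:
  assumes c: "bispan_composite G b1 b2 c"
  shows "bispan_comp G (bispan_class G b1) (bispan_class G b2) = bispan_class G c"
proof (intro subset_antisym subsetI)
  fix c' assume "c' \<in> bispan_comp G (bispan_class G b1) (bispan_class G b2)"
  then obtain b1' b2' where b: "is_bispan G b1'" "bispan_iso G b1 b1'" "is_bispan G b2'" "bispan_iso G b2 b2'"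
    and c': "bispan_composite G b1' b2' c'" by (auto simp: bispan_comp_def bispan_class_def)
  have "bispan_composite G b1' b2' c" by (rule bispan_composite_iso_factors[OF c b])
  then have "bispan_iso G c c'" using c' by (rule bispan_composite_unique)
  then show "c' \<in> bispan_class G c" using c' unfolding bispan_class_def bispan_composite_def by blast
next
  fix c' assume "c' \<in> bispan_class G c"
  then have 1: "bispan_composite G b1 b2 c'"
    using bispan_composite_iso[OF c] by (simp add: bispan_class_def)
  have "is_bispan G b1" "is_bispan G b2" using c unfolding bispan_composite_def by blast+
  then have "b1 \<in> bispan_class G b1" "b2 \<in> bispan_class G b2"
    by (simp_all add: bispan_class_def bispan_iso_refl)
  then show "c' \<in> bispan_comp G (bispan_class G b1) (bispan_class G b2)"
    using 1 unfolding bispan_comp_def by blast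
qed

corollary bispan_comp_is_class:
  assumes "is_bispan G b1" "is_bispan G b2" "tgt b1 = src b2"
  obtains c where "is_bispan G c" "src c = src b1" "tgt c = tgt b2"
    "bispan_comp G (bispan_class G b1) (bispan_class G b2) = bispan_class G c"
proof -
  obtain c where c: "bispan_composite G b1 b2 c" using bispan_composite_exists[OF assms] ..
  have "is_bispan G c" "src c = src b1" "tgt c = tgt b2" using c unfolding bispan_composite_def by blast+
  then show thesis using bispan_comp_class[OF c] by (rule that)
qed

lemma fin_gset_subgroup:
  fixes G (structure)
  assumes H: "subgroup H G" and X: "fin_gset G X"
  shows "fin_gset (G\<lparr>carrier := H\<rparr>) X"
proof (rule fin_gsetI)
  have grp: "group G" by (rule fin_gsetD(1)[OF X])
  show "group (G\<lparr>carrier := H\<rparr>)" by (rule subgroup.subgroup_is_group[OF H grp])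
  have sub: "h \<in> carrier G" if "h \<in> carrier (G\<lparr>carrier := H\<rparr>)" for h
    using that subgroup.subset[OF H] by auto
  show "act X h \<in> extensional (pts X)" if "h \<in> carrier (G\<lparr>carrier := H\<rparr>)" for h
    using group_action.bij_prop0[of G "pts X" "act X" h] X sub[OF that]
    by (simp add: fin_gset_def Bij_def)
qed (use fin_gsetD[OF X] subgroup.subset[OF H] in \<open>auto simp: subset_iff\<close>)

lemma gset_map_subgroup:
  "subgroup H G \<Longrightarrow> gset_map G X Y f \<Longrightarrow> gset_map (G\<lparr>carrier := H\<rparr>) X Y f"
  using subgroup.subset[of H G] by (auto simp: gset_map_def)

lemma is_bispan_subgroup:
  "subgroup H G \<Longrightarrow> is_bispan G b \<Longrightarrow> is_bispan (G\<lparr>carrier := H\<rparr>) b"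
  by (simp add: is_bispan_def fin_gset_subgroup gset_map_subgroup)

lemma bispan_iso_subgroup:
  "subgroup H G \<Longrightarrow> bispan_iso G b b' \<Longrightarrow> bispan_iso (G\<lparr>carrier := H\<rparr>) b b'"
  using gset_map_subgroup[of H G "apexA b" "apexA b'"] gset_map_subgroup[of H G "apexB b" "apexB b'"]
  unfolding bispan_iso_def by blast



section \<open>Tambara functors\<close>

text \<open>Data of a functor from bispans to sets: \<open>Tob\<close> on objects, \<open>Tmap\<close> on isomorphism classes of
  bispans.\<close>

record ('g, 'v) tambara =
  Tob :: "'g gset \<Rightarrow> 'v set"
  Tmap :: "'g bispan set \<Rightarrow> 'v \<Rightarrow> 'v"

definition Tres :: "('g, 'm) monoid_scheme \<Rightarrow> ('g, 'v) tambara \<Rightarrow> 'g gset \<Rightarrow> 'g gset \<Rightarrow>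
    (nat \<Rightarrow> nat) \<Rightarrow> 'v \<Rightarrow> 'v" where
  "Tres G R X Y f = Tmap R (bispan_class G (res_bispan X Y f))"

definition Tnorm :: "('g, 'm) monoid_scheme \<Rightarrow> ('g, 'v) tambara \<Rightarrow> 'g gset \<Rightarrow> 'g gset \<Rightarrow>
    (nat \<Rightarrow> nat) \<Rightarrow> 'v \<Rightarrow> 'v" where
  "Tnorm G R X Y f = Tmap R (bispan_class G (norm_bispan X Y f))"

definition Ttr :: "('g, 'm) monoid_scheme \<Rightarrow> ('g, 'v) tambara \<Rightarrow> 'g gset \<Rightarrow> 'g gset \<Rightarrow>
    (nat \<Rightarrow> nat) \<Rightarrow> 'v \<Rightarrow> 'v" where
  "Ttr G R X Y f = Tmap R (bispan_class G (tr_bispan X Y f))"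

text \<open>The element of \<open>R(X \<squnion> X)\<close> corresponding to \<open>(x, y) \<in> R(X) \<times> R(X)\<close>, and the element of the one-point
  set \<open>R(\<emptyset>)\<close>.\<close>

definition Tpair :: "('g, 'm) monoid_scheme \<Rightarrow> ('g, 'v) tambara \<Rightarrow> 'g gset \<Rightarrow> 'v \<Rightarrow> 'v \<Rightarrow> 'v" where
  "Tpair G R X x y = (THE z. z \<in> Tob R (gset_sum X X) \<and>
     Tres G R X (gset_sum X X) inl z = x \<and> Tres G R X (gset_sum X X) inr z = y)"

definition Tpoint :: "('g, 'v) tambara \<Rightarrow> 'v" where
  "Tpoint R = (THE z. z \<in> Tob R gset_empty)"

definition Tring :: "('g, 'm) monoid_scheme \<Rightarrow> ('g, 'v) tambara \<Rightarrow> 'g gset \<Rightarrow> 'v ring" where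
  "Tring G R X = \<lparr>carrier = Tob R X,
     mult = (\<lambda>x y. Tnorm G R (gset_sum X X) X fold_map (Tpair G R X x y)),
     one = Tnorm G R gset_empty X id (Tpoint R),
     zero = Ttr G R gset_empty X id (Tpoint R),
     add = (\<lambda>x y. Ttr G R (gset_sum X X) X fold_map (Tpair G R X x y))\<rparr>"

text \<open>In the category of bispans the product of \<open>X\<close> and \<open>Y\<close> is \<open>X \<squnion> Y\<close>, with the restrictions along
  the two inclusions as projections, and the empty set is terminal.\<close>

locale tambara_functor =
  fixes G :: "('g, 'm) monoid_scheme" and R :: "('g, 'v) tambara"
  assumes group: "group G"
    and finite: "finite (carrier G)"
    and map_closed: "is_bispan G b \<Longrightarrow>
          Tmap R (bispan_class G b) \<in> Tob R (src b) \<rightarrow>\<^sub>E Tob R (tgt b)"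
    and map_id: "fin_gset G X \<Longrightarrow> Tmap R (bispan_class G (bispan_id X)) = (\<lambda>x\<in>Tob R X. x)"
    and map_comp: "is_bispan G b1 \<Longrightarrow> is_bispan G b2 \<Longrightarrow> tgt b1 = src b2 \<Longrightarrow>
          Tmap R (bispan_comp G (bispan_class G b1) (bispan_class G b2)) =
          compose (Tob R (src b1)) (Tmap R (bispan_class G b2)) (Tmap R (bispan_class G b1))"
    and preserves_terminal: "\<exists>z. Tob R gset_empty = {z}"
    and preserves_products: "fin_gset G X \<Longrightarrow> fin_gset G Y \<Longrightarrow>
          bij_betw (\<lambda>z. (Tres G R X (gset_sum X Y) inl z, Tres G R Y (gset_sum X Y) inr z))
            (Tob R (gset_sum X Y)) (Tob R X \<times> Tob R Y)"
    and additive_group: "fin_gset G X \<Longrightarrow> group (add_monoid (Tring G R X))"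

definition tambara_hom :: "('g, 'm) monoid_scheme \<Rightarrow> ('g, 'v) tambara \<Rightarrow> ('g, 'w) tambara \<Rightarrow>
    ('g gset \<Rightarrow> 'v \<Rightarrow> 'w) \<Rightarrow> bool" where
  "tambara_hom G R R' \<eta> \<longleftrightarrow>
     (\<forall>X. fin_gset G X \<longrightarrow> \<eta> X \<in> Tob R X \<rightarrow> Tob R' X) \<and>
     (\<forall>b. is_bispan G b \<longrightarrow> (\<forall>x\<in>Tob R (src b).
        \<eta> (tgt b) (Tmap R (bispan_class G b) x) = Tmap R' (bispan_class G b) (\<eta> (src b) x)))"

definition tambara_isomorphic ::
  "('g, 'm) monoid_scheme \<Rightarrow> ('g, 'v) tambara \<Rightarrow> ('g, 'w) tambara \<Rightarrow> bool" where
  "tambara_isomorphic G R R' \<longleftrightarrow> (\<exists>\<eta> \<theta>. tambara_hom G R R' \<eta> \<and> tambara_hom G R' R \<theta> \<and>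
     (\<forall>X. fin_gset G X \<longrightarrow>
        (\<forall>x\<in>Tob R X. \<theta> X (\<eta> X x) = x) \<and> (\<forall>y\<in>Tob R' X. \<eta> X (\<theta> X y) = y)))"

text \<open>Restriction of bispans from \<open>G\<close> to a subgroup \<open>H\<close>: the \<open>H\<close>-isomorphism class of a bispan of
  \<open>G\<close>-sets, which depends only on its \<open>G\<close>-isomorphism class.\<close>

definition res_class :: "('g, 'm) monoid_scheme \<Rightarrow> 'g set \<Rightarrow> 'g bispan set \<Rightarrow> 'g bispan set" where
  "res_class G H C = (\<Union>b\<in>C. bispan_class (G\<lparr>carrier := H\<rparr>) b)"

lemma res_class_bispan_class:
  assumes H: "subgroup H G" and b: "is_bispan G b"
  shows "res_class G H (bispan_class G b) = bispan_class (G\<lparr>carrier := H\<rparr>) b"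
proof -
  have "bispan_class (G\<lparr>carrier := H\<rparr>) b' = bispan_class (G\<lparr>carrier := H\<rparr>) b"
    if b': "b' \<in> bispan_class G b" for b'
  proof -
    have "is_bispan G b'" "bispan_iso G b b'" using b' by (auto simp: bispan_class_def)
    then show ?thesis
      using bispan_class_eq_iff[of "G\<lparr>carrier := H\<rparr>" b b'] is_bispan_subgroup[OF H] b
        bispan_iso_subgroup[OF H] by blast
  qed
  moreover have "b \<in> bispan_class G b" using b by (simp add: bispan_class_def bispan_iso_refl)
  ultimately show ?thesis unfolding res_class_def by blast
qed

definition tambara_coind ::
  "('g, 'm) monoid_scheme \<Rightarrow> 'g set \<Rightarrow> ('g, 'v) tambara \<Rightarrow> ('g, 'v) tambara" where
  "tambara_coind G H T = \<lparr>Tob = Tob T, Tmap = (\<lambda>C. Tmap T (res_class G H C))\<rparr>"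


section \<open>\<open>G\<close>-rings\<close>

definition G_ring :: "('g, 'm) monoid_scheme \<Rightarrow> ('s, 'k) ring_scheme \<Rightarrow> ('g \<Rightarrow> 's \<Rightarrow> 's) \<Rightarrow> bool" where
  "G_ring G S \<sigma> \<longleftrightarrow> cring S \<and> group_action G (carrier S) \<sigma> \<and> (\<forall>g\<in>carrier G. \<sigma> g \<in> ring_iso S S)"

definition G_ring_isomorphic ::
  "('g, 'm) monoid_scheme \<Rightarrow> ('s, 'k) ring_scheme \<Rightarrow> ('g \<Rightarrow> 's \<Rightarrow> 's) \<Rightarrow>
   ('t, 'l) ring_scheme \<Rightarrow> ('g \<Rightarrow> 't \<Rightarrow> 't) \<Rightarrow> bool" where
  "G_ring_isomorphic G S \<sigma> S' \<sigma>' \<longleftrightarrow>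
     (\<exists>\<phi>\<in>ring_iso S S'. \<forall>g\<in>carrier G. \<forall>x\<in>carrier S. \<phi> (\<sigma> g x) = \<sigma>' g (\<phi> x))"

text \<open>Since \<open>x \<mapsto> x\<gamma>\<delta>\<close> is \<open>x \<mapsto> x\<gamma>\<close> followed by right multiplication by \<open>\<delta>\<close> and restriction is
  contravariant, letting \<open>\<gamma>\<close> act by restriction along \<open>x \<mapsto> x\<gamma>\<close> is a left action.\<close>

definition Taction :: "('g, 'm) monoid_scheme \<Rightarrow> ('g, 'v) tambara \<Rightarrow> 'g \<Rightarrow> 'v \<Rightarrow> 'v" where
  "Taction G R \<gamma> = Tres G R (free_orbit G) (free_orbit G) (right_mult G \<gamma>)"

text \<open>The coinduced \<open>G\<close>-ring: as \<open>FP(S)(X)\<close> is the ring of \<open>H\<close>-equivariant maps \<open>X \<rightarrow> S\<close>, the ring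
  \<open>(Coind FP(S))(G/e)\<close> consists of the \<open>H\<close>-equivariant maps \<open>G \<rightarrow> S\<close>.\<close>

definition coind_carrier ::
  "('g, 'm) monoid_scheme \<Rightarrow> 'g set \<Rightarrow> ('s, 'k) ring_scheme \<Rightarrow> ('g \<Rightarrow> 's \<Rightarrow> 's) \<Rightarrow> ('g \<Rightarrow> 's) set" where
  "coind_carrier G H S \<sigma> = {f \<in> carrier G \<rightarrow>\<^sub>E carrier S.
     \<forall>h\<in>H. \<forall>x\<in>carrier G. f (h \<otimes>\<^bsub>G\<^esub> x) = \<sigma> h (f x)}"

definition coind_ring ::
  "('g, 'm) monoid_scheme \<Rightarrow> 'g set \<Rightarrow> ('s, 'k) ring_scheme \<Rightarrow> ('g \<Rightarrow> 's \<Rightarrow> 's) \<Rightarrow> ('g \<Rightarrow> 's) ring" where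
  "coind_ring G H S \<sigma> = \<lparr>carrier = coind_carrier G H S \<sigma>,
     mult = (\<lambda>f f'. \<lambda>x\<in>carrier G. f x \<otimes>\<^bsub>S\<^esub> f' x),
     one = (\<lambda>x\<in>carrier G. \<one>\<^bsub>S\<^esub>),
     zero = (\<lambda>x\<in>carrier G. \<zero>\<^bsub>S\<^esub>),
     add = (\<lambda>f f'. \<lambda>x\<in>carrier G. f x \<oplus>\<^bsub>S\<^esub> f' x)\<rparr>"

definition coind_action :: "('g, 'm) monoid_scheme \<Rightarrow> 'g \<Rightarrow> ('g \<Rightarrow> 's) \<Rightarrow> 'g \<Rightarrow> 's" where
  "coind_action G \<gamma> f = (\<lambda>x\<in>carrier G. f (x \<otimes>\<^bsub>G\<^esub> \<gamma>))"

end

theory Submission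
  imports Defs
begin

text \<open>
  Let \<open>J = G/H\<close>. The indicator function of \<open>H\<close> is an idempotent of the coinduced ring; let \<open>\<epsilon> \<in> R(G/e)\<close>
  (\<open>eps\<close>) be the element that corresponds to it. It is fixed by \<open>H\<close>, its translates by different
  cosets are orthogonal, and the translates add up to \<open>1\<close>. If \<open>R\<close> is coinduced from \<open>T\<close>, then
  \<open>R(G \<times>\<^sub>H Y) = T(res (G \<times>\<^sub>H Y))\<close>, and \<open>T(Y)\<close> is the summand of it that belongs to the copy of \<open>Y\<close> over the
  base point of \<open>J\<close>. So the task is to lift \<open>\<epsilon>\<close> to an idempotent \<open>d \<in> R(J)\<close>, to define \<open>T(Y)\<close> as
  \<open>d \<cdot> R(G \<times>\<^sub>H Y)\<close>, where \<open>d\<close> is pulled back along \<open>G \<times>\<^sub>H Y \<rightarrow> J\<close>, and to compare \<open>R(X)\<close> with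
  \<open>d \<cdot> R(G \<times>\<^sub>H X)\<close> through \<open>x \<mapsto> d \<cdot> pr\<^sup>* x\<close> and the transfer along \<open>pr : G \<times>\<^sub>H X \<rightarrow> X\<close>.

  The lift is \<open>d = N \<epsilon>\<close>, the norm along \<open>G/e \<rightarrow> J\<close> (\<open>coset_idem\<close>). For a general idempotent \<open>x\<close> of a Tambara functor
  \<open>N\<^sub>g g\<^sup>* x\<close> has little to do with \<open>x\<close>, but over a free \<open>G\<close>-set, where a norm is a product over the points
  of the fibres, it is \<open>x\<close> when \<open>g\<close> is surjective (\<open>norm_idempotent_free\<close>). Since \<open>d\<close> is a
  norm from a free set, base change carries this over: \<open>d\<^sub>B \<cdot> N\<^sub>g d\<^sub>C = d\<^sub>B\<close> for the pullbacks of \<open>d\<close> to \<open>B\<close> and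
  \<open>C\<close> and every \<open>g : C \<rightarrow> B\<close> over \<open>J\<close>, and \<open>N\<^sub>g d\<^sub>C = d\<^sub>B\<close> for surjective \<open>g\<close> (\<open>norm_idem_at\<close>). Hence
  multiplication by \<open>d\<close> is compatible with all bispans over \<open>J\<close> (\<open>absorb\<close>), and \<open>T\<close> is a Tambara functor.

  For the comparison, two maps to \<open>J\<close> that differ everywhere pull \<open>d\<close> back to orthogonal elements
  (\<open>idem_at_orthogonal\<close>), and the transfer of \<open>d\<close> to the point is \<open>1\<close> (\<open>transfer_coset_idem\<close>). The second fact
  is the heart of the proof. Over \<open>G/e\<close> it says that the translates of \<open>\<epsilon>\<close> add up to \<open>1\<close>. To descend, one takes
  the norm to the point of this sum and expands it by the distributive law. The terms are indexed by the
  orbits of maps from \<open>G\<close> to \<open>J\<close>. The constant maps form a copy of \<open>J\<close> and contribute the transfer of \<open>d\<close>. The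
  other terms vanish: the norm \<open>N v\<close> in question is the norm over the fibre square of the product of
  the two pullbacks of \<open>v\<close>, which is zero wherever the two values of the map differ
  (\<open>norm_idem_at_vanishes\<close>).

  Now Frobenius reciprocity gives \<open>Tr (d \<cdot> pr\<^sup>* x) = Tr(d) \<cdot> x = x\<close>, and \<open>d \<cdot> pr\<^sup>* (Tr y) = y\<close> for \<open>y = d \<cdot> y\<close> because the
  part of \<open>pr\<^sup>* \<circ> Tr\<close> away from the diagonal is killed by orthogonality. Finally \<open>G/e = G \<times>\<^sub>H H/e\<close>, where
  \<open>d\<close> restricts to \<open>\<epsilon>\<close>; so \<open>T(H/e) = \<epsilon> \<cdot> R(G/e)\<close> corresponds to the functions supported on \<open>H\<close>, that is, to \<open>S\<close>.
\<close>

section \<open>Restrictions, norms and transfers\<close>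

lemma pullback_id_right:
  assumes "fin_gset G A" "fin_gset G B" "gset_map G A B f"
  shows "pullback G A id f A f B id B"
  by (rule pullbackI) (use assms gset_mapD[OF assms(3)] in \<open>auto simp: gset_map_def\<close>)

lemma pullback_id_left:
  assumes "fin_gset G A" "fin_gset G B" "gset_map G B A f"
  shows "pullback G B f id A id B f A"
  by (rule pullbackI) (use assms gset_mapD[OF assms(3)] in \<open>auto simp: gset_map_def\<close>)

lemma pullback_sym:
  assumes P: "pullback G P u v A f B g C"
  shows "pullback G P v u B g A f C"
proof (rule pullbackI)
  note PD = pullbackD[OF P]
  show "g (v p) = f (u p)" if "p \<in> pts P" for p using PD(9)[OF that] by simp
  show "p = q" if "p \<in> pts P" "q \<in> pts P" "v p = v q" "u p = u q" for p q using PD(10) that by blast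
  show "\<exists>p\<in>pts P. v p = a \<and> u p = b" if "a \<in> pts B" "b \<in> pts A" "g a = f b" for a b
    using PD(11)[OF that(2,1)] that(3) by auto
qed (use pullbackD[OF P] in simp_all)

lemma exponential_along_id:
  assumes "fin_gset G P" "fin_gset G A" "gset_map G P A g"
  shows "exponential G P g A id A P id id P g"
  unfolding exponential_def
proof (intro conjI ballI allI impI)
  show "pullback G P (\<lambda>x. g (id x)) id A id P g A" using pullback_id_left[OF assms(2,1,3)] by simp
  show "gset_map G P P id" by (simp add: gset_map_def)
  show "\<exists>!d. d \<in> pts P \<and> g d = b \<and> (\<forall>x\<in>pts P. id x = d \<longrightarrow> id x = s (g (id x)))"
    if "b \<in> pts A" "\<forall>a\<in>pts A. id a = b \<longrightarrow> s a \<in> pts P \<and> g (s a) = a" for b s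
    by (rule ex1I[of _ "s b"]) (use that in auto)
qed (use assms in auto)

lemma exponential_of_id:
  assumes "fin_gset G A" "fin_gset G B" "gset_map G A B f"
  shows "exponential G A id A f B A id f B id"
  unfolding exponential_def
proof (intro conjI ballI allI impI)
  show "pullback G A (\<lambda>x. id (id x)) f A f B id B" using pullback_id_right[OF assms] by (simp add: id_def)
  show "gset_map G A A id" "gset_map G A A id" by (simp_all add: gset_map_def)
  show "\<exists>!d. d \<in> pts B \<and> id d = b \<and> (\<forall>x\<in>pts A. f x = d \<longrightarrow> id x = s (id (id x)))"
    if "b \<in> pts B" "\<forall>a\<in>pts A. f a = b \<longrightarrow> s a \<in> pts A \<and> id (s a) = a" for b s
    by (rule ex1I[of _ b]) (use that in auto)
qed (use assms in auto)

lemma gset_map_id [simp]: "gset_map G A A id" "gset_map G A A (\<lambda>x. x)"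
  by (simp_all add: gset_map_def)

lemma is_bispan_basic:
  assumes "fin_gset G A" "fin_gset G B" "gset_map G A B f"
  shows "is_bispan G (res_bispan A B f)" "is_bispan G (norm_bispan A B f)" "is_bispan G (tr_bispan A B f)"
  using assms by (simp_all add: is_bispan_def res_bispan_def norm_bispan_def tr_bispan_def)

text \<open>
  The witnesses in the definition of composites are many functions of one type, which proof search confuses; as
  a rule with these as separate premises the verification of a composite is a list of small goals.
\<close>

lemma bispan_compositeI:
  assumes "is_bispan G b1" "is_bispan G b2" "is_bispan G c"
    "tgt b1 = src b2" "src c = src b1" "tgt c = tgt b2"
    "pullback G P u v (apexB b1) (legq b1) (apexA b2) (legp b2) (tgt b1)"
    "exponential G P v (apexA b2) (legf b2) (apexB b2) E e f' (apexB c) r"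
    "pullback G (apexA c) n m (apexA b1) (legf b1) E (\<lambda>x. u (e x)) (apexB b1)"
    "\<And>x. x \<in> pts (apexA c) \<Longrightarrow> legp c x = legp b1 (n x)"
    "\<And>x. x \<in> pts (apexA c) \<Longrightarrow> legf c x = f' (m x)"
    "\<And>x. x \<in> pts (apexB c) \<Longrightarrow> legq c x = legq b2 (r x)"
  shows "bispan_composite G b1 b2 c"
  unfolding bispan_composite_def
  by (intro conjI assms(1-6), rule exI[of _ P], rule exI[of _ u], rule exI[of _ v], rule exI[of _ E],
    rule exI[of _ e], rule exI[of _ f'], rule exI[of _ r], rule exI[of _ n], rule exI[of _ m])
    (intro conjI ballI assms(7-12))

lemma composite_res_res:
  assumes "fin_gset G A" "fin_gset G B" "fin_gset G C" "gset_map G A B f" "gset_map G B C g"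
  shows "bispan_composite G (res_bispan B C g) (res_bispan A B f) (res_bispan A C (\<lambda>a. g (f a)))"
proof (rule bispan_compositeI)
  show "pullback G A f id (apexB (res_bispan B C g)) (legq (res_bispan B C g)) (apexA (res_bispan A B f))
      (legp (res_bispan A B f)) (tgt (res_bispan B C g))"
    using pullback_id_left[OF assms(2,1,4)] by (simp add: res_bispan_def)
  show "exponential G A id (apexA (res_bispan A B f)) (legf (res_bispan A B f)) (apexB (res_bispan A B f))
      A id id (apexB (res_bispan A C (\<lambda>a. g (f a)))) id"
    using exponential_of_id[OF assms(1,1), of id] by (simp add: res_bispan_def)
  show "pullback G (apexA (res_bispan A C (\<lambda>a. g (f a)))) f id (apexA (res_bispan B C g))
      (legf (res_bispan B C g)) A (\<lambda>x. f (id x)) (apexB (res_bispan B C g))"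
    using pullback_id_left[OF assms(2,1,4)] by (simp add: res_bispan_def)
qed (use is_bispan_basic assms gset_map_comp[OF assms(4,5)] in \<open>auto simp: res_bispan_def is_bispan_def\<close>)

lemma composite_norm_norm:
  assumes "fin_gset G A" "fin_gset G B" "fin_gset G C" "gset_map G A B f" "gset_map G B C g"
  shows "bispan_composite G (norm_bispan A B f) (norm_bispan B C g) (norm_bispan A C (\<lambda>a. g (f a)))"
proof (rule bispan_compositeI)
  let ?b1 = "norm_bispan A B f" and ?b2 = "norm_bispan B C g" and ?c = "norm_bispan A C (\<lambda>a. g (f a))"
  show "pullback G B id id (apexB ?b1) (legq ?b1) (apexA ?b2) (legp ?b2) (tgt ?b1)"
    using pullback_id_left[OF assms(2,2), of id] by (simp add: norm_bispan_def)
  show "exponential G B id (apexA ?b2) (legf ?b2) (apexB ?b2) B id g (apexB ?c) id"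
    using exponential_of_id[OF assms(2,3,5)] by (simp add: norm_bispan_def)
  show "pullback G (apexA ?c) id f (apexA ?b1) (legf ?b1) B (\<lambda>x. id (id x)) (apexB ?b1)"
    using pullback_id_right[OF assms(1,2,4)] by (simp add: norm_bispan_def id_def)
qed (use is_bispan_basic assms gset_map_comp[OF assms(4,5)] in \<open>auto simp: norm_bispan_def is_bispan_def\<close>)

lemma composite_tr_tr:
  assumes "fin_gset G A" "fin_gset G B" "fin_gset G C" "gset_map G A B f" "gset_map G B C g"
  shows "bispan_composite G (tr_bispan A B f) (tr_bispan B C g) (tr_bispan A C (\<lambda>a. g (f a)))"
proof (rule bispan_compositeI)
  let ?b1 = "tr_bispan A B f" and ?b2 = "tr_bispan B C g" and ?c = "tr_bispan A C (\<lambda>a. g (f a))"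
  show "pullback G A id f (apexB ?b1) (legq ?b1) (apexA ?b2) (legp ?b2) (tgt ?b1)"
    using pullback_id_right[OF assms(1,2,4)] by (simp add: tr_bispan_def)
  show "exponential G A f (apexA ?b2) (legf ?b2) (apexB ?b2) A id id (apexB ?c) f"
    using exponential_along_id[OF assms(1,2,4)] by (simp add: tr_bispan_def)
  show "pullback G (apexA ?c) id id (apexA ?b1) (legf ?b1) A (\<lambda>x. id (id x)) (apexB ?b1)"
    using pullback_id_right[OF assms(1,1), of id] by (simp add: tr_bispan_def id_def)
qed (use is_bispan_basic assms gset_map_comp[OF assms(4,5)] in \<open>auto simp: tr_bispan_def is_bispan_def\<close>)

text \<open>
  The general bispan \<open>X \<leftarrow> A \<rightarrow> B \<rightarrow> Y\<close> with its data as arguments, so that equality of classes can be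
  tested leg by leg.
\<close>

definition poly_bispan :: "'g gset \<Rightarrow> (nat \<Rightarrow> nat) \<Rightarrow> 'g gset \<Rightarrow> (nat \<Rightarrow> nat) \<Rightarrow> 'g gset \<Rightarrow> (nat \<Rightarrow> nat) \<Rightarrow> 'g gset \<Rightarrow> 'g bispan"
  where "poly_bispan X p A f B q Y = \<lparr>src = X, apexA = A, apexB = B, tgt = Y, legp = p, legf = f, legq = q\<rparr>"

lemma is_bispan_poly:
  "is_bispan G (poly_bispan X p A f B q Y) \<longleftrightarrow> fin_gset G X \<and> fin_gset G A \<and> fin_gset G B \<and> fin_gset G Y \<and>
    gset_map G A X p \<and> gset_map G A B f \<and> gset_map G B Y q"
  by (auto simp: is_bispan_def poly_bispan_def)

lemma is_bispan_as_poly: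
  "b = poly_bispan (src b) (legp b) (apexA b) (legf b) (apexB b) (legq b) (tgt b)"
  by (simp add: poly_bispan_def)

lemma bispanD:
  assumes "is_bispan K b"
  shows "fin_gset K (src b)" "fin_gset K (tgt b)" "fin_gset K (apexA b)" "fin_gset K (apexB b)"
    "gset_map K (apexA b) (src b) (legp b)" "gset_map K (apexA b) (apexB b) (legf b)" "gset_map K (apexB b) (tgt b) (legq b)"
  using assms by (auto simp: is_bispan_def)

lemma basic_bispans_poly:
  "res_bispan A B f = poly_bispan B f A id A id A"
  "norm_bispan A B f = poly_bispan A id A f B id B"
  "tr_bispan A B f = poly_bispan A id A id A f B"
  by (simp_all add: res_bispan_def norm_bispan_def tr_bispan_def poly_bispan_def)

lemma composite_res_norm:
  assumes "fin_gset G X" "fin_gset G A" "fin_gset G B" "gset_map G A X p" "gset_map G A B f"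
  shows "bispan_composite G (res_bispan A X p) (norm_bispan A B f) (poly_bispan X p A f B id B)"
proof (rule bispan_compositeI)
  let ?b1 = "res_bispan A X p" and ?b2 = "norm_bispan A B f" and ?c = "poly_bispan X p A f B id B"
  note d = res_bispan_def norm_bispan_def poly_bispan_def
  show "pullback G A id id (apexB ?b1) (legq ?b1) (apexA ?b2) (legp ?b2) (tgt ?b1)"
    using pullback_id_left[OF assms(2,2), of id] by (simp add: d)
  show "exponential G A id (apexA ?b2) (legf ?b2) (apexB ?b2) A id f (apexB ?c) id"
    using exponential_of_id[OF assms(2,3,5)] by (simp add: d)
  show "pullback G (apexA ?c) id id (apexA ?b1) (legf ?b1) A (\<lambda>x. id (id x)) (apexB ?b1)"
    using pullback_id_right[OF assms(2,2), of id] by (simp add: d id_def)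
qed (use is_bispan_basic assms in \<open>auto simp: res_bispan_def norm_bispan_def poly_bispan_def is_bispan_def\<close>)

lemma composite_poly_tr:
  assumes "fin_gset G X" "fin_gset G A" "fin_gset G B" "fin_gset G Y"
    "gset_map G A X p" "gset_map G A B f" "gset_map G B Y q"
  shows "bispan_composite G (poly_bispan X p A f B id B) (tr_bispan B Y q) (poly_bispan X p A f B q Y)"
proof (rule bispan_compositeI)
  let ?b1 = "poly_bispan X p A f B id B" and ?b2 = "tr_bispan B Y q" and ?c = "poly_bispan X p A f B q Y"
  note d = tr_bispan_def poly_bispan_def
  show "pullback G B id id (apexB ?b1) (legq ?b1) (apexA ?b2) (legp ?b2) (tgt ?b1)"
    using pullback_id_left[OF assms(3,3), of id] by (simp add: d)
  show "exponential G B id (apexA ?b2) (legf ?b2) (apexB ?b2) B id id (apexB ?c) id"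
    using exponential_of_id[OF assms(3,3), of id] by (simp add: d)
  show "pullback G (apexA ?c) id f (apexA ?b1) (legf ?b1) B (\<lambda>x. id (id x)) (apexB ?b1)"
    using pullback_id_right[OF assms(2,3,6)] by (simp add: d id_def)
qed (use is_bispan_basic assms in \<open>auto simp: tr_bispan_def poly_bispan_def is_bispan_def\<close>)

lemma composite_norm_res:
  assumes P: "pullback G P u v A f B g C"
  shows "bispan_composite G (norm_bispan A C f) (res_bispan B C g) (poly_bispan A u P v B id B)"
proof (rule bispan_compositeI)
  note PD = pullbackD[OF P]
  let ?b1 = "norm_bispan A C f" and ?b2 = "res_bispan B C g" and ?c = "poly_bispan A u P v B id B"
  note d = norm_bispan_def res_bispan_def poly_bispan_def
  show "pullback G B g id (apexB ?b1) (legq ?b1) (apexA ?b2) (legp ?b2) (tgt ?b1)"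
    using pullback_id_left[OF PD(4,3,8)] by (simp add: d)
  show "exponential G B id (apexA ?b2) (legf ?b2) (apexB ?b2) B id id (apexB ?c) id"
    using exponential_of_id[OF PD(3,3), of id] by (simp add: d)
  show "pullback G (apexA ?c) u v (apexA ?b1) (legf ?b1) B (\<lambda>x. g (id x)) (apexB ?b1)"
    using P by (simp add: d)
qed (use is_bispan_basic pullbackD(1-8)[OF P] in \<open>auto simp: norm_bispan_def res_bispan_def poly_bispan_def is_bispan_def\<close>)

lemma composite_tr_res:
  assumes P: "pullback G P u v A f B g C"
  shows "bispan_composite G (tr_bispan A C f) (res_bispan B C g) (poly_bispan A u P id P v B)"
proof (rule bispan_compositeI)
  note PD = pullbackD[OF P]
  let ?b1 = "tr_bispan A C f" and ?b2 = "res_bispan B C g" and ?c = "poly_bispan A u P id P v B"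
  note d = tr_bispan_def res_bispan_def poly_bispan_def
  show "pullback G P u v (apexB ?b1) (legq ?b1) (apexA ?b2) (legp ?b2) (tgt ?b1)"
    using P by (simp add: d)
  show "exponential G P v (apexA ?b2) (legf ?b2) (apexB ?b2) P id id (apexB ?c) v"
    using exponential_along_id[OF PD(1,3,6)] by (simp add: d)
  show "pullback G (apexA ?c) u id (apexA ?b1) (legf ?b1) P (\<lambda>x. u (id x)) (apexB ?b1)"
    using pullback_id_left[OF PD(2,1,5)] by (simp add: d)
qed (use is_bispan_basic pullbackD(1-8)[OF P] in \<open>auto simp: tr_bispan_def res_bispan_def poly_bispan_def is_bispan_def\<close>)

text \<open>
  The composite of a transfer and a norm is the only basic one in which the exponential diagram is not
  degenerate.
\<close>

lemma composite_tr_norm: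
  assumes X: "exponential G P q A f B E e f' D r"
  shows "bispan_composite G (tr_bispan P A q) (norm_bispan A B f) (poly_bispan P e E f' D r B)"
proof (rule bispan_compositeI)
  have PD: "pullback G E (\<lambda>x. q (e x)) f' A f D r B" "fin_gset G P" "gset_map G P A q" "gset_map G E P e"
    using X by (auto simp: exponential_def)
  note ED = pullbackD[OF PD(1)]
  let ?b1 = "tr_bispan P A q" and ?b2 = "norm_bispan A B f" and ?c = "poly_bispan P e E f' D r B"
  note d = tr_bispan_def norm_bispan_def poly_bispan_def
  show "pullback G P id q (apexB ?b1) (legq ?b1) (apexA ?b2) (legp ?b2) (tgt ?b1)"
    using pullback_id_right[OF PD(2) ED(2) PD(3)] by (simp add: d)
  show "exponential G P q (apexA ?b2) (legf ?b2) (apexB ?b2) E e f' (apexB ?c) r"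
    using X by (simp add: d)
  show "pullback G (apexA ?c) e id (apexA ?b1) (legf ?b1) E (\<lambda>x. id (e x)) (apexB ?b1)"
    using pullback_id_left[OF PD(2) ED(1) PD(4)] by (simp add: d)
  show "is_bispan G ?b1" "is_bispan G ?b2" "is_bispan G ?c"
    using PD ED by (auto simp: is_bispan_basic is_bispan_poly)
qed (auto simp: tr_bispan_def norm_bispan_def poly_bispan_def)

text \<open>
  Only the values of the legs on the points matter. This lets maps be replaced by pointwise equal ones
  throughout.
\<close>

lemma bispan_iso_legs:
  assumes "is_bispan G (poly_bispan X p A f B q Y)"
    "\<And>a. a \<in> pts A \<Longrightarrow> p' a = p a" "\<And>a. a \<in> pts A \<Longrightarrow> f' a = f a" "\<And>b. b \<in> pts B \<Longrightarrow> q' b = q b"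
  shows "bispan_class G (poly_bispan X p' A f' B q' Y) = bispan_class G (poly_bispan X p A f B q Y)"
proof (rule bispan_class_eq_iff[THEN iffD2])
  show "is_bispan G (poly_bispan X p A f B q Y)" by fact
  then show "is_bispan G (poly_bispan X p' A f' B q' Y)"
    using assms fin_gsetD(3)[of G A] fin_gsetD(3)[of G B] by (auto simp: is_bispan_poly gset_map_def Pi_iff)
  show "bispan_iso G (poly_bispan X p' A f' B q' Y) (poly_bispan X p A f B q Y)"
    unfolding bispan_iso_def using assms
    by (intro conjI exI[of _ id]) (auto simp: poly_bispan_def)
qed

context tambara_functor begin

text \<open>
  Restriction, norm and transfer. In \<open>rs A B f\<close>, \<open>nm A B f\<close> and \<open>tr A B f\<close> the map always goes from \<open>A\<close> to \<open>B\<close>, so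
  that \<open>rs A B f\<close> maps \<open>R(B)\<close> to \<open>R(A)\<close>.
\<close>

abbreviation "rs \<equiv> Tres G R"

abbreviation "nm \<equiv> Tnorm G R"

abbreviation "tr \<equiv> Ttr G R"

lemma Tmap_in:
  "is_bispan G b \<Longrightarrow> x \<in> Tob R (src b) \<Longrightarrow> Tmap R (bispan_class G b) x \<in> Tob R (tgt b)"
  using map_closed[of b] by (auto dest: PiE_mem)

lemma Tmap_composite:
  assumes "bispan_composite G b1 b2 c" "x \<in> Tob R (src b1)"
  shows "Tmap R (bispan_class G b2) (Tmap R (bispan_class G b1) x) = Tmap R (bispan_class G c) x"
proof -
  have "is_bispan G b1" "is_bispan G b2" "tgt b1 = src b2" using assms by (auto simp: bispan_composite_def)
  from map_comp[OF this] show ?thesis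
    unfolding bispan_comp_class[OF assms(1)] using assms(2) by (simp add: compose_def)
qed

lemma basic_closed:
  assumes "fin_gset G A" "fin_gset G B" "gset_map G A B f"
  shows "y \<in> Tob R B \<Longrightarrow> rs A B f y \<in> Tob R A" "x \<in> Tob R A \<Longrightarrow> nm A B f x \<in> Tob R B"
    "x \<in> Tob R A \<Longrightarrow> tr A B f x \<in> Tob R B"
  using Tmap_in[OF is_bispan_basic(1)[OF assms]] Tmap_in[OF is_bispan_basic(2)[OF assms]]
    Tmap_in[OF is_bispan_basic(3)[OF assms]]
  by (simp_all add: Tres_def Tnorm_def Ttr_def) (simp_all add: res_bispan_def norm_bispan_def tr_bispan_def)

lemma basic_cong:
  assumes "fin_gset G A" "fin_gset G B" "gset_map G A B f" "\<And>a. a \<in> pts A \<Longrightarrow> f' a = f a"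
  shows "rs A B f' = rs A B f" "nm A B f' = nm A B f" "tr A B f' = tr A B f"
proof -
  have "bispan_class G (poly_bispan B f' A id A id A) = bispan_class G (poly_bispan B f A id A id A)"
    "bispan_class G (poly_bispan A id A f' B id B) = bispan_class G (poly_bispan A id A f B id B)"
    "bispan_class G (poly_bispan A id A id A f' B) = bispan_class G (poly_bispan A id A id A f B)"
    by (rule bispan_iso_legs; use assms in \<open>simp add: is_bispan_poly\<close>)+
  then show "rs A B f' = rs A B f" "nm A B f' = nm A B f" "tr A B f' = tr A B f"
    by (simp_all add: Tres_def Tnorm_def Ttr_def basic_bispans_poly)
qed

lemma basic_id:
  assumes "fin_gset G A" "\<And>a. a \<in> pts A \<Longrightarrow> f a = a" "x \<in> Tob R A"
  shows "rs A A f x = x" "nm A A f x = x" "tr A A f x = x"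
proof -
  have "rs A A f = rs A A id" "nm A A f = nm A A id" "tr A A f = tr A A id"
    by (intro basic_cong; use assms in simp)+
  moreover have "bispan_id A = poly_bispan A id A id A id A" by (simp add: bispan_id_def poly_bispan_def)
  ultimately show "rs A A f x = x" "nm A A f x = x" "tr A A f x = x"
    using map_id[OF assms(1)] assms(3) by (simp_all add: Tres_def Tnorm_def Ttr_def basic_bispans_poly)
qed

lemma basic_comp:
  assumes "fin_gset G A" "fin_gset G B" "fin_gset G C" "gset_map G A B f" "gset_map G B C g"
  shows "z \<in> Tob R C \<Longrightarrow> rs A B f (rs B C g z) = rs A C (\<lambda>a. g (f a)) z"
    "x \<in> Tob R A \<Longrightarrow> nm B C g (nm A B f x) = nm A C (\<lambda>a. g (f a)) x"
    "x \<in> Tob R A \<Longrightarrow> tr B C g (tr A B f x) = tr A C (\<lambda>a. g (f a)) x"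
  unfolding Tres_def Tnorm_def Ttr_def
  by (intro Tmap_composite composite_res_res composite_norm_norm composite_tr_tr assms;
      simp add: res_bispan_def norm_bispan_def tr_bispan_def)+

text \<open>
  Every bispan is a composite of a restriction, a norm and a transfer, so a statement about all of them
  reduces to these three.
\<close>

lemma Tmap_poly:
  assumes b: "is_bispan G (poly_bispan X p A f B q Y)" and x: "x \<in> Tob R X"
  shows "Tmap R (bispan_class G (poly_bispan X p A f B q Y)) x = tr B Y q (nm A B f (rs A X p x))"
proof -
  note D = b[unfolded is_bispan_poly]
  have "nm A B f (rs A X p x) = Tmap R (bispan_class G (poly_bispan X p A f B id B)) x"
    unfolding Tnorm_def Tres_def by (rule Tmap_composite, rule composite_res_norm) (use D x in \<open>auto simp: res_bispan_def\<close>)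
  moreover have "Tmap R (bispan_class G (tr_bispan B Y q)) \<dots> = Tmap R (bispan_class G (poly_bispan X p A f B q Y)) x"
    by (rule Tmap_composite, rule composite_poly_tr) (use D x in \<open>auto simp: poly_bispan_def\<close>)
  ultimately show ?thesis by (simp add: Ttr_def)
qed

lemma base_change:
  assumes P: "pullback G P u v A f B g C" and x: "x \<in> Tob R A"
  shows "rs B C g (nm A C f x) = nm P B v (rs P A u x)" "rs B C g (tr A C f x) = tr P B v (rs P A u x)"
proof -
  note PD = pullbackD[OF P]
  have u: "rs P A u x \<in> Tob R P" using PD x by (intro basic_closed)
  have "rs B C g (nm A C f x) = Tmap R (bispan_class G (poly_bispan A u P v B id B)) x"
    unfolding Tnorm_def Tres_def by (rule Tmap_composite, rule composite_norm_res[OF P]) (use x in \<open>auto simp: norm_bispan_def\<close>)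
  also have "\<dots> = tr B B id (nm P B v (rs P A u x))" by (rule Tmap_poly) (use PD x in \<open>auto simp: is_bispan_poly\<close>)
  also have "\<dots> = nm P B v (rs P A u x)" by (rule basic_id) (use PD u basic_closed in auto)
  finally show "rs B C g (nm A C f x) = nm P B v (rs P A u x)" .
  have "rs B C g (tr A C f x) = Tmap R (bispan_class G (poly_bispan A u P id P v B)) x"
    unfolding Ttr_def Tres_def by (rule Tmap_composite, rule composite_tr_res[OF P]) (use x in \<open>auto simp: tr_bispan_def\<close>)
  also have "\<dots> = tr P B v (nm P P id (rs P A u x))" by (rule Tmap_poly) (use PD x in \<open>auto simp: is_bispan_poly\<close>)
  also have "nm P P id (rs P A u x) = rs P A u x" by (rule basic_id) (use PD u in auto)
  finally show "rs B C g (tr A C f x) = tr P B v (rs P A u x)" .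
qed

text \<open>
  The distributive law. All that links addition with multiplication below comes from it, applied to suitable
  exponential diagrams.
\<close>

lemma norm_transfer:
  assumes X: "exponential G P q A f B E e f' D r" and x: "x \<in> Tob R P"
  shows "nm A B f (tr P A q x) = tr D B r (nm E D f' (rs E P e x))"
proof -
  have PD: "pullback G E (\<lambda>x. q (e x)) f' A f D r B" "fin_gset G P" "gset_map G P A q" "gset_map G E P e"
    using X by (auto simp: exponential_def)
  have "nm A B f (tr P A q x) = Tmap R (bispan_class G (poly_bispan P e E f' D r B)) x"
    unfolding Tnorm_def Ttr_def by (rule Tmap_composite, rule composite_tr_norm[OF X]) (use x in \<open>auto simp: tr_bispan_def\<close>)
  also have "\<dots> = tr D B r (nm E D f' (rs E P e x))"
    by (rule Tmap_poly) (use PD pullbackD[OF PD(1)] x in \<open>auto simp: is_bispan_poly\<close>)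
  finally show ?thesis .
qed

lemma tr_bij:
  assumes A: "fin_gset G A" and B: "fin_gset G B" and f: "gset_map G A B f" "bij_betw f (pts A) (pts B)" and x: "x \<in> Tob R B"
  shows "tr A B f (rs A B f x) = x"
proof -
  let ?f' = "inv_into (pts A) f"
  have f': "gset_map G B A ?f'" by (rule gset_map_inv[OF A f])
  have ff': "f (?f' b) = b" if "b \<in> pts B" for b using f(2) that by (simp add: bij_betw_inv_into_right)
  have fx: "rs A B f x \<in> Tob R A" by (rule basic_closed(1)[OF A B f(1) x])
  have y: "tr A B f (rs A B f x) \<in> Tob R B" by (rule basic_closed(3)[OF A B f(1) fx])
  have "pullback G A id id A f A f B"
    by (rule pullbackI) (use A B f in \<open>auto simp: bij_betw_def dest: inj_onD\<close>)
  from base_change(2)[OF this fx] have "rs A B f (tr A B f (rs A B f x)) = rs A B f x"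
    using basic_id[OF A, of id] fx by simp
  then have "rs B A ?f' (rs A B f (tr A B f (rs A B f x))) = rs B A ?f' (rs A B f x)" by simp
  then show ?thesis
    using basic_comp(1)[OF B A B f' f(1)] basic_id(1)[OF B ff'] x y by simp
qed

end

section \<open>Disjoint unions and the ring operations\<close>

definition copair :: "(nat \<Rightarrow> nat) \<Rightarrow> (nat \<Rightarrow> nat) \<Rightarrow> nat \<Rightarrow> nat" where
  "copair i j n = (case sum_decode n of Inl x \<Rightarrow> i x | Inr y \<Rightarrow> j y)"

definition sum_map :: "(nat \<Rightarrow> nat) \<Rightarrow> (nat \<Rightarrow> nat) \<Rightarrow> nat \<Rightarrow> nat" where
  "sum_map f g = copair (\<lambda>x. inl (f x)) (\<lambda>y. inr (g y))"

lemma copair_simps [simp]: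
  "copair i j (inl x) = i x" "copair i j (inr x) = j x"
  "sum_map f g (inl x) = inl (f x)" "sum_map f g (inr x) = inr (g x)"
  "fold_map (inl x) = x" "fold_map (inr x) = x"
  by (simp_all add: copair_def sum_map_def fold_map_def inl_def inr_def)

lemma inl_inr_simps [simp]: "inl x = inl y \<longleftrightarrow> x = y" "inr x = inr y \<longleftrightarrow> x = y" "inl x \<noteq> inr y" "inr y \<noteq> inl x"
  by (simp_all add: inl_def inr_def inj_eq[OF inj_sum_encode])

lemma gset_sum_simps [simp]:
  "inl x \<in> pts (gset_sum X Y) \<longleftrightarrow> x \<in> pts X" "inr y \<in> pts (gset_sum X Y) \<longleftrightarrow> y \<in> pts Y"
  "x \<in> pts X \<Longrightarrow> act (gset_sum X Y) g (inl x) = inl (act X g x)"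
  "y \<in> pts Y \<Longrightarrow> act (gset_sum X Y) g (inr y) = inr (act Y g y)"
  by (auto simp: gset_sum_def) (auto simp: inl_def inr_def)

lemma gset_sum_cases:
  assumes "n \<in> pts (gset_sum X Y)"
  obtains x where "x \<in> pts X" "n = inl x" | y where "y \<in> pts Y" "n = inr y"
  using assms by (auto simp: gset_sum_def)

lemma gset_sum_pts: "pts (gset_sum X Y) = inl ` pts X \<union> inr ` pts Y" by (simp add: gset_sum_def)

lemma ball_gset_sum [simp]:
  "(\<forall>n\<in>pts (gset_sum X Y). P n) \<longleftrightarrow> (\<forall>x\<in>pts X. P (inl x)) \<and> (\<forall>y\<in>pts Y. P (inr y))"
  "(\<exists>n\<in>pts (gset_sum X Y). P n) \<longleftrightarrow> (\<exists>x\<in>pts X. P (inl x)) \<or> (\<exists>y\<in>pts Y. P (inr y))"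
  by (auto simp: gset_sum_pts)

lemma fin_gset_sum:
  assumes "fin_gset G X" "fin_gset G Y"
  shows "fin_gset G (gset_sum X Y)"
proof (rule fin_gsetI)
  note X = fin_gsetD[OF assms(1)] and Y = fin_gsetD[OF assms(2)]
  show "group G" by (rule X)
  show "finite (pts (gset_sum X Y))" using X Y by (simp add: gset_sum_pts)
  show "act (gset_sum X Y) g \<in> extensional (pts (gset_sum X Y))" for g by (simp add: gset_sum_def)
  show "act (gset_sum X Y) g n \<in> pts (gset_sum X Y)" if "g \<in> carrier G" "n \<in> pts (gset_sum X Y)" for g n
    using that X Y by (auto elim!: gset_sum_cases)
  show "act (gset_sum X Y) \<one>\<^bsub>G\<^esub> n = n" if "n \<in> pts (gset_sum X Y)" for n
    using that X Y by (auto elim!: gset_sum_cases)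
  show "act (gset_sum X Y) (g \<otimes>\<^bsub>G\<^esub> h) n = act (gset_sum X Y) g (act (gset_sum X Y) h n)"
    if "g \<in> carrier G" "h \<in> carrier G" "n \<in> pts (gset_sum X Y)" for g h n
    using that X Y by (auto elim!: gset_sum_cases)
qed

lemma fin_gset_empty: "group G \<Longrightarrow> fin_gset G gset_empty"
  by (rule fin_gsetI) (auto simp: gset_empty_def)

lemma pts_gset_empty [simp]: "pts gset_empty = {}" by (simp add: gset_empty_def)

lemma gset_map_from_empty [simp]: "pts C = {} \<Longrightarrow> gset_map G C X f" by (simp add: gset_map_def)

lemma gset_map_sum [simp]:
  "gset_map G X (gset_sum X Y) inl" "gset_map G Y (gset_sum X Y) inr"
  "gset_map G (gset_sum X X) X fold_map"
  by (auto simp: gset_map_def elim!: gset_sum_cases)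

lemma gset_map_copair:
  "gset_map G X Z i \<Longrightarrow> gset_map G Y Z j \<Longrightarrow> gset_map G (gset_sum X Y) Z (copair i j)"
  by (auto simp: gset_map_def Pi_iff)

lemma gset_map_sum_map:
  "gset_map G X X' f \<Longrightarrow> gset_map G Y Y' g \<Longrightarrow> gset_map G (gset_sum X Y) (gset_sum X' Y') (sum_map f g)"
  unfolding sum_map_def by (intro gset_map_copair gset_map_comp[of G X X' f _ inl] gset_map_comp[of G Y Y' g _ inr] gset_map_sum)

lemma pullback_sum_map:
  assumes "fin_gset G X" "fin_gset G X'" "fin_gset G Y" "fin_gset G Y'" "gset_map G X X' f" "gset_map G Y Y' g"
  shows "pullback G X inl f (gset_sum X Y) (sum_map f g) X' inl (gset_sum X' Y')"
    "pullback G Y inr g (gset_sum X Y) (sum_map f g) Y' inr (gset_sum X' Y')"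
  by (rule pullbackI; (use assms in \<open>auto simp: fin_gset_sum gset_map_sum_map elim!: gset_sum_cases\<close>))+

lemma copair_image: "copair i j ` pts (gset_sum X Y) = i ` pts X \<union> j ` pts Y"
  by (simp add: gset_sum_pts image_Un image_image)

text \<open>
  Disjoint unions are described by their inclusions: the encoded sum is needed only as one instance, and the
  decomposition of a set into invariant subsets is another.
\<close>

definition coproduct :: "('g, 'm) monoid_scheme \<Rightarrow> 'g gset \<Rightarrow> (nat \<Rightarrow> nat) \<Rightarrow> 'g gset \<Rightarrow> (nat \<Rightarrow> nat) \<Rightarrow> 'g gset \<Rightarrow> bool" where
  "coproduct G A1 i1 A2 i2 A \<longleftrightarrow> fin_gset G A1 \<and> fin_gset G A2 \<and> fin_gset G A \<and>
     gset_map G A1 A i1 \<and> gset_map G A2 A i2 \<and> inj_on i1 (pts A1) \<and> inj_on i2 (pts A2) \<and>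
     i1 ` pts A1 \<inter> i2 ` pts A2 = {} \<and> i1 ` pts A1 \<union> i2 ` pts A2 = pts A"

lemma coproductD:
  assumes "coproduct G A1 i1 A2 i2 A"
  shows "fin_gset G A1" "fin_gset G A2" "fin_gset G A" "gset_map G A1 A i1" "gset_map G A2 A i2"
    "bij_betw (copair i1 i2) (pts (gset_sum A1 A2)) (pts A)"
proof -
  have dis: "i1 x \<noteq> i2 y" if "x \<in> pts A1" "y \<in> pts A2" for x y
    using assms that unfolding coproduct_def by (metis IntI empty_iff imageI)
  have "inj_on (copair i1 i2) (pts (gset_sum A1 A2))"
    using assms dis unfolding coproduct_def inj_on_def by simp metis
  moreover have "copair i1 i2 ` pts (gset_sum A1 A2) = pts A"
    using assms unfolding coproduct_def by (simp add: copair_image)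
  ultimately show "bij_betw (copair i1 i2) (pts (gset_sum A1 A2)) (pts A)" by (simp add: bij_betw_def)
qed (use assms in \<open>auto simp: coproduct_def\<close>)

lemma coproduct_sum: "fin_gset G X \<Longrightarrow> fin_gset G Y \<Longrightarrow> coproduct G X inl Y inr (gset_sum X Y)"
  by (auto simp: coproduct_def fin_gset_sum gset_sum_pts inj_on_def)

lemma coproduct_swap: "coproduct G A1 i1 A2 i2 A \<Longrightarrow> coproduct G A2 i2 A1 i1 A"
  by (auto simp: coproduct_def)

text \<open>
  Over \<open>x\<close>, a section of \<open>A \<squnion> X \<rightarrow> X \<squnion> X\<close> chooses a point of \<open>A\<close> above the left copy and has no choice above the right
  one, so the dependent product along the fold map is \<open>A\<close>.
\<close>

lemma exponential_frobenius:
  assumes A: "fin_gset G A" and X: "fin_gset G X" and q: "gset_map G A X q"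
  shows "exponential G (gset_sum A X) (sum_map q id) (gset_sum X X) fold_map X
    (gset_sum A A) (sum_map id q) fold_map A q"
  unfolding exponential_def
proof (intro conjI ballI allI impI)
  note S = fin_gset_sum[OF A A] fin_gset_sum[OF A X] fin_gset_sum[OF X X]
  show "gset_map G (gset_sum A X) (gset_sum X X) (sum_map q id)"
    "gset_map G (gset_sum A A) (gset_sum A X) (sum_map id q)"
    using q by (auto intro: gset_map_sum_map)
  then show "pullback G (gset_sum A A) (\<lambda>x. sum_map q id (sum_map id q x)) fold_map (gset_sum X X) fold_map A q X"
    by (intro pullbackI S A X q gset_map_sum; (elim gset_sum_cases)?)
      (auto intro: gset_map_comp elim!: gset_sum_cases)
  fix b s assume b: "b \<in> pts X" and s: "\<forall>a\<in>pts (gset_sum X X). fold_map a = b \<longrightarrow>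
    s a \<in> pts (gset_sum A X) \<and> sum_map q id (s a) = a"
  have "s (inl b) \<in> pts (gset_sum A X)" "sum_map q id (s (inl b)) = inl b" using s b by auto
  then obtain a where a: "a \<in> pts A" "s (inl b) = inl a" "q a = b" by (auto elim!: gset_sum_cases)
  have "s (inr b) \<in> pts (gset_sum A X)" "sum_map q id (s (inr b)) = inr b" using s b by auto
  then have b': "s (inr b) = inr b" by (auto elim!: gset_sum_cases)
  show "\<exists>!d. d \<in> pts A \<and> q d = b \<and> (\<forall>x\<in>pts (gset_sum A A). fold_map x = d \<longrightarrow>
    sum_map id q x = s (sum_map q id (sum_map id q x)))"
    by (rule ex1I[of _ a]) (use a b' in auto)
qed (use A X in \<open>simp add: fin_gset_sum\<close>)

text \<open>
  Each fibre of a surjection is nonempty and has no section with values in the empty set. So the dependent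
  product has no points.
\<close>

lemma exponential_empty:
  assumes A: "fin_gset G A" and B: "fin_gset G B" and f: "gset_map G A B f" "f ` pts A = pts B"
  shows "exponential G gset_empty id A f B gset_empty id id gset_empty id"
proof -
  have E: "fin_gset G gset_empty" by (rule fin_gset_empty[OF fin_gsetD(1)[OF A]])
  have "pullback G gset_empty (\<lambda>x. id (id x)) id A f gset_empty id B"
    by (rule pullbackI) (use E A B f in auto)
  moreover have False if b: "b \<in> pts B" and s: "\<forall>a\<in>pts A. f a = b \<longrightarrow> s a \<in> pts gset_empty \<and> id (s a) = a" for b s
  proof -
    obtain a where "a \<in> pts A" "f a = b" using b unfolding f(2)[symmetric] by auto
    then show False using s by simp
  qed
  ultimately show ?thesis unfolding exponential_def using E by auto
qed

context tambara_functor begin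

text \<open>
  Any disjoint union is isomorphic to the encoded sum, for which products are known to be preserved.
\<close>

lemma coproduct_iso:
  assumes c: "coproduct G A1 i1 A2 i2 A"
  obtains \<kappa> where "gset_map G A (gset_sum A1 A2) \<kappa>"
    "\<And>a. a \<in> pts A \<Longrightarrow> copair i1 i2 (\<kappa> a) = a" "\<And>n. n \<in> pts (gset_sum A1 A2) \<Longrightarrow> \<kappa> (copair i1 i2 n) = n"
proof -
  note D = coproductD[OF c]
  have "gset_map G A (gset_sum A1 A2) (inv_into (pts (gset_sum A1 A2)) (copair i1 i2))"
    by (rule gset_map_inv[OF fin_gset_sum gset_map_copair]) (use D in auto)
  then show thesis
    by (rule that) (use D(6) in \<open>auto simp: bij_betw_def f_inv_into_f inv_into_f_f simp del: ball_gset_sum\<close>)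
qed

lemma coproduct_exists:
  assumes c: "coproduct G A1 i1 A2 i2 A" and x: "x \<in> Tob R A1" and y: "y \<in> Tob R A2"
  obtains z where "z \<in> Tob R A" "rs A1 A i1 z = x" "rs A2 A i2 z = y"
proof -
  note D = coproductD[OF c]
  let ?S = "gset_sum A1 A2"
  have S: "fin_gset G ?S" using D by (simp add: fin_gset_sum)
  obtain \<kappa> where k: "gset_map G A ?S \<kappa>" "\<And>n. n \<in> pts ?S \<Longrightarrow> \<kappa> (copair i1 i2 n) = n"
    using coproduct_iso[OF c] by metis
  have "(x, y) \<in> (\<lambda>z. (rs A1 ?S inl z, rs A2 ?S inr z)) ` Tob R ?S"
    using bij_betw_imp_surj_on[OF preserves_products[OF D(1,2)]] x y by blast
  then obtain w where w: "w \<in> Tob R ?S" "rs A1 ?S inl w = x" "rs A2 ?S inr w = y" by auto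
  have 1: "\<kappa> (i1 a) = inl a" if "a \<in> pts A1" for a using k(2)[of "inl a"] that by simp
  have 2: "\<kappa> (i2 a) = inr a" if "a \<in> pts A2" for a using k(2)[of "inr a"] that by simp
  have "rs A1 A i1 (rs A ?S \<kappa> w) = rs A1 ?S (\<lambda>a. \<kappa> (i1 a)) w" using D S k w by (intro basic_comp)
  also have "\<dots> = x" using basic_cong(1)[of A1 ?S inl "\<lambda>a. \<kappa> (i1 a)"] 1 D S w by simp
  finally have 3: "rs A1 A i1 (rs A ?S \<kappa> w) = x" .
  have "rs A2 A i2 (rs A ?S \<kappa> w) = rs A2 ?S (\<lambda>a. \<kappa> (i2 a)) w" using D S k w by (intro basic_comp)
  also have "\<dots> = y" using basic_cong(1)[of A2 ?S inr "\<lambda>a. \<kappa> (i2 a)"] 2 D S w by simp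
  finally have "rs A2 A i2 (rs A ?S \<kappa> w) = y" .
  then show thesis using 3 that basic_closed(1)[OF D(3) S k(1) w(1)] by blast
qed

text \<open>
  \<open>R\<close> turns disjoint unions into products, so elements may be compared part by part.
\<close>

lemma coproduct_unique:
  assumes c: "coproduct G A1 i1 A2 i2 A" and z: "z \<in> Tob R A" "z' \<in> Tob R A"
    and eq: "rs A1 A i1 z = rs A1 A i1 z'" "rs A2 A i2 z = rs A2 A i2 z'"
  shows "z = z'"
proof -
  note D = coproductD[OF c]
  let ?S = "gset_sum A1 A2" and ?c = "copair i1 i2"
  have S: "fin_gset G ?S" using D by (simp add: fin_gset_sum)
  obtain \<kappa> where k: "gset_map G A ?S \<kappa>" "\<And>a. a \<in> pts A \<Longrightarrow> ?c (\<kappa> a) = a"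
    using coproduct_iso[OF c] by metis
  have m: "gset_map G ?S A ?c" using D by (intro gset_map_copair)
  have "rs A1 ?S inl (rs ?S A ?c w) = rs A1 A i1 w \<and> rs A2 ?S inr (rs ?S A ?c w) = rs A2 A i2 w"
    if w: "w \<in> Tob R A" for w
    using basic_comp(1)[OF D(1) S D(3) gset_map_sum(1) m w] basic_comp(1)[OF D(2) S D(3) gset_map_sum(2) m w] by simp
  then have "rs ?S A ?c z = rs ?S A ?c z'"
    using bij_betw_imp_inj_on[OF preserves_products[OF D(1,2)]] z eq basic_closed(1)[OF S D(3) m]
    by (simp add: inj_on_def)
  then have "rs A ?S \<kappa> (rs ?S A ?c z) = rs A ?S \<kappa> (rs ?S A ?c z')" by simp
  moreover have "rs A ?S \<kappa> (rs ?S A ?c w) = w" if w: "w \<in> Tob R A" for w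
    using basic_comp(1)[OF D(3) S D(3) k(1) m w] basic_id(1)[OF D(3), of "\<lambda>a. ?c (\<kappa> a)" w] k(2) w by simp
  ultimately show ?thesis using z by simp
qed

lemma
  assumes X: "fin_gset G X" and x: "x \<in> Tob R X" and y: "y \<in> Tob R X"
  shows Tpair: "Tpair G R X x y \<in> Tob R (gset_sum X X)" "rs X (gset_sum X X) inl (Tpair G R X x y) = x"
    "rs X (gset_sum X X) inr (Tpair G R X x y) = y"
    and Tpair_eqI: "\<And>z. z \<in> Tob R (gset_sum X X) \<Longrightarrow> rs X (gset_sum X X) inl z = x \<Longrightarrow> rs X (gset_sum X X) inr z = y \<Longrightarrow> Tpair G R X x y = z"
proof -
  note c = coproduct_sum[OF X X]
  obtain z where z: "z \<in> Tob R (gset_sum X X)" "rs X (gset_sum X X) inl z = x" "rs X (gset_sum X X) inr z = y"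
    using coproduct_exists[OF c x y] by metis
  have *: "Tpair G R X x y = z'" if "z' \<in> Tob R (gset_sum X X)" "rs X (gset_sum X X) inl z' = x" "rs X (gset_sum X X) inr z' = y" for z'
    unfolding Tpair_def by (rule the_equality) (use coproduct_unique[OF c] that in auto)
  from *[OF z] z show "Tpair G R X x y \<in> Tob R (gset_sum X X)" "rs X (gset_sum X X) inl (Tpair G R X x y) = x"
    "rs X (gset_sum X X) inr (Tpair G R X x y) = y" by auto
  show "\<And>z. z \<in> Tob R (gset_sum X X) \<Longrightarrow> rs X (gset_sum X X) inl z = x \<Longrightarrow> rs X (gset_sum X X) inr z = y \<Longrightarrow> Tpair G R X x y = z"
    by (rule *)
qed

lemma Tpoint: "Tpoint R \<in> Tob R gset_empty"
proof -
  obtain z where z: "Tob R gset_empty = {z}" using preserves_terminal by blast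
  then have "Tpoint R = z" unfolding Tpoint_def by simp
  then show ?thesis using z by simp
qed

lemma empty_gset: "fin_gset G gset_empty" using group by (rule fin_gset_empty)

text \<open>
  The action of a set without points is arbitrary outside the carrier of the group, so the set need not be equal to
  \<open>gset_empty\<close>; it is only isomorphic to it.
\<close>

lemma empty_unique:
  assumes C: "fin_gset G C" "pts C = {}" and z: "z \<in> Tob R C" "z' \<in> Tob R C"
  shows "z = z'"
proof -
  have m: "gset_map G C gset_empty id" "gset_map G gset_empty C id" using C by auto
  obtain p where p: "Tob R gset_empty = {p}" using preserves_terminal by blast
  have "rs gset_empty C id z = rs gset_empty C id z'"
    using basic_closed(1)[OF empty_gset C(1) m(2)] z p by auto
  moreover have "rs C gset_empty id (rs gset_empty C id w) = w" if w: "w \<in> Tob R C" for w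
    using basic_comp(1)[OF C(1) empty_gset C(1) m w] basic_id(1)[OF C(1), of "\<lambda>a. id (id a)" w] w by simp
  ultimately show ?thesis using z by metis
qed

end

text \<open>
  Norms and transfers obey the same formal laws, those assumed of \<open>F\<close> here. The fold map turns the one into
  multiplication and the other into addition, so everything about the ring \<open>R(X)\<close> that does not mix the
  two operations is proved once.
\<close>

locale tambara_fold = tambara_functor G R for G :: "('g, 'm) monoid_scheme" and R :: "('g, 'v) tambara" +
  fixes F :: "'g gset \<Rightarrow> 'g gset \<Rightarrow> (nat \<Rightarrow> nat) \<Rightarrow> 'v \<Rightarrow> 'v"
  assumes F_closed: "fin_gset G A \<Longrightarrow> fin_gset G B \<Longrightarrow> gset_map G A B f \<Longrightarrow> x \<in> Tob R A \<Longrightarrow> F A B f x \<in> Tob R B"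
    and F_cong: "fin_gset G A \<Longrightarrow> fin_gset G B \<Longrightarrow> gset_map G A B f \<Longrightarrow> (\<And>a. a \<in> pts A \<Longrightarrow> f' a = f a) \<Longrightarrow> F A B f' = F A B f"
    and F_id: "fin_gset G A \<Longrightarrow> (\<And>a. a \<in> pts A \<Longrightarrow> f a = a) \<Longrightarrow> x \<in> Tob R A \<Longrightarrow> F A A f x = x"
    and F_comp: "fin_gset G A \<Longrightarrow> fin_gset G B \<Longrightarrow> fin_gset G C \<Longrightarrow> gset_map G A B f \<Longrightarrow> gset_map G B C g \<Longrightarrow>
      x \<in> Tob R A \<Longrightarrow> F B C g (F A B f x) = F A C (\<lambda>a. g (f a)) x"
    and F_base: "pullback G P u v A f B g C \<Longrightarrow> x \<in> Tob R A \<Longrightarrow> rs B C g (F A C f x) = F P B v (rs P A u x)"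
begin

definition op :: "'g gset \<Rightarrow> 'v \<Rightarrow> 'v \<Rightarrow> 'v" where
  "op X x y = F (gset_sum X X) X fold_map (Tpair G R X x y)"

definition unit :: "'g gset \<Rightarrow> 'v" where
  "unit X = F gset_empty X id (Tpoint R)"

lemma op_closed: "fin_gset G X \<Longrightarrow> x \<in> Tob R X \<Longrightarrow> y \<in> Tob R X \<Longrightarrow> op X x y \<in> Tob R X"
  unfolding op_def by (intro F_closed fin_gset_sum Tpair gset_map_sum)

lemma unit_closed: "fin_gset G X \<Longrightarrow> unit X \<in> Tob R X"
  unfolding unit_def by (intro F_closed empty_gset Tpoint) auto

text \<open>
  A map out of a disjoint union factors as a sum of two maps followed by the fold map. The monoid laws
  follow by cutting one set in two in different ways.
\<close>

lemma fold_formula: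
  assumes c: "coproduct G A1 i1 A2 i2 A" and B: "fin_gset G B" and p: "gset_map G A B p" and w: "w \<in> Tob R A"
  shows "F A B p w = op B (F A1 B (\<lambda>a. p (i1 a)) (rs A1 A i1 w)) (F A2 B (\<lambda>a. p (i2 a)) (rs A2 A i2 w))"
proof -
  note D = coproductD[OF c]
  let ?S = "gset_sum A1 A2" and ?B = "gset_sum B B" and ?c = "copair i1 i2"
  let ?p1 = "\<lambda>a. p (i1 a)" and ?p2 = "\<lambda>a. p (i2 a)"
  have S: "fin_gset G ?S" and BB: "fin_gset G ?B" using D B by (simp_all add: fin_gset_sum)
  have m: "gset_map G ?S A ?c" using D by (intro gset_map_copair)
  have p1: "gset_map G A1 B ?p1" and p2: "gset_map G A2 B ?p2"
    using gset_map_comp[OF D(4) p] gset_map_comp[OF D(5) p] .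
  have ps: "gset_map G ?S ?B (sum_map ?p1 ?p2)" using p1 p2 by (rule gset_map_sum_map)
  define w' where "w' = rs ?S A ?c w"
  have w': "w' \<in> Tob R ?S" unfolding w'_def by (rule basic_closed(1)[OF S D(3) m w])
  have r1: "rs A1 ?S inl (rs ?S A ?c v) = rs A1 A i1 v" if "v \<in> Tob R A" for v
    using basic_comp(1)[OF D(1) S D(3) gset_map_sum(1) m that] by simp
  have r2: "rs A2 ?S inr (rs ?S A ?c v) = rs A2 A i2 v" if "v \<in> Tob R A" for v
    using basic_comp(1)[OF D(2) S D(3) gset_map_sum(2) m that] by simp
  have Fw: "F ?S A ?c w' \<in> Tob R A" by (rule F_closed[OF S D(3) m w'])
  have "pullback G ?S id id ?S ?c ?S ?c A"
    by (rule pullbackI) (use S D m in \<open>auto simp: bij_betw_def dest: inj_onD\<close>)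
  then have "rs ?S A ?c (F ?S A ?c w') = F ?S ?S id (rs ?S ?S id w')" using w' by (rule F_base)
  also have "\<dots> = w'" using F_id[OF S, of id] basic_id(1)[OF S, of id] w' by simp
  finally have k: "rs ?S A ?c (F ?S A ?c w') = w'" .
  have "F ?S A ?c w' = w"
    by (rule coproduct_unique[OF c Fw w]) (use r1[OF Fw] r2[OF Fw] r1[OF w] r2[OF w] k w'_def in simp_all)
  then have "F A B p w = F ?S B (\<lambda>a. p (?c a)) w'"
    using F_comp[OF S D(3) B m p w'] by simp
  also have "\<dots> = F ?S B (\<lambda>a. fold_map (sum_map ?p1 ?p2 a)) w'"
    by (rule fun_cong[OF F_cong[OF S B gset_map_comp[OF ps gset_map_sum(3)]]]) (auto elim!: gset_sum_cases)
  also have "\<dots> = F ?B B fold_map (F ?S ?B (sum_map ?p1 ?p2) w')"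
    using F_comp[OF S BB B ps gset_map_sum(3) w'] by simp
  also have "F ?S ?B (sum_map ?p1 ?p2) w' = Tpair G R B (F A1 B ?p1 (rs A1 A i1 w)) (F A2 B ?p2 (rs A2 A i2 w))"
  proof (rule Tpair_eqI[symmetric])
    show "rs B ?B inl (F ?S ?B (sum_map ?p1 ?p2) w') = F A1 B ?p1 (rs A1 A i1 w)"
      using F_base[OF pullback_sum_map(1)[OF D(1) B D(2) B p1 p2] w'] r1[OF w] by (simp add: w'_def)
    show "rs B ?B inr (F ?S ?B (sum_map ?p1 ?p2) w') = F A2 B ?p2 (rs A2 A i2 w)"
      using F_base[OF pullback_sum_map(2)[OF D(1) B D(2) B p1 p2] w'] r2[OF w] by (simp add: w'_def)
    show "F A1 B ?p1 (rs A1 A i1 w) \<in> Tob R B" "F A2 B ?p2 (rs A2 A i2 w) \<in> Tob R B"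
      by (intro F_closed basic_closed(1) D B p1 p2 w)+
    show "F ?S ?B (sum_map ?p1 ?p2) w' \<in> Tob R ?B" by (rule F_closed[OF S BB ps w'])
  qed (rule B)
  finally show ?thesis by (simp add: op_def)
qed

lemma op_comm:
  assumes X: "fin_gset G X" and x: "x \<in> Tob R X" and y: "y \<in> Tob R X"
  shows "op X x y = op X y x"
proof -
  note T = Tpair[OF X x y] and c = coproduct_swap[OF coproduct_sum[OF X X]]
  show ?thesis
    unfolding op_def[of X x y]
    by (subst fold_formula[OF c X gset_map_sum(3) T(1)]) (use T X x y F_id[OF X, of "\<lambda>a. a"] in simp)
qed

text \<open>
  Both sides are \<open>F\<close> along the fold map of three copies of \<open>X\<close>, cut as \<open>1 + 2\<close> and as \<open>2 + 1\<close>.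
\<close>

lemma op_assoc:
  assumes X: "fin_gset G X" and x: "x \<in> Tob R X" and y: "y \<in> Tob R X" and z: "z \<in> Tob R X"
  shows "op X (op X x y) z = op X x (op X y z)"
proof -
  let ?X2 = "gset_sum X X" and ?X3 = "gset_sum X (gset_sum X X)" and ?p = "copair id fold_map"
  have X2: "fin_gset G ?X2" and X3: "fin_gset G ?X3" using X by (auto simp: fin_gset_sum)
  note c = coproduct_sum[OF X X2]
  have p: "gset_map G ?X3 X ?p" by (intro gset_map_copair) auto
  obtain w where w: "w \<in> Tob R ?X3" "rs X ?X3 inl w = x" "rs ?X2 ?X3 inr w = Tpair G R X y z"
    using coproduct_exists[OF c x Tpair(1)[OF X y z]] by metis
  \<comment> \<open>inclusions of the first two copies and of the third copy\<close>
  let ?i = "copair inl (\<lambda>a. inr (inl a))" and ?j = "\<lambda>a. inr (inr a)"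
  have i: "gset_map G ?X2 ?X3 ?i" and j: "gset_map G X ?X3 ?j"
    by (intro gset_map_copair gset_map_comp[OF gset_map_sum(1) gset_map_sum(2)] gset_map_comp[OF gset_map_sum(2) gset_map_sum(2)] gset_map_sum)+
  have c': "coproduct G ?X2 ?i X ?j ?X3"
    using X X2 X3 i j by (auto simp: coproduct_def inj_on_def copair_image gset_sum_pts image_Un image_image)
  have yz: "rs X ?X3 (\<lambda>a. inr (inl a)) w = y" "rs X ?X3 ?j w = z"
    using basic_comp(1)[OF X X2 X3 gset_map_sum(1) gset_map_sum(2) w(1)]
      basic_comp(1)[OF X X2 X3 gset_map_sum(2) gset_map_sum(2) w(1)] Tpair[OF X y z] w by simp_all
  have "Tpair G R X x y = rs ?X2 ?X3 ?i w"
    by (rule Tpair_eqI[OF X x y]) (use basic_closed(1)[OF X2 X3 i w(1)] w(2) yz(1)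
      basic_comp(1)[OF X X2 X3 gset_map_sum(1) i w(1)] basic_comp(1)[OF X X2 X3 gset_map_sum(2) i w(1)] in simp_all)
  moreover have "F ?X2 X (\<lambda>a. ?p (?i a)) = F ?X2 X fold_map"
    by (rule F_cong) (use X X2 in \<open>auto elim!: gset_sum_cases\<close>)
  ultimately have "F ?X3 X ?p w = op X (op X x y) z"
    using fold_formula[OF c' X p w(1)] yz F_id[OF X, of "\<lambda>a. a"] z by (simp add: op_def[of X x y])
  moreover have "F ?X3 X ?p w = op X x (op X y z)"
    using fold_formula[OF c X p w(1)] w(2,3) F_id[OF X, of "\<lambda>a. a"] x by (simp add: op_def[of X y z])
  ultimately show ?thesis by simp
qed

text \<open>
  The unit is defined through \<open>gset_empty\<close>; all sources without points are isomorphic to it and give the same element.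
\<close>

lemma F_from_empty:
  assumes C: "fin_gset G C" "pts C = {}" and X: "fin_gset G X" and w: "w \<in> Tob R C"
  shows "F C X q w = unit X"
proof -
  have m: "gset_map G gset_empty C id" "gset_map G C X q" using C by auto
  have "w = F gset_empty C id (Tpoint R)"
    by (rule empty_unique[OF C w F_closed[OF empty_gset C(1) m(1) Tpoint]])
  then have "F C X q w = F gset_empty X (\<lambda>a. q (id a)) (Tpoint R)"
    using F_comp[OF empty_gset C(1) X m Tpoint] by simp
  also have "F gset_empty X (\<lambda>a. q (id a)) = F gset_empty X id"
    by (rule F_cong) (use X empty_gset in auto)
  finally show ?thesis by (simp add: unit_def)
qed

lemma op_unit:
  assumes X: "fin_gset G X" and x: "x \<in> Tob R X"
  shows "op X (unit X) x = x"
proof -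
  have c: "coproduct G gset_empty id X id X" using X empty_gset by (auto simp: coproduct_def)
  show ?thesis
    using fold_formula[OF c X gset_map_id(1) x] F_from_empty[OF empty_gset _ X basic_closed(1)[OF empty_gset X _ x]]
      F_id[OF X] basic_id(1)[OF X] x by (simp add: id_def)
qed

lemma F_op:
  assumes X: "fin_gset G X" and Y: "fin_gset G Y" and f: "gset_map G X Y f" and x: "x \<in> Tob R X" and y: "y \<in> Tob R X"
  shows "F X Y f (op X x y) = op Y (F X Y f x) (F X Y f y)"
proof -
  note T = Tpair[OF X x y] and X2 = fin_gset_sum[OF X X]
  have "F X Y f (op X x y) = F (gset_sum X X) Y (\<lambda>a. f (fold_map a)) (Tpair G R X x y)"
    unfolding op_def using X X2 Y f T(1) by (intro F_comp) auto
  also have "\<dots> = op Y (F X Y f x) (F X Y f y)"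
    using fold_formula[OF coproduct_sum[OF X X] Y gset_map_comp[OF gset_map_sum(3) f] T(1)] T by simp
  finally show ?thesis .
qed

lemma F_unit:
  assumes X: "fin_gset G X" and Y: "fin_gset G Y" and f: "gset_map G X Y f"
  shows "F X Y f (unit X) = unit Y"
  unfolding unit_def[of X]
  using F_comp[OF empty_gset X Y _ f Tpoint, of id] F_from_empty[OF empty_gset _ Y Tpoint] by simp

lemma rs_op:
  assumes X: "fin_gset G X" and Y: "fin_gset G Y" and f: "gset_map G X Y f" and x: "x \<in> Tob R Y" and y: "y \<in> Tob R Y"
  shows "rs X Y f (op Y x y) = op X (rs X Y f x) (rs X Y f y)"
proof -
  let ?X = "gset_sum X X" and ?Y = "gset_sum Y Y"
  note T = Tpair[OF Y x y]
  have X2: "fin_gset G ?X" and Y2: "fin_gset G ?Y" using X Y by (auto simp: fin_gset_sum)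
  have f2: "gset_map G ?X ?Y (sum_map f f)" using f f by (rule gset_map_sum_map)
  have "pullback G ?X (sum_map f f) fold_map ?Y fold_map X f Y"
    by (rule pullbackI) (use X Y X2 Y2 f f2 in \<open>auto elim!: gset_sum_cases\<close>)
  then have "rs X Y f (op Y x y) = F ?X X fold_map (rs ?X ?Y (sum_map f f) (Tpair G R Y x y))"
    unfolding op_def[of Y x y] using T(1) by (rule F_base)
  also have "rs ?X ?Y (sum_map f f) (Tpair G R Y x y) = Tpair G R X (rs X Y f x) (rs X Y f y)"
  proof (rule Tpair_eqI[symmetric])
    show "rs X Y f x \<in> Tob R X" "rs X Y f y \<in> Tob R X" using X Y f x y by (auto intro: basic_closed)
    show "rs ?X ?Y (sum_map f f) (Tpair G R Y x y) \<in> Tob R ?X" using X2 Y2 f2 T by (auto intro: basic_closed)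
    show "rs X ?X inl (rs ?X ?Y (sum_map f f) (Tpair G R Y x y)) = rs X Y f x"
      using basic_comp(1)[OF X X2 Y2 gset_map_sum(1) f2 T(1)] basic_comp(1)[OF X Y Y2 f gset_map_sum(1) T(1)] T by simp
    show "rs X ?X inr (rs ?X ?Y (sum_map f f) (Tpair G R Y x y)) = rs X Y f y"
      using basic_comp(1)[OF X X2 Y2 gset_map_sum(2) f2 T(1)] basic_comp(1)[OF X Y Y2 f gset_map_sum(2) T(1)] T by simp
  qed (rule X)
  finally show ?thesis by (simp add: op_def)
qed

lemma rs_unit:
  assumes X: "fin_gset G X" and Y: "fin_gset G Y" and f: "gset_map G X Y f"
  shows "rs X Y f (unit Y) = unit X"
proof -
  have "pullback G gset_empty id id gset_empty id X f Y"
    by (rule pullbackI) (use X Y f empty_gset in auto)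
  then show ?thesis unfolding unit_def[of Y] using F_base[OF _ Tpoint] F_from_empty[OF empty_gset _ X]
    basic_closed(1)[OF empty_gset empty_gset _ Tpoint, of id] by simp
qed

end

context tambara_functor begin

sublocale mul: tambara_fold G R "Tnorm G R"
proof unfold_locales
qed (fact basic_closed basic_cong basic_id basic_comp base_change)+

sublocale plus: tambara_fold G R "Ttr G R"
proof unfold_locales
qed (fact basic_closed basic_cong basic_id basic_comp base_change)+

abbreviation Rg :: "'g gset \<Rightarrow> 'v ring" where "Rg X \<equiv> Tring G R X"

lemma Tring_simps [simp]:
  "carrier (Rg X) = Tob R X" "x \<otimes>\<^bsub>Rg X\<^esub> y = mul.op X x y" "\<one>\<^bsub>Rg X\<^esub> = mul.unit X"
  "x \<oplus>\<^bsub>Rg X\<^esub> y = plus.op X x y" "\<zero>\<^bsub>Rg X\<^esub> = plus.unit X"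
  by (simp_all add: Tring_def mul.op_def plus.op_def mul.unit_def plus.unit_def)

text \<open>
  The product on the left is a norm along the fold map applied to a transfer; the distributive law exchanges
  them.
\<close>

lemma frobenius:
  assumes A: "fin_gset G A" and X: "fin_gset G X" and q: "gset_map G A X q" and y: "y \<in> Tob R A" and x: "x \<in> Tob R X"
  shows "mul.op X (tr A X q y) x = tr A X q (mul.op A y (rs A X q x))"
proof -
  let ?AX = "gset_sum A X" and ?X = "gset_sum X X" and ?A = "gset_sum A A"
  have AX: "fin_gset G ?AX" and X2: "fin_gset G ?X" and A2: "fin_gset G ?A" using A X by (auto simp: fin_gset_sum)
  obtain w where w: "w \<in> Tob R ?AX" "rs A ?AX inl w = y" "rs X ?AX inr w = x"
    using coproduct_exists[OF coproduct_sum[OF A X] y x] by metis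
  have m: "gset_map G ?AX ?X (sum_map q id)" "gset_map G ?A ?AX (sum_map id q)" using q by (auto intro: gset_map_sum_map)
  have qy: "tr A X q y \<in> Tob R X" and qx: "rs A X q x \<in> Tob R A" using A X q x y by (auto intro: basic_closed)
  have "tr ?AX ?X (sum_map q id) w = Tpair G R X (tr A X q y) x"
  proof (rule Tpair_eqI[OF X qy x, symmetric])
    show "rs X ?X inl (tr ?AX ?X (sum_map q id) w) = tr A X q y"
      using base_change(2)[OF pullback_sum_map(1)[OF A X X X q gset_map_id(1)] w(1)] w(2) by simp
    show "rs X ?X inr (tr ?AX ?X (sum_map q id) w) = x"
      using base_change(2)[OF pullback_sum_map(2)[OF A X X X q gset_map_id(1)] w(1)] w(3) basic_id(3)[OF X, of id x] x by simp
    show "tr ?AX ?X (sum_map q id) w \<in> Tob R ?X" using AX X2 m(1) w(1) by (rule basic_closed(3))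
  qed
  then have "mul.op X (tr A X q y) x = tr A X q (nm ?A A fold_map (rs ?A ?AX (sum_map id q) w))"
    unfolding mul.op_def using norm_transfer[OF exponential_frobenius[OF A X q] w(1)] by simp
  also have "rs ?A ?AX (sum_map id q) w = Tpair G R A y (rs A X q x)"
  proof (rule Tpair_eqI[OF A y qx, symmetric])
    show "rs A ?A inl (rs ?A ?AX (sum_map id q) w) = y"
      using basic_comp(1)[OF A A2 AX gset_map_sum(1) m(2) w(1)] w(2) by simp
    show "rs A ?A inr (rs ?A ?AX (sum_map id q) w) = rs A X q x"
      using basic_comp(1)[OF A A2 AX gset_map_sum(2) m(2) w(1)] basic_comp(1)[OF A X AX q gset_map_sum(2) w(1)] w(3) by simp
    show "rs ?A ?AX (sum_map id q) w \<in> Tob R ?A" using A2 AX m(2) w(1) by (rule basic_closed(1))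
  qed
  finally show ?thesis by (simp add: mul.op_def)
qed

text \<open>
  Zero is a transfer from the empty set, and the distributive law over a surjection keeps the empty set.
\<close>

lemma norm_zero:
  assumes A: "fin_gset G A" and B: "fin_gset G B" and f: "gset_map G A B f" "f ` pts A = pts B"
  shows "nm A B f (plus.unit A) = plus.unit B"
proof -
  have e: "rs gset_empty gset_empty id (Tpoint R) \<in> Tob R gset_empty"
    by (rule basic_closed) (use empty_gset Tpoint in auto)
  show ?thesis
    unfolding plus.unit_def[of A] norm_transfer[OF exponential_empty[OF A B f] Tpoint]
    by (rule plus.F_from_empty) (use empty_gset B e basic_closed(2)[OF empty_gset empty_gset, of id] in auto)
qed

text \<open>
  Zero is a transfer from the empty set, so this is a case of Frobenius reciprocity.
\<close>

lemma mul_zero: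
  assumes X: "fin_gset G X" and x: "x \<in> Tob R X"
  shows "mul.op X (plus.unit X) x = plus.unit X"
  unfolding plus.unit_def
  using frobenius[OF empty_gset X _ Tpoint x, of id] empty_unique[OF empty_gset _ mul.op_closed[OF empty_gset Tpoint] Tpoint]
    basic_closed(1)[OF empty_gset X _ x, of id] by simp

text \<open>
  A sum is a transfer along the fold map, so distributivity is a case of Frobenius reciprocity.
\<close>

lemma distrib:
  assumes X: "fin_gset G X" and x: "x \<in> Tob R X" and y: "y \<in> Tob R X" and z: "z \<in> Tob R X"
  shows "mul.op X (plus.op X x y) z = plus.op X (mul.op X x z) (mul.op X y z)"
proof -
  let ?X = "gset_sum X X"
  note X2 = fin_gset_sum[OF X X] and T = Tpair[OF X x y]
  have rz: "rs ?X X fold_map z \<in> Tob R ?X" by (rule basic_closed) (use X X2 z in auto)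
  have i: "rs X ?X inl (rs ?X X fold_map z) = z" "rs X ?X inr (rs ?X X fold_map z) = z"
    using basic_comp(1)[OF X X2 X gset_map_sum(1) gset_map_sum(3) z] basic_comp(1)[OF X X2 X gset_map_sum(2) gset_map_sum(3) z]
      basic_id(1)[OF X, of "\<lambda>a. a" z] z by simp_all
  have "mul.op X (plus.op X x y) z = tr ?X X fold_map (mul.op ?X (Tpair G R X x y) (rs ?X X fold_map z))"
    unfolding plus.op_def by (rule frobenius[OF X2 X gset_map_sum(3) T(1) z])
  also have "mul.op ?X (Tpair G R X x y) (rs ?X X fold_map z) = Tpair G R X (mul.op X x z) (mul.op X y z)"
    by (rule Tpair_eqI[symmetric])
      (use X X2 T rz i x y z in \<open>simp_all add: mul.op_closed mul.rs_op\<close>)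
  finally show ?thesis by (simp add: plus.op_def)
qed

theorem Tring_cring:
  assumes X: "fin_gset G X"
  shows "cring (Rg X)"
proof (rule cringI)
  interpret g: group "add_monoid (Rg X)" by (rule additive_group[OF X])
  have "comm_group (add_monoid (Rg X))"
    by (rule g.group_comm_groupI) (use plus.op_comm[OF X] in simp)
  then show "abelian_group (Rg X)"
    by (intro abelian_group.intro abelian_group_axioms.intro)
      (auto simp: abelian_monoid_def comm_group_def)
  show "comm_monoid (Rg X)"
    by (rule comm_monoidI)
      (simp_all add: X mul.op_closed mul.unit_closed mul.op_unit mul.op_assoc mul.op_comm[OF X])
qed (simp add: distrib[OF X])

end

section \<open>Orbits and norms of idempotents on free sets\<close>

definition sub_gset :: "'g gset \<Rightarrow> nat set \<Rightarrow> 'g gset" where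
  "sub_gset A U = \<lparr>pts = U, act = (\<lambda>g. restrict (act A g) U)\<rparr>"

lemma sub_gset_simps [simp]: "pts (sub_gset A U) = U" "x \<in> U \<Longrightarrow> act (sub_gset A U) g x = act A g x"
  by (simp_all add: sub_gset_def)

definition invariant :: "('g, 'm) monoid_scheme \<Rightarrow> 'g gset \<Rightarrow> nat set \<Rightarrow> bool" where
  "invariant G A U \<longleftrightarrow> U \<subseteq> pts A \<and> (\<forall>g\<in>carrier G. \<forall>x\<in>U. act A g x \<in> U)"

lemma fin_sub_gset:
  assumes A: "fin_gset G A" and U: "invariant G A U"
  shows "fin_gset G (sub_gset A U)"
proof (rule fin_gsetI)
  note AD = fin_gsetD[OF A]
  have sub: "x \<in> pts A" if "x \<in> U" for x using U that by (auto simp: invariant_def)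
  show "group G" by (rule AD)
  show "finite (pts (sub_gset A U))" using AD U by (auto simp: invariant_def intro: finite_subset)
  show "act (sub_gset A U) g \<in> extensional (pts (sub_gset A U))" for g by (simp add: sub_gset_def)
  show cl: "act (sub_gset A U) g x \<in> pts (sub_gset A U)" if "g \<in> carrier G" "x \<in> pts (sub_gset A U)" for g x
    using that U by (simp add: invariant_def)
  show "act (sub_gset A U) \<one>\<^bsub>G\<^esub> x = x" if "x \<in> pts (sub_gset A U)" for x using that AD sub by simp
  show "act (sub_gset A U) (g \<otimes>\<^bsub>G\<^esub> h) x = act (sub_gset A U) g (act (sub_gset A U) h x)"
    if "g \<in> carrier G" "h \<in> carrier G" "x \<in> pts (sub_gset A U)" for g h x
    using that AD sub cl[OF that(2,3)] by simp
qed

lemma gset_map_sub [simp]: "invariant G A U \<Longrightarrow> gset_map G (sub_gset A U) A id"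
  by (auto simp: gset_map_def invariant_def)

lemma act_inverse:
  assumes A: "fin_gset G A" and g: "g \<in> carrier G" and x: "x \<in> pts A"
  shows "inv\<^bsub>G\<^esub> g \<in> carrier G" "act A (inv\<^bsub>G\<^esub> g) (act A g x) = x" "act A g (act A (inv\<^bsub>G\<^esub> g) x) = x"
proof -
  interpret group G by (rule fin_gsetD(1)[OF A])
  show "inv\<^bsub>G\<^esub> g \<in> carrier G" "act A (inv\<^bsub>G\<^esub> g) (act A g x) = x" "act A g (act A (inv\<^bsub>G\<^esub> g) x) = x"
    using g x fin_gsetD[OF A] by (simp_all flip: fin_gsetD(5)[OF A])
qed

lemma invariant_compl:
  assumes A: "fin_gset G A" and U: "invariant G A U"
  shows "invariant G A (pts A - U)"
proof -
  have "act A g x \<notin> U" if "g \<in> carrier G" "x \<in> pts A" "x \<notin> U" for g x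
    using U act_inverse[OF A that(1,2)] that(3) unfolding invariant_def by metis
  then show ?thesis using fin_gsetD(3)[OF A] by (auto simp: invariant_def)
qed

lemma coproduct_sub:
  assumes A: "fin_gset G A" and U: "invariant G A U"
  shows "coproduct G (sub_gset A U) id (sub_gset A (pts A - U)) id A"
  using fin_sub_gset[OF A U] fin_sub_gset[OF A invariant_compl[OF A U]] A U invariant_compl[OF A U]
  by (auto simp: coproduct_def invariant_def gset_map_def)

definition point_gset :: "'g gset" where
  "point_gset = \<lparr>pts = {0}, act = (\<lambda>g. \<lambda>n\<in>{0}. 0)\<rparr>"

lemma point_gset: "group G \<Longrightarrow> fin_gset G point_gset"
  by (rule fin_gsetI) (auto simp: point_gset_def)

lemma point_gset_simps [simp]: "pts point_gset = {0}" "act point_gset g 0 = 0"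
  by (simp_all add: point_gset_def)

lemma gset_map_point [simp]: "fin_gset G X \<Longrightarrow> gset_map G X point_gset (\<lambda>_. 0)"
  by (simp add: gset_map_def)

locale finite_group = G: group G for G :: "('g, 'm) monoid_scheme" +
  assumes finite_carrier: "finite (carrier G)"
begin

lemma is_grp: "group G" by (rule G.group_axioms)

abbreviation "num \<equiv> to_nat_on (carrier G)"

abbreviation "elt \<equiv> from_nat_into (carrier G)"

abbreviation "\<O> \<equiv> free_orbit G"

lemma elt_num [simp]: "g \<in> carrier G \<Longrightarrow> elt (num g) = g"
  by (rule from_nat_into_to_nat_on) (auto intro: countable_finite finite_carrier)

lemma num_eq_iff: "g \<in> carrier G \<Longrightarrow> h \<in> carrier G \<Longrightarrow> num g = num h \<longleftrightarrow> g = h"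
  by (metis elt_num)

lemma free_orbit_simps [simp]:
  "pts \<O> = num ` carrier G" "x \<in> carrier G \<Longrightarrow> act \<O> g (num x) = num (g \<otimes>\<^bsub>G\<^esub> x)"
  by (auto simp: free_orbit_def)

lemma free_orbit: "fin_gset G \<O>"
proof (rule fin_gsetI)
  show "act \<O> g \<in> extensional (pts \<O>)" for g by (simp add: free_orbit_def)
qed (auto simp: is_grp finite_carrier G.m_assoc)

text \<open>
  The map \<open>G/e \<rightarrow> A\<close> that sends the unit to \<open>a\<close>.
\<close>

definition orbit_map :: "'g gset \<Rightarrow> nat \<Rightarrow> nat \<Rightarrow> nat" where
  "orbit_map A a n = act A (elt n) a"

lemma orbit_map: "fin_gset G A \<Longrightarrow> a \<in> pts A \<Longrightarrow> gset_map G \<O> A (orbit_map A a)"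
  by (auto simp: gset_map_def orbit_map_def fin_gsetD)

lemma orbit_map_one: "fin_gset G A \<Longrightarrow> a \<in> pts A \<Longrightarrow> orbit_map A a (num \<one>\<^bsub>G\<^esub>) = a"
  by (simp add: orbit_map_def fin_gsetD)

lemma orbit_map_comp:
  "gset_map G A B f \<Longrightarrow> a \<in> pts A \<Longrightarrow> n \<in> pts \<O> \<Longrightarrow> f (orbit_map A a n) = orbit_map B (f a) n"
  by (auto simp: orbit_map_def gset_mapD(2))

lemma right_mult_num [simp]: "x \<in> carrier G \<Longrightarrow> right_mult G g (num x) = num (x \<otimes>\<^bsub>G\<^esub> g)"
  by (simp add: right_mult_def)

lemma right_mult: "g \<in> carrier G \<Longrightarrow> gset_map G \<O> \<O> (right_mult G g)"
  by (auto simp: gset_map_def G.m_assoc)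

lemma orbit_map_free: "g \<in> carrier G \<Longrightarrow> n \<in> pts \<O> \<Longrightarrow> orbit_map \<O> (num g) n = right_mult G g n"
  by (auto simp: orbit_map_def)

text \<open>
  A map to \<open>G/e\<close> forces the action to be free, so an orbit that meets the fibre over the unit is a copy of \<open>G/e\<close> and
  splits off. Proofs by induction on the number of points of sets over \<open>G/e\<close> rest on this.
\<close>

lemma orbit_split:
  assumes C: "fin_gset G C" and q: "gset_map G C \<O> q" and ne: "pts C \<noteq> {}"
  obtains c C' where "c \<in> pts C" "q c = num \<one>\<^bsub>G\<^esub>" "coproduct G \<O> (orbit_map C c) C' id C"
    "pts C' = pts C - orbit_map C c ` pts \<O>" "card (pts C') < card (pts C)"
proof -
  note CD = fin_gsetD[OF C]
  obtain c0 where c0: "c0 \<in> pts C" using ne by auto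
  then obtain g where g: "g \<in> carrier G" "q c0 = num g" using gset_mapD(1)[OF q] by auto
  define c where "c = act C (inv\<^bsub>G\<^esub> g) c0"
  have c: "c \<in> pts C" "q c = num \<one>\<^bsub>G\<^esub>" using c0 g CD gset_mapD(2)[OF q _ c0] by (simp_all add: c_def)
  define U where "U = orbit_map C c ` pts \<O>"
  have U: "invariant G C U"
    using gset_mapD[OF orbit_map[OF C c(1)]] unfolding U_def invariant_def
    by (auto simp flip: gset_mapD(2)[OF orbit_map[OF C c(1)]] intro!: imageI)
  have "inj_on (orbit_map C c) (pts \<O>)"
  proof (rule inj_on_inverseI)
    show "q (orbit_map C c n) = n" if "n \<in> pts \<O>" for n
      using orbit_map_comp[OF q c(1) that] that c(2) by (auto simp: orbit_map_def)
  qed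
  then have cp: "coproduct G \<O> (orbit_map C c) (sub_gset C (pts C - U)) id C"
    using free_orbit orbit_map[OF C c(1)] coproduct_sub[OF C U] by (auto simp: coproduct_def U_def)
  have "c \<in> U" unfolding U_def using orbit_map_one[OF C c(1)] by (metis G.one_closed free_orbit_simps(1) image_eqI)
  then have "card (pts C - U) < card (pts C)" using c(1) CD(2) by (intro psubset_card_mono) auto
  then show thesis using that[OF c cp] by (simp add: U_def)
qed

lemma point: "fin_gset G point_gset" using is_grp by (rule point_gset)

lemma product_exists:
  assumes "fin_gset G X" "fin_gset G Y"
  obtains P u v where "fin_gset G P" "gset_map G P X u" "gset_map G P Y v"
    "\<And>x y. x \<in> pts X \<Longrightarrow> y \<in> pts Y \<Longrightarrow> \<exists>p\<in>pts P. u p = x \<and> v p = y"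
    "\<And>p q. p \<in> pts P \<Longrightarrow> q \<in> pts P \<Longrightarrow> u p = u q \<Longrightarrow> v p = v q \<Longrightarrow> p = q"
    "pullback G P u v X (\<lambda>_. 0) Y (\<lambda>_. 0) point_gset"
proof -
  obtain P u v where P: "pullback G P u v X (\<lambda>_. 0) Y (\<lambda>_. 0) point_gset"
    using pullback_exists[OF assms point gset_map_point gset_map_point] assms by blast
  show thesis by (rule that[OF _ _ _ _ _ P]) (use pullbackD[OF P] in auto)
qed

end

context tambara_functor begin

sublocale finite_group G
  using group finite by (simp add: finite_group_def finite_group_axioms_def)

text \<open>
  Splitting off orbits turns the norm into a product of copies of \<open>x\<close>, one for each point over the unit, and a
  nonempty product of copies of an idempotent is that idempotent.
\<close>

lemma norm_idempotent_orbit: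
  assumes x: "x \<in> Tob R \<O>" "mul.op \<O> x x = x"
  shows "fin_gset G C \<Longrightarrow> gset_map G C \<O> g \<Longrightarrow>
    nm C \<O> g (rs C \<O> g x) = (if pts C = {} then mul.unit \<O> else x)"
proof (induction "card (pts C)" arbitrary: C rule: less_induct)
  case (less C)
  note C = less.prems(1) and g = less.prems(2)
  have gx: "rs C \<O> g x \<in> Tob R C" by (rule basic_closed(1)[OF C free_orbit g x(1)])
  show ?case
  proof (cases "pts C = {}")
    case True
    then show ?thesis using mul.F_from_empty[OF C True free_orbit gx] by simp
  next
    case False
    then obtain c C' where c: "c \<in> pts C" "g c = num \<one>\<^bsub>G\<^esub>" and cp: "coproduct G \<O> (orbit_map C c) C' id C"
      and C': "pts C' = pts C - orbit_map C c ` pts \<O>" "card (pts C') < card (pts C)"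
      using orbit_split[OF C g] by metis
    note D = coproductD[OF cp]
    have g': "gset_map G C' \<O> g" using gset_map_comp[OF D(5) g] by simp
    have 1: "g (orbit_map C c n) = n" if "n \<in> pts \<O>" for n
      using orbit_map_comp[OF g c(1) that] that c(2) by (auto simp: orbit_map_def)
    have "nm \<O> \<O> (\<lambda>a. g (orbit_map C c a)) (rs \<O> C (orbit_map C c) (rs C \<O> g x)) = x"
      using basic_comp(1)[OF D(1) C free_orbit D(4) g x(1)] basic_id[OF free_orbit 1 x(1)] by simp
    moreover have "nm C' \<O> (\<lambda>a. g (id a)) (rs C' C id (rs C \<O> g x)) = (if pts C' = {} then mul.unit \<O> else x)"
      using basic_comp(1)[OF D(2) C free_orbit D(5) g x(1)] less.hyps[OF C'(2) D(2) g'] by simp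
    ultimately have "nm C \<O> g (rs C \<O> g x) = mul.op \<O> x (if pts C' = {} then mul.unit \<O> else x)"
      using mul.fold_formula[OF cp free_orbit g gx] by simp
    then show ?thesis
      using False x mul.op_unit[OF free_orbit x(1)] mul.op_comm[OF free_orbit x(1) mul.unit_closed[OF free_orbit]] by simp
  qed
qed

text \<open>
  A set over \<open>G/e\<close> is a disjoint union of copies of \<open>G/e\<close>, so an element is determined by its values there. Over a set that is
  not free such a statement fails in general.
\<close>

lemma free_separation:
  assumes "fin_gset G C" "gset_map G C \<O> q" "x \<in> Tob R C" "y \<in> Tob R C"
    "\<And>c. c \<in> pts C \<Longrightarrow> rs \<O> C (orbit_map C c) x = rs \<O> C (orbit_map C c) y"
  shows "x = y"
  using assms
proof (induction "card (pts C)" arbitrary: C x y rule: less_induct)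
  case (less C)
  note C = less.prems(1) and q = less.prems(2) and xy = less.prems(3,4) and eq = less.prems(5)
  show ?case
  proof (cases "pts C = {}")
    case True
    then show ?thesis using empty_unique[OF C] xy by simp
  next
    case False
    then obtain c C' where c: "c \<in> pts C" "q c = num \<one>\<^bsub>G\<^esub>" and cp: "coproduct G \<O> (orbit_map C c) C' id C"
      and C': "pts C' = pts C - orbit_map C c ` pts \<O>" "card (pts C') < card (pts C)"
      using orbit_split[OF C q] by metis
    note D = coproductD[OF cp]
    have q': "gset_map G C' \<O> q" using gset_map_comp[OF D(5) q] by simp
    have "rs \<O> C' (orbit_map C' a) (rs C' C id z) = rs \<O> C (orbit_map C a) z"
      if "a \<in> pts C'" "z \<in> Tob R C" for a z
    proof -
      note om = orbit_map[OF D(2) that(1)]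
      have "orbit_map C a n = id (orbit_map C' a n)" if "n \<in> pts \<O>" for n
        using orbit_map_comp[OF D(5) \<open>a \<in> pts C'\<close> that] by simp
      from basic_cong(1)[OF D(1) C gset_map_comp[OF om D(5)] this]
      show ?thesis using basic_comp(1)[OF D(1) D(2) C om D(5) that(2)] by simp
    qed
    then have "rs C' C id x = rs C' C id y"
      by (intro less.hyps[OF C'(2) D(2) q' basic_closed(1)[OF D(2) C D(5) xy(1)] basic_closed(1)[OF D(2) C D(5) xy(2)]])
        (use C'(1) eq xy in simp)
    then show ?thesis using coproduct_unique[OF cp xy eq[OF c(1)]] by simp
  qed
qed

text \<open>
  Base change to an orbit reduces the norm to the case of \<open>G/e\<close>. The second alternative occurs when the fibre
  is empty.
\<close>

lemma norm_idempotent_free_aux: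
  assumes B: "fin_gset G B" and C: "fin_gset G C" and g: "gset_map G C B g"
    and x: "x \<in> Tob R B" "mul.op B x x = x" and b: "b \<in> pts B"
  shows "rs \<O> B (orbit_map B b) (nm C B g (rs C B g x)) = rs \<O> B (orbit_map B b) x \<or>
    rs \<O> B (orbit_map B b) (nm C B g (rs C B g x)) = mul.unit \<O> \<and> g ` pts C \<noteq> pts B"
proof -
  let ?t = "orbit_map B b"
  note t = orbit_map[OF B b]
  obtain Q u v where Q: "pullback G Q u v C g \<O> ?t B" using pullback_exists[OF C free_orbit B g t] by blast
  note QD = pullbackD[OF Q]
  have gx: "rs C B g x \<in> Tob R C" and tx: "rs \<O> B ?t x \<in> Tob R \<O>"
    using basic_closed(1)[OF C B g x(1)] basic_closed(1)[OF free_orbit B t x(1)] .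
  have "rs Q C u (rs C B g x) = rs Q B (\<lambda>a. g (u a)) x" by (rule basic_comp(1)[OF QD(1) C B QD(5) g x(1)])
  also have "\<dots> = rs Q B (\<lambda>a. ?t (v a)) x"
    using basic_cong(1)[OF QD(1) B gset_map_comp[OF QD(5) g], of "\<lambda>a. ?t (v a)"] QD(9) by simp
  also have "\<dots> = rs Q \<O> v (rs \<O> B ?t x)" by (rule basic_comp(1)[OF QD(1) free_orbit B QD(6) t x(1), symmetric])
  finally have "rs \<O> B ?t (nm C B g (rs C B g x)) = nm Q \<O> v (rs Q \<O> v (rs \<O> B ?t x))"
    using base_change(1)[OF Q gx] by simp
  also have "\<dots> = (if pts Q = {} then mul.unit \<O> else rs \<O> B ?t x)"
    by (rule norm_idempotent_orbit[OF tx _ QD(1) QD(6)]) (use mul.rs_op[OF free_orbit B t x(1) x(1)] x(2) in simp)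
  finally have 1: "rs \<O> B ?t (nm C B g (rs C B g x)) = (if pts Q = {} then mul.unit \<O> else rs \<O> B ?t x)" .
  have "pts Q \<noteq> {}" if s: "g ` pts C = pts B"
  proof -
    obtain c where "c \<in> pts C" "g c = b" using b unfolding s[symmetric] by auto
    then have "\<exists>p\<in>pts Q. u p = c \<and> v p = num \<one>\<^bsub>G\<^esub>" using orbit_map_one[OF B b] by (intro QD(11)) auto
    then show ?thesis by blast
  qed
  then show ?thesis using 1 by auto
qed

text \<open>
  By separation it suffices to compare both sides on orbits, where the norm contributes the idempotent itself or, over
  an empty fibre, the unit. On sets that are not free, idempotents need not be absorbed by their norms.
\<close>

lemma norm_idempotent_free:
  assumes B: "fin_gset G B" "gset_map G B \<O> \<epsilon>" and C: "fin_gset G C" and g: "gset_map G C B g"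
    and x: "x \<in> Tob R B" "mul.op B x x = x"
  shows "mul.op B x (nm C B g (rs C B g x)) = x"
    and "g ` pts C = pts B \<Longrightarrow> nm C B g (rs C B g x) = x"
proof -
  have gx: "nm C B g (rs C B g x) \<in> Tob R B" using B C g x basic_closed[OF C B(1) g] by blast
  note t = orbit_map[OF B(1)]
  have tx: "rs \<O> B (orbit_map B b) x \<in> Tob R \<O>" if "b \<in> pts B" for b
    by (rule basic_closed(1)[OF free_orbit B(1) t[OF that] x(1)])
  have txx: "mul.op \<O> (rs \<O> B (orbit_map B b) x) (rs \<O> B (orbit_map B b) x) = rs \<O> B (orbit_map B b) x" if "b \<in> pts B" for b
    using mul.rs_op[OF free_orbit B(1) t[OF that] x(1) x(1)] x(2) by simp
  show "mul.op B x (nm C B g (rs C B g x)) = x"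
  proof (rule free_separation[OF B mul.op_closed[OF B(1) x(1) gx] x(1)])
    fix b assume b: "b \<in> pts B"
    let ?t = "rs \<O> B (orbit_map B b)"
    show "?t (mul.op B x (nm C B g (rs C B g x))) = ?t x"
      using mul.rs_op[OF free_orbit B(1) t[OF b] x(1) gx] txx[OF b] mul.op_unit[OF free_orbit tx[OF b]]
        mul.op_comm[OF free_orbit tx[OF b] mul.unit_closed[OF free_orbit]]
        norm_idempotent_free_aux[OF B(1) C g x b] by auto
  qed
  show "nm C B g (rs C B g x) = x" if s: "g ` pts C = pts B"
  proof (rule free_separation[OF B gx x(1)])
    fix b assume b: "b \<in> pts B"
    show "rs \<O> B (orbit_map B b) (nm C B g (rs C B g x)) = rs \<O> B (orbit_map B b) x"
      using norm_idempotent_free_aux[OF B(1) C g x b] s by auto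
  qed
qed

end

section \<open>Coset representatives and induced sets\<close>

text \<open>
  A representative of the coset \<open>gH\<close> that depends only on the coset.
\<close>

definition rep :: "('g, 'm) monoid_scheme \<Rightarrow> 'g set \<Rightarrow> 'g \<Rightarrow> 'g" where
  "rep G H g = (SOME x. \<exists>h\<in>H. x = g \<otimes>\<^bsub>G\<^esub> h)"

text \<open>
  The points of \<open>G/H\<close> are represented by chosen representatives, so that a point of \<open>G \<times>\<^sub>H Y\<close> is a pair of
  a representative and a point of \<open>Y\<close>.
\<close>

definition coset_gset :: "('g, 'm) monoid_scheme \<Rightarrow> 'g set \<Rightarrow> 'g gset" where
  "coset_gset G H = \<lparr>pts = to_nat_on (carrier G) ` rep G H ` carrier G,
     act = (\<lambda>g. \<lambda>n\<in>to_nat_on (carrier G) ` rep G H ` carrier G.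
       to_nat_on (carrier G) (rep G H (g \<otimes>\<^bsub>G\<^esub> from_nat_into (carrier G) n)))\<rparr>"

text \<open>
  The set \<open>G \<times>\<^sub>H Y\<close> as a set of pairs \<open>(r, y)\<close>, standing for the class of \<open>(r, y)\<close>. As
  \<open>g r = r' h\<close> with \<open>r'\<close> the representative of \<open>g r\<close> and \<open>h = r'\<^sup>-\<^sup>1 g r \<in> H\<close>, the element \<open>g\<close> acts by
  \<open>(r, y) \<mapsto> (r', h y)\<close>. Maps act on the second component alone, so induction commutes strictly with
  composition.
\<close>

definition induced :: "('g, 'm) monoid_scheme \<Rightarrow> 'g set \<Rightarrow> 'g gset \<Rightarrow> 'g gset" where
  "induced G H Y = \<lparr>pts = prod_encode ` (pts (coset_gset G H) \<times> pts Y),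
     act = (\<lambda>g. \<lambda>n\<in>prod_encode ` (pts (coset_gset G H) \<times> pts Y).
       case prod_decode n of (j, y) \<Rightarrow>
         let k = g \<otimes>\<^bsub>G\<^esub> from_nat_into (carrier G) j
         in prod_encode (to_nat_on (carrier G) (rep G H k), act Y (inv\<^bsub>G\<^esub> (rep G H k) \<otimes>\<^bsub>G\<^esub> k) y))\<rparr>"

definition induced_map :: "(nat \<Rightarrow> nat) \<Rightarrow> nat \<Rightarrow> nat" where
  "induced_map f n = (case prod_decode n of (j, y) \<Rightarrow> prod_encode (j, f y))"

definition coset_of :: "nat \<Rightarrow> nat" where "coset_of n = fst (prod_decode n)"

definition induced_bispan :: "('g, 'm) monoid_scheme \<Rightarrow> 'g set \<Rightarrow> 'g bispan \<Rightarrow> 'g bispan" where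
  "induced_bispan G H b = \<lparr>src = induced G H (src b), apexA = induced G H (apexA b), apexB = induced G H (apexB b),
     tgt = induced G H (tgt b), legp = induced_map (legp b), legf = induced_map (legf b), legq = induced_map (legq b)\<rparr>"

lemma induced_map_simps [simp]:
  "induced_map f (prod_encode (j, y)) = prod_encode (j, f y)" "coset_of (prod_encode (j, y)) = j"
  "coset_of (induced_map f n) = coset_of n"
  by (simp_all add: induced_map_def coset_of_def case_prod_unfold)

lemma induced_map_comp: "induced_map f (induced_map g n) = induced_map (\<lambda>y. f (g y)) n"
  by (simp add: induced_map_def case_prod_unfold)

locale finite_subgroup = finite_group G + H: subgroup H G
  for G :: "('g, 'm) monoid_scheme" and H :: "'g set"
begin

lemma H: "subgroup H G" by (rule H.subgroup_axioms)

abbreviation "rp \<equiv> rep G H"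

abbreviation "J \<equiv> coset_gset G H"

lemma rep:
  assumes "g \<in> carrier G"
  obtains h where "h \<in> H" "rp g = g \<otimes>\<^bsub>G\<^esub> h"
proof -
  have "\<exists>x. \<exists>h\<in>H. x = g \<otimes>\<^bsub>G\<^esub> h" using H.one_closed by blast
  then have "\<exists>h\<in>H. rp g = g \<otimes>\<^bsub>G\<^esub> h" unfolding rep_def by (rule someI_ex)
  then show thesis using that by blast
qed

lemma rep_closed [simp]: "g \<in> carrier G \<Longrightarrow> rp g \<in> carrier G"
  by (metis rep G.m_closed H.mem_carrier)

lemma inv_rep: "g \<in> carrier G \<Longrightarrow> inv\<^bsub>G\<^esub> (rp g) \<otimes>\<^bsub>G\<^esub> g \<in> H"
proof -
  assume g: "g \<in> carrier G"
  obtain h where h: "h \<in> H" "rp g = g \<otimes>\<^bsub>G\<^esub> h" using rep[OF g] .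
  then have "inv\<^bsub>G\<^esub> (rp g) \<otimes>\<^bsub>G\<^esub> g = inv\<^bsub>G\<^esub> h"
    using g by (simp add: G.inv_mult_group G.m_assoc)
  then show ?thesis using h by simp
qed

lemma rep_mult [simp]:
  assumes g: "g \<in> carrier G" and h: "h \<in> H"
  shows "rp (g \<otimes>\<^bsub>G\<^esub> h) = rp g"
proof -
  have "(\<exists>k\<in>H. x = g \<otimes>\<^bsub>G\<^esub> h \<otimes>\<^bsub>G\<^esub> k) \<longleftrightarrow> (\<exists>k\<in>H. x = g \<otimes>\<^bsub>G\<^esub> k)" for x
  proof
    assume "\<exists>k\<in>H. x = g \<otimes>\<^bsub>G\<^esub> h \<otimes>\<^bsub>G\<^esub> k"
    then show "\<exists>k\<in>H. x = g \<otimes>\<^bsub>G\<^esub> k" using g h by (metis G.m_assoc H.m_closed H.mem_carrier)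
  next
    assume "\<exists>k\<in>H. x = g \<otimes>\<^bsub>G\<^esub> k"
    then obtain k where k: "k \<in> H" "x = g \<otimes>\<^bsub>G\<^esub> k" by blast
    have "h \<otimes>\<^bsub>G\<^esub> (inv\<^bsub>G\<^esub> h \<otimes>\<^bsub>G\<^esub> k) = k" using h k by (simp flip: G.m_assoc)
    then have "x = g \<otimes>\<^bsub>G\<^esub> h \<otimes>\<^bsub>G\<^esub> (inv\<^bsub>G\<^esub> h \<otimes>\<^bsub>G\<^esub> k)"
      using g h k by (simp add: G.m_assoc)
    then show "\<exists>k\<in>H. x = g \<otimes>\<^bsub>G\<^esub> h \<otimes>\<^bsub>G\<^esub> k" using h k by blast
  qed
  then show ?thesis by (simp add: rep_def)
qed

lemma rep_eq_iff:
  assumes "g \<in> carrier G" "k \<in> carrier G"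
  shows "rp g = rp k \<longleftrightarrow> inv\<^bsub>G\<^esub> g \<otimes>\<^bsub>G\<^esub> k \<in> H"
proof
  assume "inv\<^bsub>G\<^esub> g \<otimes>\<^bsub>G\<^esub> k \<in> H"
  then have "rp (g \<otimes>\<^bsub>G\<^esub> (inv\<^bsub>G\<^esub> g \<otimes>\<^bsub>G\<^esub> k)) = rp g" by (rule rep_mult[OF assms(1)])
  then show "rp g = rp k" using assms by (simp flip: G.m_assoc)
next
  assume eq: "rp g = rp k"
  obtain h where h: "h \<in> H" "rp g = g \<otimes>\<^bsub>G\<^esub> h" using rep[OF assms(1)] .
  obtain h' where h': "h' \<in> H" "rp k = k \<otimes>\<^bsub>G\<^esub> h'" using rep[OF assms(2)] .
  have "k \<otimes>\<^bsub>G\<^esub> h' \<otimes>\<^bsub>G\<^esub> inv\<^bsub>G\<^esub> h' = k" using h' assms by (simp add: G.m_assoc)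
  then have k: "k = g \<otimes>\<^bsub>G\<^esub> h \<otimes>\<^bsub>G\<^esub> inv\<^bsub>G\<^esub> h'" using h h' eq by simp
  have "inv\<^bsub>G\<^esub> g \<otimes>\<^bsub>G\<^esub> (g \<otimes>\<^bsub>G\<^esub> h \<otimes>\<^bsub>G\<^esub> inv\<^bsub>G\<^esub> h') = h \<otimes>\<^bsub>G\<^esub> inv\<^bsub>G\<^esub> h'"
    using assms h h' by (simp flip: G.m_assoc)
  then have "inv\<^bsub>G\<^esub> g \<otimes>\<^bsub>G\<^esub> k = h \<otimes>\<^bsub>G\<^esub> inv\<^bsub>G\<^esub> h'" by (simp only: k)
  then show "inv\<^bsub>G\<^esub> g \<otimes>\<^bsub>G\<^esub> k \<in> H" using h h' by simp
qed

lemma rep_mult_rep [simp]: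
  assumes "g \<in> carrier G" "k \<in> carrier G"
  shows "rp (g \<otimes>\<^bsub>G\<^esub> rp k) = rp (g \<otimes>\<^bsub>G\<^esub> k)"
proof -
  obtain h where h: "h \<in> H" "rp k = k \<otimes>\<^bsub>G\<^esub> h" using rep[OF assms(2)] .
  then show ?thesis using assms by (simp flip: G.m_assoc)
qed

lemma rep_rep [simp]: "g \<in> carrier G \<Longrightarrow> rp (rp g) = rp g"
  using rep_mult_rep[OF G.one_closed] by simp

lemma coset_gset_simps [simp]:
  "pts J = num ` rp ` carrier G"
  "k \<in> carrier G \<Longrightarrow> act J g (num (rp k)) = num (rp (g \<otimes>\<^bsub>G\<^esub> rp k))"
  by (auto simp: coset_gset_def)

lemma J: "fin_gset G J"
proof (rule fin_gsetI)
  show "act J g \<in> extensional (pts J)" for g by (simp add: coset_gset_def)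
  show "act J (g \<otimes>\<^bsub>G\<^esub> h) x = act J g (act J h x)" if "g \<in> carrier G" "h \<in> carrier G" "x \<in> pts J" for g h x
    using that by (auto simp flip: G.m_assoc)
qed (auto simp: is_grp finite_carrier simp del: rep_mult)

definition \<pi> :: "nat \<Rightarrow> nat" where "\<pi> n = num (rp (elt n))"

lemma \<pi>_num [simp]: "g \<in> carrier G \<Longrightarrow> \<pi> (num g) = num (rp g)" by (simp add: \<pi>_def)

lemma \<pi>: "gset_map G \<O> J \<pi>"
  by (auto simp: gset_map_def)

lemma \<pi>_surj: "j \<in> pts J \<Longrightarrow> \<exists>g\<in>carrier G. j = \<pi> (num g)" by auto

lemma orbit_map_J:
  assumes "g \<in> carrier G" "n \<in> pts \<O>"
  shows "orbit_map J (\<pi> (num g)) n = \<pi> (right_mult G g n)"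
  using orbit_map_comp[OF \<pi> _ assms(2), of "num g"] orbit_map_free[OF assms] assms(1) by simp

abbreviation "GH \<equiv> G\<lparr>carrier := H\<rparr>"

abbreviation "Ind \<equiv> induced G H"

lemma GH_group: "group GH" by (rule subgroup.subgroup_is_group[OF H is_grp])

lemma Ind_pts: "pts (Ind Y) = prod_encode ` (pts J \<times> pts Y)" by (simp add: induced_def)

lemma Ind_mem [simp]: "prod_encode (j, y) \<in> pts (Ind Y) \<longleftrightarrow> j \<in> pts J \<and> y \<in> pts Y"
  unfolding Ind_pts by (auto simp: inj_image_mem_iff[OF inj_prod_encode] simp del: coset_gset_simps)

lemma Ind_cases:
  assumes "n \<in> pts (Ind Y)"
  obtains r y where "r \<in> carrier G" "rp r = r" "y \<in> pts Y" "n = prod_encode (num r, y)"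
proof -
  obtain j y where jy: "j \<in> pts J" "y \<in> pts Y" "n = prod_encode (j, y)" using assms by (auto simp only: Ind_pts)
  then obtain g where "g \<in> carrier G" "j = num (rp g)" by auto
  then show thesis using that[of "rp g" y] jy by simp
qed

lemma num_J [simp]: "r \<in> carrier G \<Longrightarrow> num (rp r) \<in> pts J" by simp

lemma num_J' [simp]: "r \<in> carrier G \<Longrightarrow> rp r = r \<Longrightarrow> num r \<in> pts J" by (metis num_J)

lemma Ind_act [simp]:
  assumes "r \<in> carrier G" "rp r = r" "y \<in> pts Y"
  shows "act (Ind Y) g (prod_encode (num r, y)) =
    prod_encode (num (rp (g \<otimes>\<^bsub>G\<^esub> r)), act Y (inv\<^bsub>G\<^esub> (rp (g \<otimes>\<^bsub>G\<^esub> r)) \<otimes>\<^bsub>G\<^esub> (g \<otimes>\<^bsub>G\<^esub> r)) y)"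
proof -
  have "prod_encode (num r, y) \<in> prod_encode ` (pts J \<times> pts Y)" using assms num_J' by blast
  then show ?thesis using assms by (simp add: induced_def Let_def del: coset_gset_simps)
qed

text \<open>
  The elements \<open>r'\<^sup>-\<^sup>1 g r\<close> of \<open>H\<close> satisfy the cocycle identity.
\<close>

lemma Ind_gset:
  assumes Y: "fin_gset GH Y"
  shows "fin_gset G (Ind Y)"
proof (rule fin_gsetI)
  note YD = fin_gsetD[OF Y]
  show "group G" by (rule is_grp)
  show "finite (pts (Ind Y))" unfolding Ind_pts using fin_gsetD(2)[OF J] YD(2) by blast
  show "act (Ind Y) g \<in> extensional (pts (Ind Y))" for g by (simp add: induced_def)
  show "act (Ind Y) g n \<in> pts (Ind Y)" if "g \<in> carrier G" "n \<in> pts (Ind Y)" for g n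
    using that YD(3) inv_rep by (auto elim!: Ind_cases simp del: coset_gset_simps)
  show "act (Ind Y) \<one>\<^bsub>G\<^esub> n = n" if n: "n \<in> pts (Ind Y)" for n
    using n YD(4) by (auto elim!: Ind_cases simp del: coset_gset_simps)
  show "act (Ind Y) (g \<otimes>\<^bsub>G\<^esub> h) n = act (Ind Y) g (act (Ind Y) h n)"
    if gh: "g \<in> carrier G" "h \<in> carrier G" and n: "n \<in> pts (Ind Y)" for g h n
  proof -
    obtain r y where r: "r \<in> carrier G" "rp r = r" "y \<in> pts Y" "n = prod_encode (num r, y)" using Ind_cases[OF n] .
    let ?k = "h \<otimes>\<^bsub>G\<^esub> r" and ?l = "g \<otimes>\<^bsub>G\<^esub> (h \<otimes>\<^bsub>G\<^esub> r)"
    let ?a = "inv\<^bsub>G\<^esub> (rp ?l) \<otimes>\<^bsub>G\<^esub> (g \<otimes>\<^bsub>G\<^esub> rp ?k)" and ?b = "inv\<^bsub>G\<^esub> (rp ?k) \<otimes>\<^bsub>G\<^esub> ?k"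
    have k: "?k \<in> carrier G" and l: "?l \<in> carrier G" using gh r by auto
    have rl: "rp (g \<otimes>\<^bsub>G\<^esub> rp ?k) = rp ?l" using gh k by simp
    have b: "?b \<in> H" using inv_rep[OF k] .
    have a: "?a \<in> H" using inv_rep[of "g \<otimes>\<^bsub>G\<^esub> rp ?k"] gh k rl by simp
    have "?a \<otimes>\<^bsub>G\<^esub> ?b = inv\<^bsub>G\<^esub> (rp ?l) \<otimes>\<^bsub>G\<^esub> ?l"
    proof -
      have "rp ?k \<otimes>\<^bsub>G\<^esub> (inv\<^bsub>G\<^esub> (rp ?k) \<otimes>\<^bsub>G\<^esub> ?k) = ?k" using k by (simp flip: G.m_assoc)
      then show ?thesis using gh k l r by (simp add: G.m_assoc)
    qed
    then have "act Y (inv\<^bsub>G\<^esub> (rp ?l) \<otimes>\<^bsub>G\<^esub> ?l) y = act Y ?a (act Y ?b y)"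
      using YD(5)[of ?a ?b y] a b r(3) by simp
    moreover have "act Y ?b y \<in> pts Y" using YD(3)[of ?b y] b r(3) by simp
    moreover have "g \<otimes>\<^bsub>G\<^esub> h \<otimes>\<^bsub>G\<^esub> r = ?l" using gh r by (simp add: G.m_assoc)
    ultimately show ?thesis using r gh k rl by (simp del: rep_mult_rep)
  qed
qed

lemma Ind_map:
  assumes f: "gset_map GH Y Z f"
  shows "gset_map G (Ind Y) (Ind Z) (induced_map f)"
  unfolding gset_map_def
proof (intro conjI ballI funcsetI)
  show "induced_map f n \<in> pts (Ind Z)" if "n \<in> pts (Ind Y)" for n
    using that gset_mapD(1)[OF f] by (auto elim!: Ind_cases simp del: coset_gset_simps)
  fix g n assume g: "g \<in> carrier G" and n: "n \<in> pts (Ind Y)"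
  then obtain r y where r: "r \<in> carrier G" "rp r = r" "y \<in> pts Y" "n = prod_encode (num r, y)" by (rule_tac Ind_cases)
  have "inv\<^bsub>G\<^esub> (rp (g \<otimes>\<^bsub>G\<^esub> r)) \<otimes>\<^bsub>G\<^esub> (g \<otimes>\<^bsub>G\<^esub> r) \<in> H" using inv_rep g r by simp
  then show "induced_map f (act (Ind Y) g n) = act (Ind Z) g (induced_map f n)"
    using r gset_mapD(1)[OF f r(3)] gset_mapD(2)[OF f _ r(3)] by simp
qed

lemma coset_of_map: "gset_map G (Ind Y) J coset_of"
  unfolding gset_map_def
proof (intro conjI ballI funcsetI)
  show "coset_of n \<in> pts J" if "n \<in> pts (Ind Y)" for n
    using that by (auto elim!: Ind_cases simp del: coset_gset_simps)
  fix g n assume g: "g \<in> carrier G" and n: "n \<in> pts (Ind Y)"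
  then obtain r y where r: "r \<in> carrier G" "rp r = r" "y \<in> pts Y" "n = prod_encode (num r, y)" by (rule_tac Ind_cases)
  have "act J g (num r) = num (rp (g \<otimes>\<^bsub>G\<^esub> r))" using coset_gset_simps(2)[OF r(1), of g] r(2) by simp
  then show "coset_of (act (Ind Y) g n) = act J g (coset_of n)" using r by simp
qed

lemma Ind_pullback:
  assumes P: "pullback GH P u v A f B g C"
  shows "pullback G (Ind P) (induced_map u) (induced_map v) (Ind A) (induced_map f) (Ind B) (induced_map g) (Ind C)"
proof (rule pullbackI)
  note PD = pullbackD[OF P]
  show "fin_gset G (Ind P)" "fin_gset G (Ind A)" "fin_gset G (Ind B)" "fin_gset G (Ind C)"
    using PD by (auto intro: Ind_gset)
  show "gset_map G (Ind P) (Ind A) (induced_map u)" "gset_map G (Ind P) (Ind B) (induced_map v)"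
    "gset_map G (Ind A) (Ind C) (induced_map f)" "gset_map G (Ind B) (Ind C) (induced_map g)"
    using PD by (auto intro: Ind_map)
  show "induced_map f (induced_map u p) = induced_map g (induced_map v p)" if "p \<in> pts (Ind P)" for p
    using that PD(9) by (auto elim!: Ind_cases)
  show "p = q" if "p \<in> pts (Ind P)" "q \<in> pts (Ind P)" "induced_map u p = induced_map u q" "induced_map v p = induced_map v q" for p q
    using that PD(10) by (auto elim!: Ind_cases)
  show "\<exists>p\<in>pts (Ind P). induced_map u p = a \<and> induced_map v p = b"
    if ab: "a \<in> pts (Ind A)" "b \<in> pts (Ind B)" "induced_map f a = induced_map g b" for a b
  proof -
    obtain r x where a: "r \<in> carrier G" "rp r = r" "x \<in> pts A" "a = prod_encode (num r, x)" using Ind_cases[OF ab(1)] .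
    obtain t y where b: "t \<in> carrier G" "rp t = t" "y \<in> pts B" "b = prod_encode (num t, y)" using Ind_cases[OF ab(2)] .
    have "num r = num t" "f x = g y" using ab(3) a b by auto
    then obtain p where "p \<in> pts P" "u p = x" "v p = y" using PD(11)[OF a(3) b(3)] by blast
    then have "prod_encode (num r, p) \<in> pts (Ind P)" "induced_map u (prod_encode (num r, p)) = a" "induced_map v (prod_encode (num r, p)) = b"
      using a b \<open>num r = num t\<close> by (auto simp del: coset_gset_simps)
    then show ?thesis by blast
  qed
qed

text \<open>
  Maps between induced sets preserve the coset, so a section over a fibre of the induced map is the same as a
  section over one fibre of the original map, labelled with a coset.
\<close>

lemma Ind_exponential:
  assumes X: "exponential GH P g A f B E e f' D r"
  shows "exponential G (Ind P) (induced_map g) (Ind A) (induced_map f) (Ind B) (Ind E) (induced_map e)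
    (induced_map f') (Ind D) (induced_map r)"
proof -
  have EP: "pullback GH E (\<lambda>x. g (e x)) f' A f D r B" and P: "fin_gset GH P" and gP: "gset_map GH P A g" and e: "gset_map GH E P e"
    and uni: "\<And>b s. b \<in> pts B \<Longrightarrow> (\<forall>a\<in>pts A. f a = b \<longrightarrow> s a \<in> pts P \<and> g (s a) = a) \<Longrightarrow>
       (\<exists>!d. d \<in> pts D \<and> r d = b \<and> (\<forall>x\<in>pts E. f' x = d \<longrightarrow> e x = s (g (e x))))"
    using X unfolding exponential_def by auto
  note ED = pullbackD[OF EP]
  show ?thesis
    unfolding exponential_def
  proof (intro conjI ballI allI impI)
    show "pullback G (Ind E) (\<lambda>x. induced_map g (induced_map e x)) (induced_map f') (Ind A) (induced_map f) (Ind D) (induced_map r) (Ind B)"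
      using Ind_pullback[OF EP] by (simp add: induced_map_comp)
    fix \<beta> s assume \<beta>: "\<beta> \<in> pts (Ind B)" and s: "\<forall>a\<in>pts (Ind A). induced_map f a = \<beta> \<longrightarrow> s a \<in> pts (Ind P) \<and> induced_map g (s a) = a"
    obtain t b where b: "t \<in> carrier G" "rp t = t" "b \<in> pts B" "\<beta> = prod_encode (num t, b)" using Ind_cases[OF \<beta>] .
    define s' where "s' a = snd (prod_decode (s (prod_encode (num t, a))))" for a
    have ss: "s (prod_encode (num t, a)) = prod_encode (num t, s' a) \<and> s' a \<in> pts P \<and> g (s' a) = a"
      if a: "a \<in> pts A" "f a = b" for a
    proof -
      have 1: "s (prod_encode (num t, a)) \<in> pts (Ind P)" "induced_map g (s (prod_encode (num t, a))) = prod_encode (num t, a)"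
        using s a b by (auto simp del: coset_gset_simps)
      obtain t' p where p: "t' \<in> carrier G" "rp t' = t'" "p \<in> pts P" "s (prod_encode (num t, a)) = prod_encode (num t', p)"
        using Ind_cases[OF 1(1)] .
      then show ?thesis using 1(2) by (simp add: s'_def)
    qed
    have tJ: "num t \<in> pts J" using b by (simp del: coset_gset_simps)
    have iff: "(\<forall>x\<in>pts (Ind E). induced_map f' x = prod_encode (num t, d) \<longrightarrow> induced_map e x = s (induced_map g (induced_map e x)))
        \<longleftrightarrow> (\<forall>x\<in>pts E. f' x = d \<longrightarrow> e x = s' (g (e x)))" if d: "d \<in> pts D" "r d = b" for d
    proof -
      have eq: "induced_map e (prod_encode (num t, x)) = s (induced_map g (induced_map e (prod_encode (num t, x)))) \<longleftrightarrow> e x = s' (g (e x))"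
        if x: "x \<in> pts E" "f' x = d" for x
      proof -
        have "g (e x) \<in> pts A" "f (g (e x)) = b" using gset_mapD(1)[OF ED(5) x(1)] ED(9)[OF x(1)] x(2) d by auto
        then show ?thesis using ss by simp
      qed
      show ?thesis
      proof (intro iffI ballI impI)
        fix x assume l: "\<forall>x\<in>pts (Ind E). induced_map f' x = prod_encode (num t, d) \<longrightarrow> induced_map e x = s (induced_map g (induced_map e x))"
          and x: "x \<in> pts E" "f' x = d"
        have "prod_encode (num t, x) \<in> pts (Ind E)" "induced_map f' (prod_encode (num t, x)) = prod_encode (num t, d)"
          using tJ x by (auto simp del: coset_gset_simps)
        then show "e x = s' (g (e x))" using l eq[OF x] by blast
      next
        fix \<xi> assume l: "\<forall>x\<in>pts E. f' x = d \<longrightarrow> e x = s' (g (e x))" and \<xi>: "\<xi> \<in> pts (Ind E)" "induced_map f' \<xi> = prod_encode (num t, d)"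
        obtain t' x where x: "x \<in> pts E" "\<xi> = prod_encode (num t', x)" using Ind_cases[OF \<xi>(1)] by metis
        then have "\<xi> = prod_encode (num t, x)" "f' x = d" using \<xi>(2) by auto
        then show "induced_map e \<xi> = s (induced_map g (induced_map e \<xi>))" using l eq x(1) by blast
      qed
    qed
    obtain d where d: "d \<in> pts D" "r d = b" "\<forall>x\<in>pts E. f' x = d \<longrightarrow> e x = s' (g (e x))"
      and du: "\<And>d'. d' \<in> pts D \<Longrightarrow> r d' = b \<Longrightarrow> \<forall>x\<in>pts E. f' x = d' \<longrightarrow> e x = s' (g (e x)) \<Longrightarrow> d' = d"
      using uni[OF b(3), of s'] ss by blast
    show "\<exists>!d. d \<in> pts (Ind D) \<and> induced_map r d = \<beta> \<and> (\<forall>x\<in>pts (Ind E). induced_map f' x = d \<longrightarrow> induced_map e x = s (induced_map g (induced_map e x)))"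
    proof (rule ex1I[of _ "prod_encode (num t, d)"])
      show "prod_encode (num t, d) \<in> pts (Ind D) \<and> induced_map r (prod_encode (num t, d)) = \<beta> \<and>
        (\<forall>x\<in>pts (Ind E). induced_map f' x = prod_encode (num t, d) \<longrightarrow> induced_map e x = s (induced_map g (induced_map e x)))"
        unfolding iff[OF d(1,2)] using d b tJ by (simp del: coset_gset_simps)
    next
      fix \<delta> assume \<delta>: "\<delta> \<in> pts (Ind D) \<and> induced_map r \<delta> = \<beta> \<and> (\<forall>x\<in>pts (Ind E). induced_map f' x = \<delta> \<longrightarrow> induced_map e x = s (induced_map g (induced_map e x)))"
      then obtain t' d' where d': "d' \<in> pts D" "\<delta> = prod_encode (num t', d')" by (metis Ind_cases)
      then have "num t' = num t" and rd': "r d' = b" using \<delta> b(4) by auto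
      then have \<delta>e: "\<delta> = prod_encode (num t, d')" using d' by simp
      have "d' = d" by (rule du[OF d'(1) rd']) (use \<delta>[unfolded \<delta>e iff[OF d'(1) rd']] in blast)
      then show "\<delta> = prod_encode (num t, d)" using \<delta>e by simp
    qed
  qed (intro Ind_gset Ind_map P gP e)+
qed

lemma Ind_bispan: "is_bispan GH b \<Longrightarrow> is_bispan G (induced_bispan G H b)"
  by (auto simp: is_bispan_def induced_bispan_def intro: Ind_gset Ind_map)

lemma Ind_bispan_iso:
  assumes i: "bispan_iso GH b b'"
  shows "bispan_iso G (induced_bispan G H b) (induced_bispan G H b')"
proof -
  obtain \<alpha> \<beta> where m: "gset_map GH (apexA b) (apexA b') \<alpha>" "bij_betw \<alpha> (pts (apexA b)) (pts (apexA b'))"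
    "gset_map GH (apexB b) (apexB b') \<beta>" "bij_betw \<beta> (pts (apexB b)) (pts (apexB b'))"
    "\<forall>a\<in>pts (apexA b). legp b' (\<alpha> a) = legp b a \<and> legf b' (\<alpha> a) = \<beta> (legf b a)"
    "\<forall>x\<in>pts (apexB b). legq b' (\<beta> x) = legq b x" and st: "src b = src b'" "tgt b = tgt b'"
    using i unfolding bispan_iso_def by blast
  have bij: "bij_betw (induced_map f) (pts (Ind X)) (pts (Ind Y))" if "bij_betw f (pts X) (pts Y)" for f X Y
  proof -
    have "inj_on (induced_map f) (pts (Ind X))"
      using that by (auto simp: inj_on_def bij_betw_def Ind_pts)
    moreover have "induced_map f ` pts (Ind X) = prod_encode ` (pts J \<times> f ` pts X)"
      unfolding Ind_pts by (auto simp: image_iff simp del: coset_gset_simps)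
    ultimately show ?thesis using that by (simp add: bij_betw_def Ind_pts)
  qed
  show ?thesis
    unfolding bispan_iso_def
  proof (intro conjI exI)
    show "gset_map G (apexA (induced_bispan G H b)) (apexA (induced_bispan G H b')) (induced_map \<alpha>)"
      "gset_map G (apexB (induced_bispan G H b)) (apexB (induced_bispan G H b')) (induced_map \<beta>)"
      using m by (auto simp: induced_bispan_def intro: Ind_map)
    show "bij_betw (induced_map \<alpha>) (pts (apexA (induced_bispan G H b))) (pts (apexA (induced_bispan G H b')))"
      "bij_betw (induced_map \<beta>) (pts (apexB (induced_bispan G H b))) (pts (apexB (induced_bispan G H b')))"
      using m bij by (auto simp: induced_bispan_def)
  qed (use m(5,6) st in \<open>auto simp: induced_bispan_def elim!: Ind_cases\<close>)
qed

lemma Ind_composite: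
  assumes c: "bispan_composite GH b1 b2 c"
  shows "bispan_composite G (induced_bispan G H b1) (induced_bispan G H b2) (induced_bispan G H c)"
proof -
  have b: "is_bispan GH b1" "is_bispan GH b2" "is_bispan GH c" "tgt b1 = src b2" "src c = src b1" "tgt c = tgt b2"
    using c unfolding bispan_composite_def by blast+
  obtain P u v E e f' r n m where
    P: "pullback GH P u v (apexB b1) (legq b1) (apexA b2) (legp b2) (tgt b1)" and
    X: "exponential GH P v (apexA b2) (legf b2) (apexB b2) E e f' (apexB c) r" and
    N: "pullback GH (apexA c) n m (apexA b1) (legf b1) E (\<lambda>x. u (e x)) (apexB b1)" and
    ca: "\<forall>x\<in>pts (apexA c). legp c x = legp b1 (n x) \<and> legf c x = f' (m x)" and
    cb: "\<forall>x\<in>pts (apexB c). legq c x = legq b2 (r x)"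
    using c unfolding bispan_composite_def by blast
  show ?thesis
  proof (rule bispan_compositeI)
    let ?b = "induced_bispan G H"
    show "pullback G (Ind P) (induced_map u) (induced_map v) (apexB (?b b1)) (legq (?b b1)) (apexA (?b b2)) (legp (?b b2)) (tgt (?b b1))"
      using Ind_pullback[OF P] by (simp add: induced_bispan_def)
    show "exponential G (Ind P) (induced_map v) (apexA (?b b2)) (legf (?b b2)) (apexB (?b b2)) (Ind E) (induced_map e) (induced_map f') (apexB (?b c)) (induced_map r)"
      using Ind_exponential[OF X] by (simp add: induced_bispan_def)
    show "pullback G (apexA (?b c)) (induced_map n) (induced_map m) (apexA (?b b1)) (legf (?b b1)) (Ind E) (\<lambda>x. induced_map u (induced_map e x)) (apexB (?b b1))"
      using Ind_pullback[OF N] by (simp add: induced_bispan_def induced_map_comp)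
    show "is_bispan G (?b b1)" "is_bispan G (?b b2)" "is_bispan G (?b c)" using b by (auto intro: Ind_bispan)
    show "tgt (?b b1) = src (?b b2)" "src (?b c) = src (?b b1)" "tgt (?b c) = tgt (?b b2)" using b by (auto simp: induced_bispan_def)
  qed (use ca cb in \<open>auto simp: induced_bispan_def elim!: Ind_cases\<close>)
qed

lemma Ind_coproduct:
  assumes X: "fin_gset GH X" and Y: "fin_gset GH Y"
  shows "coproduct G (Ind X) (induced_map inl) (Ind Y) (induced_map inr) (Ind (gset_sum X Y))"
proof -
  have inj: "inj_on (induced_map i) (pts (Ind Z))" if "inj i" for i and Z :: "'g gset"
    using that by (auto simp: inj_on_def inj_def Ind_pts)
  have im: "induced_map i ` pts (Ind Z) = prod_encode ` (pts J \<times> i ` pts Z)" for i and Z :: "'g gset"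
    unfolding Ind_pts by (auto simp: image_iff simp del: coset_gset_simps)
  have "inj inl" "inj inr" by (auto simp: inj_def)
  then show ?thesis
    unfolding coproduct_def im
    using X Y by (auto simp: fin_gset_sum gset_sum_pts inj image_iff Ind_pts[of "gset_sum X Y"] intro!: Ind_gset Ind_map simp del: coset_gset_simps)
qed

lemma GH_empty: "fin_gset GH gset_empty" by (rule fin_gset_empty[OF GH_group])

lemma Ind_empty: "pts (Ind gset_empty) = {}" by (simp add: Ind_pts)

text \<open>
  For a \<open>G\<close>-set \<open>X\<close>, the map \<open>G \<times>\<^sub>H X \<rightarrow> X\<close> induced by the action.
\<close>

definition pr :: "'g gset \<Rightarrow> nat \<Rightarrow> nat" where
  "pr X n = (case prod_decode n of (j, x) \<Rightarrow> act X (elt j) x)"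

lemma pr_simp [simp]: "r \<in> carrier G \<Longrightarrow> pr X (prod_encode (num r, x)) = act X r x"
  by (simp add: pr_def)

lemma res_gset: "fin_gset G X \<Longrightarrow> fin_gset GH X" by (rule fin_gset_subgroup[OF H])

lemma res_map: "gset_map G X Y f \<Longrightarrow> gset_map GH X Y f" by (rule gset_map_subgroup[OF H])

lemma Ind_G: "fin_gset G X \<Longrightarrow> fin_gset G (Ind X)" by (intro Ind_gset res_gset)

lemma pr_map:
  assumes X: "fin_gset G X"
  shows "gset_map G (Ind X) X (pr X)"
  unfolding gset_map_def
proof (intro conjI ballI funcsetI)
  note XD = fin_gsetD[OF X]
  show "pr X n \<in> pts X" if "n \<in> pts (Ind X)" for n using that XD(3) by (auto elim!: Ind_cases)
  fix g n assume g: "g \<in> carrier G" and n: "n \<in> pts (Ind X)"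
  then obtain r y where r: "r \<in> carrier G" "rp r = r" "y \<in> pts X" "n = prod_encode (num r, y)" by (rule_tac Ind_cases)
  let ?k = "g \<otimes>\<^bsub>G\<^esub> r"
  have k: "?k \<in> carrier G" using g r by simp
  have "rp ?k \<otimes>\<^bsub>G\<^esub> (inv\<^bsub>G\<^esub> (rp ?k) \<otimes>\<^bsub>G\<^esub> ?k) = ?k" using k by (simp flip: G.m_assoc)
  then have "act X (rp ?k) (act X (inv\<^bsub>G\<^esub> (rp ?k) \<otimes>\<^bsub>G\<^esub> ?k) y) = act X ?k y"
    using XD(5)[of "rp ?k" "inv\<^bsub>G\<^esub> (rp ?k) \<otimes>\<^bsub>G\<^esub> ?k" y] k r(3) by simp
  then show "pr X (act (Ind X) g n) = act X g (pr X n)" using r g k XD(5) by simp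
qed

lemma pr_exists:
  assumes X: "fin_gset G X" and r: "r \<in> carrier G" "rp r = r" and x: "x \<in> pts X"
  shows "prod_encode (num r, act X (inv\<^bsub>G\<^esub> r) x) \<in> pts (Ind X)"
    "pr X (prod_encode (num r, act X (inv\<^bsub>G\<^esub> r) x)) = x"
  using act_inverse[OF X r(1) x] fin_gsetD(3)[OF X _ x] r by (simp_all del: coset_gset_simps)

lemma pr_inj:
  assumes X: "fin_gset G X" and pq: "p \<in> pts (Ind X)" "q \<in> pts (Ind X)" "coset_of p = coset_of q" "pr X p = pr X q"
  shows "p = q"
proof -
  obtain r x where p: "r \<in> carrier G" "rp r = r" "x \<in> pts X" "p = prod_encode (num r, x)" using Ind_cases[OF pq(1)] .
  obtain t y where q: "t \<in> carrier G" "rp t = t" "y \<in> pts X" "q = prod_encode (num t, y)" using Ind_cases[OF pq(2)] .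
  have rt: "r = t" using pq(3) p q by (simp add: num_eq_iff)
  then have "act X r x = act X r y" using pq(4) p q by simp
  then have "x = y" using act_inverse(2)[OF X p(1,3)] act_inverse(2)[OF X p(1) q(3)] by metis
  then show ?thesis using p q rt by simp
qed

text \<open>
  Induced maps of \<open>G\<close>-maps are base changes along \<open>pr\<close>: a point of \<open>A\<close> and a coset determine a unique point of \<open>G \<times>\<^sub>H A\<close>.
\<close>

lemma pullback_pr:
  assumes A: "fin_gset G A" and B: "fin_gset G B" and f: "gset_map G A B f"
  shows "pullback G (Ind A) (induced_map f) (pr A) (Ind B) (pr B) A f B"
proof (rule pullbackI)
  show "fin_gset G (Ind A)" "fin_gset G A" "fin_gset G (Ind B)" "fin_gset G B" using A B by (auto intro: Ind_gset res_gset)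
  show "gset_map G (Ind A) (Ind B) (induced_map f)" "gset_map G (Ind A) A (pr A)" "gset_map G (Ind B) B (pr B)" "gset_map G A B f"
    using A B f by (auto intro: Ind_map res_map pr_map)
  show "pr B (induced_map f p) = f (pr A p)" if "p \<in> pts (Ind A)" for p
    using that gset_mapD(2)[OF f] by (auto elim!: Ind_cases)
  show "p = q" if pq: "p \<in> pts (Ind A)" "q \<in> pts (Ind A)" "induced_map f p = induced_map f q" "pr A p = pr A q" for p q
  proof (rule pr_inj[OF A pq(1,2) _ pq(4)])
    show "coset_of p = coset_of q" using induced_map_simps(3)[of f] pq(3) by metis
  qed
  show "\<exists>p\<in>pts (Ind A). induced_map f p = a \<and> pr A p = b"
    if ab: "a \<in> pts (Ind B)" "b \<in> pts A" "pr B a = f b" for a b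
  proof -
    obtain r x where a: "r \<in> carrier G" "rp r = r" "x \<in> pts B" "a = prod_encode (num r, x)" using Ind_cases[OF ab(1)] .
    have "f (act A (inv\<^bsub>G\<^esub> r) b) = act B (inv\<^bsub>G\<^esub> r) (act B r x)" using gset_mapD(2)[OF f _ ab(2)] ab(3) a by simp
    also have "\<dots> = x" by (rule act_inverse(2)[OF B a(1,3)])
    finally have "induced_map f (prod_encode (num r, act A (inv\<^bsub>G\<^esub> r) b)) = a" using a by simp
    then show ?thesis using pr_exists[OF A a(1,2) ab(2)] by blast
  qed
qed

text \<open>
  Base change along this square carries the transfer from \<open>G/H\<close> to the point over to the transfer along \<open>pr\<close>.
\<close>

lemma pullback_coset:
  assumes X: "fin_gset G X"
  shows "pullback G (Ind X) coset_of (pr X) J (\<lambda>_. 0) X (\<lambda>_. 0) point_gset"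
proof (rule pullbackI)
  show "p = q" if pq: "p \<in> pts (Ind X)" "q \<in> pts (Ind X)" "coset_of p = coset_of q" "pr X p = pr X q" for p q
    by (rule pr_inj[OF X pq])
  show "\<exists>p\<in>pts (Ind X). coset_of p = a \<and> pr X p = b" if ab: "a \<in> pts J" "b \<in> pts X" for a b
  proof -
    obtain g where g: "g \<in> carrier G" "a = num (rp g)" using ab(1) by auto
    then show ?thesis using pr_exists[OF X, of "rp g" b] ab by (metis induced_map_simps(2) rep_closed rep_rep)
  qed
qed (use X in \<open>auto intro: Ind_gset res_gset J point coset_of_map pr_map gset_map_point simp del: coset_gset_simps\<close>)

abbreviation "OH \<equiv> free_orbit GH"

abbreviation "numH \<equiv> to_nat_on H"

lemma finH: "finite H" using finite_carrier H.subset by (rule finite_subset[rotated])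

lemma numH [simp]: "h \<in> H \<Longrightarrow> from_nat_into H (numH h) = h"
  by (rule from_nat_into_to_nat_on) (auto intro: countable_finite finH)

lemma OH_simps [simp]: "pts OH = numH ` H" "h \<in> H \<Longrightarrow> act OH g (numH h) = numH (g \<otimes>\<^bsub>G\<^esub> h)"
  "h \<in> H \<Longrightarrow> right_mult GH k (numH h) = numH (h \<otimes>\<^bsub>G\<^esub> k)"
  by (auto simp: free_orbit_def right_mult_def)

lemma finite_group_GH: "finite_group GH"
  using GH_group finH by (simp add: finite_group_def finite_group_axioms_def)

lemma OH: "fin_gset GH OH"
  by (rule finite_group.free_orbit[OF finite_group_GH])

lemma right_mult_H: "h \<in> H \<Longrightarrow> gset_map GH OH OH (right_mult GH h)"
  using finite_group.right_mult[OF finite_group_GH, of h] by simp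

text \<open>
  The isomorphism of \<open>G/e\<close> with \<open>G \<times>\<^sub>H H/e\<close>.
\<close>

definition orbit_iso :: "nat \<Rightarrow> nat" where
  "orbit_iso n = prod_encode (\<pi> n, numH (inv\<^bsub>G\<^esub> (rp (elt n)) \<otimes>\<^bsub>G\<^esub> elt n))"

lemma orbit_iso_num [simp]:
  "x \<in> carrier G \<Longrightarrow> orbit_iso (num x) = prod_encode (num (rp x), numH (inv\<^bsub>G\<^esub> (rp x) \<otimes>\<^bsub>G\<^esub> x))"
  "coset_of (orbit_iso n) = \<pi> n"
  by (simp_all add: orbit_iso_def)

lemma rep_decompose: "x \<in> carrier G \<Longrightarrow> rp x \<otimes>\<^bsub>G\<^esub> (inv\<^bsub>G\<^esub> (rp x) \<otimes>\<^bsub>G\<^esub> x) = x"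
  by (simp flip: G.m_assoc)

lemma orbit_iso: "gset_map G \<O> (Ind OH) orbit_iso"
  unfolding gset_map_def
proof (intro conjI ballI funcsetI)
  show "orbit_iso n \<in> pts (Ind OH)" if "n \<in> pts \<O>" for n using that inv_rep by (auto simp del: coset_gset_simps)
  fix g n assume g: "g \<in> carrier G" and "n \<in> pts \<O>"
  then obtain x where x: "x \<in> carrier G" "n = num x" by auto
  let ?h = "inv\<^bsub>G\<^esub> (rp x) \<otimes>\<^bsub>G\<^esub> x"
  have h: "?h \<in> H" "?h \<in> carrier G" using inv_rep[OF x(1)] H.mem_carrier by auto
  have "inv\<^bsub>G\<^esub> (rp (g \<otimes>\<^bsub>G\<^esub> x)) \<otimes>\<^bsub>G\<^esub> (g \<otimes>\<^bsub>G\<^esub> rp x) \<otimes>\<^bsub>G\<^esub> ?h = inv\<^bsub>G\<^esub> (rp (g \<otimes>\<^bsub>G\<^esub> x)) \<otimes>\<^bsub>G\<^esub> (g \<otimes>\<^bsub>G\<^esub> x)"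
    using g x h(2) rep_decompose[OF x(1)] by (simp add: G.m_assoc)
  then show "orbit_iso (act \<O> g n) = act (Ind OH) g (orbit_iso n)"
    using g x h Ind_act[of "rp x" "numH ?h" OH g] by simp
qed

lemma orbit_iso_bij: "bij_betw orbit_iso (pts \<O>) (pts (Ind OH))"
  unfolding bij_betw_def
proof
  show "inj_on orbit_iso (pts \<O>)"
  proof (rule inj_onI)
    fix m n assume "m \<in> pts \<O>" "n \<in> pts \<O>" and eq: "orbit_iso m = orbit_iso n"
    then obtain x y where xy: "x \<in> carrier G" "m = num x" "y \<in> carrier G" "n = num y" by auto
    have r: "rp x = rp y" using eq xy by (simp add: num_eq_iff)
    have "numH (inv\<^bsub>G\<^esub> (rp x) \<otimes>\<^bsub>G\<^esub> x) = numH (inv\<^bsub>G\<^esub> (rp y) \<otimes>\<^bsub>G\<^esub> y)" using eq xy by simp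
    then have "inv\<^bsub>G\<^esub> (rp x) \<otimes>\<^bsub>G\<^esub> x = inv\<^bsub>G\<^esub> (rp y) \<otimes>\<^bsub>G\<^esub> y" using numH inv_rep xy by metis
    then show "m = n" using rep_decompose[OF xy(1)] rep_decompose[OF xy(3)] r xy by metis
  qed
  have "n \<in> orbit_iso ` pts \<O>" if n: "n \<in> pts (Ind OH)" for n
  proof -
    obtain r y where r: "r \<in> carrier G" "rp r = r" "y \<in> pts OH" "n = prod_encode (num r, y)" using Ind_cases[OF n] .
    obtain h where h: "h \<in> H" "y = numH h" using r(3) by auto
    have "inv\<^bsub>G\<^esub> r \<otimes>\<^bsub>G\<^esub> (r \<otimes>\<^bsub>G\<^esub> h) = h" using r h by (simp flip: G.m_assoc)
    then have "orbit_iso (num (r \<otimes>\<^bsub>G\<^esub> h)) = n" using r h by simp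
    moreover have "num (r \<otimes>\<^bsub>G\<^esub> h) \<in> pts \<O>" using r h by simp
    ultimately show ?thesis by blast
  qed
  then show "orbit_iso ` pts \<O> = pts (Ind OH)" using gset_mapD(1)[OF orbit_iso] by blast
qed

end

section \<open>The idempotent of the coset space\<close>

text \<open>
  The hypotheses of the theorem with the isomorphism \<open>\<phi>\<close> of \<open>G\<close>-rings from \<open>R(G/e)\<close> to the coinduced ring fixed, since
  the constructions below depend on it.
\<close>

locale coinduced_ring = tambara_functor G R
  for G :: "('g, 'm) monoid_scheme" and R :: "('g, 'v) tambara" +
  fixes H :: "'g set" and S :: "('s, 'k) ring_scheme" and \<sigma> :: "'g \<Rightarrow> 's \<Rightarrow> 's" and \<phi> :: "'v \<Rightarrow> 'g \<Rightarrow> 's"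
  assumes sub: "subgroup H G"
    and S: "G_ring (G\<lparr>carrier := H\<rparr>) S \<sigma>"
    and iso: "\<phi> \<in> ring_iso (Tring G R (free_orbit G)) (coind_ring G H S \<sigma>)"
    and equivariant: "g \<in> carrier G \<Longrightarrow> x \<in> Tob R (free_orbit G) \<Longrightarrow> \<phi> (Taction G R g x) = coind_action G g (\<phi> x)"

begin

sublocale finite_subgroup G H
  by (intro finite_subgroup.intro finite_group_axioms sub)

sublocale S: cring S using S by (simp add: G_ring_def)

lemma \<phi>_hom:
  assumes "x \<in> Tob R \<O>" "y \<in> Tob R \<O>"
  shows "\<phi> x \<in> coind_carrier G H S \<sigma>" "\<phi> (mul.op \<O> x y) = (\<lambda>g\<in>carrier G. \<phi> x g \<otimes>\<^bsub>S\<^esub> \<phi> y g)"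
    "\<phi> (plus.op \<O> x y) = (\<lambda>g\<in>carrier G. \<phi> x g \<oplus>\<^bsub>S\<^esub> \<phi> y g)"
  using iso assms by (auto simp: ring_iso_def ring_hom_def coind_ring_def)

lemma \<phi>_carrier: "x \<in> Tob R \<O> \<Longrightarrow> g \<in> carrier G \<Longrightarrow> \<phi> x g \<in> carrier S"
  using \<phi>_hom(1)[of x x] by (auto simp: coind_carrier_def)

lemma \<phi>_ext: "x \<in> Tob R \<O> \<Longrightarrow> \<phi> x \<in> extensional (carrier G)"
  using \<phi>_hom(1)[of x x] by (auto simp: coind_carrier_def PiE_def)

lemma \<phi>_equivariant: "x \<in> Tob R \<O> \<Longrightarrow> h \<in> H \<Longrightarrow> g \<in> carrier G \<Longrightarrow> \<phi> x (h \<otimes>\<^bsub>G\<^esub> g) = \<sigma> h (\<phi> x g)"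
  using \<phi>_hom(1)[of x x] by (auto simp: coind_carrier_def)

lemma \<phi>_one: "\<phi> (mul.unit \<O>) = (\<lambda>g\<in>carrier G. \<one>\<^bsub>S\<^esub>)"
  using iso by (auto simp: ring_iso_def ring_hom_def coind_ring_def)

text \<open>
  The zero of the coinduced ring is not part of the data that a ring homomorphism preserves, but it is the only solution
  of \<open>a = a + a\<close>.
\<close>

lemma \<phi>_zero: "\<phi> (plus.unit \<O>) = (\<lambda>g\<in>carrier G. \<zero>\<^bsub>S\<^esub>)"
proof (rule extensionalityI[OF \<phi>_ext])
  show z: "plus.unit \<O> \<in> Tob R \<O>" by (rule plus.unit_closed[OF free_orbit])
  fix g assume g: "g \<in> carrier G"
  have "\<phi> (plus.op \<O> (plus.unit \<O>) (plus.unit \<O>)) g = \<phi> (plus.unit \<O>) g \<oplus>\<^bsub>S\<^esub> \<phi> (plus.unit \<O>) g"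
    using g by (simp only: \<phi>_hom(3)[OF z z] restrict_apply')
  then have "\<phi> (plus.unit \<O>) g = \<phi> (plus.unit \<O>) g \<oplus>\<^bsub>S\<^esub> \<phi> (plus.unit \<O>) g"
    by (simp only: plus.op_unit[OF free_orbit z])
  then show "\<phi> (plus.unit \<O>) g = (\<lambda>g\<in>carrier G. \<zero>\<^bsub>S\<^esub>) g"
    using \<phi>_carrier[OF z g] g by simp
qed auto

lemma \<phi>_inj: "x \<in> Tob R \<O> \<Longrightarrow> y \<in> Tob R \<O> \<Longrightarrow> (\<And>g. g \<in> carrier G \<Longrightarrow> \<phi> x g = \<phi> y g) \<Longrightarrow> x = y"
  using iso extensionalityI[OF \<phi>_ext \<phi>_ext] by (auto simp: ring_iso_def bij_betw_def inj_on_def)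

lemma \<phi>_surj: "f \<in> coind_carrier G H S \<sigma> \<Longrightarrow> \<exists>x\<in>Tob R \<O>. \<phi> x = f"
proof -
  have "\<phi> ` Tob R \<O> = coind_carrier G H S \<sigma>" using iso by (auto simp: ring_iso_def bij_betw_def coind_ring_def)
  then show "f \<in> coind_carrier G H S \<sigma> \<Longrightarrow> \<exists>x\<in>Tob R \<O>. \<phi> x = f" by (metis imageE)
qed

lemma \<sigma>_hom: "h \<in> H \<Longrightarrow> \<sigma> h \<in> ring_hom S S" using S by (auto simp: G_ring_def ring_iso_def)

definition eps :: 'v where
  "eps = (SOME x. x \<in> Tob R \<O> \<and> \<phi> x = (\<lambda>g\<in>carrier G. if g \<in> H then \<one>\<^bsub>S\<^esub> else \<zero>\<^bsub>S\<^esub>))"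

lemma eps: "eps \<in> Tob R \<O>" "\<phi> eps = (\<lambda>g\<in>carrier G. if g \<in> H then \<one>\<^bsub>S\<^esub> else \<zero>\<^bsub>S\<^esub>)"
proof -
  let ?f = "\<lambda>g\<in>carrier G. if g \<in> H then \<one>\<^bsub>S\<^esub> else \<zero>\<^bsub>S\<^esub>"
  have "h \<otimes>\<^bsub>G\<^esub> g \<in> H \<longleftrightarrow> g \<in> H" if "h \<in> H" "g \<in> carrier G" for h g
    using that by (metis H.m_closed H.m_inv_closed G.inv_solve_left H.mem_carrier G.m_closed)
  moreover have "\<sigma> h \<one>\<^bsub>S\<^esub> = \<one>\<^bsub>S\<^esub>" "\<sigma> h \<zero>\<^bsub>S\<^esub> = \<zero>\<^bsub>S\<^esub>" if "h \<in> H" for h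
    using ring_hom_one[OF \<sigma>_hom[OF that]] ring_hom_zero[OF \<sigma>_hom[OF that] S.ring_axioms S.ring_axioms] .
  ultimately have "?f \<in> coind_carrier G H S \<sigma>" by (auto simp: coind_carrier_def)
  then have "\<exists>x. x \<in> Tob R \<O> \<and> \<phi> x = ?f" using \<phi>_surj by blast
  then have "eps \<in> Tob R \<O> \<and> \<phi> eps = ?f" unfolding eps_def by (rule someI_ex)
  then show "eps \<in> Tob R \<O>" "\<phi> eps = ?f" by auto
qed

abbreviation "ract \<equiv> Taction G R"

lemma ract_closed: "g \<in> carrier G \<Longrightarrow> x \<in> Tob R \<O> \<Longrightarrow> ract g x \<in> Tob R \<O>"
  unfolding Taction_def by (intro basic_closed free_orbit right_mult)

text \<open>
  As \<open>(\<gamma> f)(x) = f(x\<gamma>)\<close>, the translate of the indicator function of \<open>H\<close> by \<open>g\<close> is the indicator function of the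
  right coset \<open>H g\<^sup>-\<^sup>1\<close>. In terms of left cosets this condition on \<open>x\<close> becomes an equation between representatives.
\<close>

lemma \<phi>_ract_eps:
  assumes "g \<in> carrier G" "x \<in> carrier G"
  shows "\<phi> (ract g eps) x = (if rp g = rp (inv\<^bsub>G\<^esub> x) then \<one>\<^bsub>S\<^esub> else \<zero>\<^bsub>S\<^esub>)"
proof -
  have "rp g = rp (inv\<^bsub>G\<^esub> x) \<longleftrightarrow> x \<otimes>\<^bsub>G\<^esub> g \<in> H"
    using rep_eq_iff[of "inv\<^bsub>G\<^esub> x" g] assms by auto
  then show ?thesis using equivariant[OF assms(1) eps(1)] assms by (simp add: coind_action_def eps(2))
qed

lemma eps_idem: "mul.op \<O> eps eps = eps"
  by (rule \<phi>_inj) (auto simp: mul.op_closed free_orbit eps \<phi>_hom)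

lemma ract_eps_eq:
  assumes "g \<in> carrier G" "k \<in> carrier G" "rp g = rp k"
  shows "ract g eps = ract k eps"
  by (rule \<phi>_inj) (use assms in \<open>auto simp: ract_closed eps \<phi>_ract_eps\<close>)

lemma ract_eps_orthogonal:
  assumes "g \<in> carrier G" "k \<in> carrier G" "rp g \<noteq> rp k"
  shows "mul.op \<O> (ract g eps) (ract k eps) = plus.unit \<O>"
  by (rule \<phi>_inj)
    (use assms in \<open>auto simp: mul.op_closed plus.unit_closed free_orbit ract_closed eps \<phi>_ract_eps \<phi>_hom \<phi>_zero\<close>)

text \<open>
  The lift of \<open>eps\<close> to \<open>R(G/H)\<close>.
\<close>

definition coset_idem :: 'v where "coset_idem = nm \<O> J \<pi> eps"

lemma coset_idem: "coset_idem \<in> Tob R J" unfolding coset_idem_def by (intro basic_closed free_orbit J \<pi> eps)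

text \<open>
  Base change expresses the left side as a norm, along one projection of the fibre square of \<open>G/e \<rightarrow> G/H\<close>, of the
  pullback of \<open>eps\<close> along the other. The two pullbacks of \<open>eps\<close> agree because \<open>eps\<close> is fixed by \<open>H\<close>, and
  idempotents on \<open>G/e\<close> survive such norms.
\<close>

lemma rs_\<pi>_coset_idem: "rs \<O> J \<pi> coset_idem = eps"
proof -
  obtain Q u v where Q: "pullback G Q u v \<O> \<pi> \<O> \<pi> J" using pullback_exists[OF free_orbit free_orbit J \<pi> \<pi>] by blast
  note QD = pullbackD[OF Q]
  have uv: "rs Q \<O> u eps = rs Q \<O> v eps"
  proof (rule free_separation[OF QD(1) QD(5)])
    show "rs Q \<O> u eps \<in> Tob R Q" "rs Q \<O> v eps \<in> Tob R Q" using QD eps by (auto intro: basic_closed)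
    fix c assume c: "c \<in> pts Q"
    have *: "rs \<O> Q (orbit_map Q c) (rs Q \<O> w eps) = ract g eps"
      if w: "gset_map G Q \<O> w" and g: "w c = num g" "g \<in> carrier G" for w g
    proof -
      note om = orbit_map[OF QD(1) c]
      have "right_mult G g n = w (orbit_map Q c n)" if "n \<in> pts \<O>" for n
        using orbit_map_comp[OF w c that] orbit_map_free[OF g(2) that] g(1) by simp
      from basic_cong(1)[OF free_orbit free_orbit gset_map_comp[OF om w] this]
      show ?thesis using basic_comp(1)[OF free_orbit QD(1) free_orbit om w eps(1)] by (simp add: Taction_def)
    qed
    obtain g k where gk: "u c = num g" "g \<in> carrier G" "v c = num k" "k \<in> carrier G"
      using gset_mapD(1)[OF QD(5) c] gset_mapD(1)[OF QD(6) c] by auto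
    then have "rp g = rp k" using QD(9)[OF c] by (simp add: num_eq_iff)
    then show "rs \<O> Q (orbit_map Q c) (rs Q \<O> u eps) = rs \<O> Q (orbit_map Q c) (rs Q \<O> v eps)"
      unfolding *[OF QD(5) gk(1,2)] *[OF QD(6) gk(3,4)] by (rule ract_eps_eq[OF gk(2,4)])
  qed
  have "num \<one>\<^bsub>G\<^esub> \<in> pts \<O>" by simp
  from QD(11)[OF this this refl] have "pts Q \<noteq> {}" by blast
  then show ?thesis
    unfolding coset_idem_def base_change(1)[OF Q eps(1)] uv
    using norm_idempotent_orbit[OF eps(1) eps_idem QD(1) QD(6)] by simp
qed

lemma coset_idem_square: "mul.op J coset_idem coset_idem = coset_idem"
  unfolding coset_idem_def using mul.F_op[OF free_orbit J \<pi> eps(1) eps(1)] eps_idem by simp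

abbreviation idem_at :: "'g gset \<Rightarrow> (nat \<Rightarrow> nat) \<Rightarrow> 'v" where "idem_at B m \<equiv> rs B J m coset_idem"

lemma idem_at_closed: "fin_gset G B \<Longrightarrow> gset_map G B J m \<Longrightarrow> idem_at B m \<in> Tob R B"
  by (intro basic_closed J coset_idem)

lemma idem_at_square: "fin_gset G B \<Longrightarrow> gset_map G B J m \<Longrightarrow> mul.op B (idem_at B m) (idem_at B m) = idem_at B m"
  using mul.rs_op[OF _ J _ coset_idem coset_idem] coset_idem_square by simp

lemma rs_idem_at: "fin_gset G B \<Longrightarrow> fin_gset G C \<Longrightarrow> gset_map G B J m \<Longrightarrow> gset_map G C B g \<Longrightarrow>
    rs C B g (idem_at B m) = idem_at C (\<lambda>a. m (g a))"
  by (rule basic_comp(1)[OF _ _ J _ _ coset_idem])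

text \<open>
  Over the pullback of \<open>G/e\<close>, which is free, both sides are norms of the same idempotent, and there
  \<open>norm_idempotent_free\<close> applies.
\<close>

lemma norm_idem_at:
  assumes B: "fin_gset G B" and C: "fin_gset G C" and m: "gset_map G B J m" and g: "gset_map G C B g"
  shows "mul.op B (idem_at B m) (nm C B g (idem_at C (\<lambda>a. m (g a)))) = idem_at B m"
    and "g ` pts C = pts B \<Longrightarrow> nm C B g (idem_at C (\<lambda>a. m (g a))) = idem_at B m"
proof -
  obtain B' e u where B': "pullback G B' e u \<O> \<pi> B m J" using pullback_exists[OF free_orbit B J \<pi> m] by blast
  note BD = pullbackD[OF B']
  obtain C' g' v where C': "pullback G C' g' v B' u C g B" using pullback_exists[OF BD(1) C B BD(6) g] by blast
  note CD = pullbackD[OF C']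
  define w where "w = rs B' \<O> e eps"
  have w: "w \<in> Tob R B'" unfolding w_def using BD eps by (auto intro: basic_closed)
  have ww: "mul.op B' w w = w" unfolding w_def using mul.rs_op[OF BD(1) BD(2) BD(5) eps(1) eps(1)] eps_idem by simp
  have gw: "rs C' B' g' w \<in> Tob R C'" using CD w by (auto intro: basic_closed)
  have d: "idem_at B m = nm B' B u w" unfolding w_def coset_idem_def by (rule base_change(1)[OF B' eps(1)])
  have "nm C B g (idem_at C (\<lambda>a. m (g a))) = nm C B g (rs C B g (nm B' B u w))"
    using rs_idem_at[OF B C m g] d by simp
  also have "\<dots> = nm C' B (\<lambda>a. g (v a)) (rs C' B' g' w)"
    using base_change(1)[OF C' w] basic_comp(2)[OF CD(1) C B CD(6) g gw] by simp
  also have "\<dots> = nm C' B (\<lambda>a. u (g' a)) (rs C' B' g' w)"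
    using basic_cong(2)[OF CD(1) B gset_map_comp[OF CD(6) g], of "\<lambda>a. u (g' a)"] CD(9) by simp
  also have "\<dots> = nm B' B u (nm C' B' g' (rs C' B' g' w))"
    by (rule basic_comp(2)[OF CD(1) BD(1) B CD(5) BD(6) gw, symmetric])
  finally have N: "nm C B g (idem_at C (\<lambda>a. m (g a))) = nm B' B u (nm C' B' g' (rs C' B' g' w))" .
  have n: "nm C' B' g' (rs C' B' g' w) \<in> Tob R B'" by (rule basic_closed(2)[OF CD(1) BD(1) CD(5) gw])
  note free = norm_idempotent_free[OF BD(1) BD(5) CD(1) CD(5) w ww]
  show "mul.op B (idem_at B m) (nm C B g (idem_at C (\<lambda>a. m (g a)))) = idem_at B m"
    unfolding N d using mul.F_op[OF BD(1) B BD(6) w n] free(1) by simp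
  show "nm C B g (idem_at C (\<lambda>a. m (g a))) = idem_at B m" if s: "g ` pts C = pts B"
  proof -
    have "pts B' \<subseteq> g' ` pts C'"
    proof
      fix b assume b: "b \<in> pts B'"
      then have "u b \<in> g ` pts C" using s gset_mapD(1)[OF BD(6)] by simp
      then obtain c where "c \<in> pts C" "u b = g c" by blast
      then show "b \<in> g' ` pts C'" using CD(11)[OF b] by (metis imageI)
    qed
    then have "g' ` pts C' = pts B'" using gset_mapD(1)[OF CD(5)] by auto
    then show ?thesis unfolding N d using free(2) by simp
  qed
qed

lemma idem_at_point:
  assumes g: "g \<in> carrier G"
  shows "idem_at \<O> (orbit_map J (\<pi> (num g))) = ract g eps"
proof -
  have "gset_map G \<O> J (\<lambda>n. \<pi> (right_mult G g n))" by (rule gset_map_comp[OF right_mult[OF g] \<pi>])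
  from basic_cong(1)[OF free_orbit J this orbit_map_J[OF g]]
  have "idem_at \<O> (orbit_map J (\<pi> (num g))) = rs \<O> J (\<lambda>n. \<pi> (right_mult G g n)) coset_idem" by simp
  also have "\<dots> = ract g eps"
    using basic_comp(1)[OF free_orbit free_orbit J right_mult[OF g] \<pi> coset_idem] rs_\<pi>_coset_idem by (simp add: Taction_def)
  finally show ?thesis .
qed

lemma idem_at_orbit:
  assumes B: "fin_gset G B" and m: "gset_map G B J m" and b: "b \<in> pts B"
  shows "rs \<O> B (orbit_map B b) (idem_at B m) = idem_at \<O> (orbit_map J (m b))"
proof -
  note om = orbit_map[OF B b]
  have "orbit_map J (m b) n = m (orbit_map B b n)" if "n \<in> pts \<O>" for n
    using orbit_map_comp[OF m b that] by simp
  from basic_cong(1)[OF free_orbit J gset_map_comp[OF om m] this]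
  show ?thesis using rs_idem_at[OF B free_orbit m om] by simp
qed

text \<open>
  Both factors are norms along the surjection \<open>G/e \<times> Q \<rightarrow> Q\<close> of their pullbacks. The product of the pullbacks can be
  tested on free orbits, where it is a product of different translates of \<open>eps\<close>, and the norm of zero along a
  surjection is zero.
\<close>

lemma idem_at_orthogonal:
  assumes Q: "fin_gset G Q" and m: "gset_map G Q J m1" "gset_map G Q J m2"
    and ne: "\<And>x. x \<in> pts Q \<Longrightarrow> m1 x \<noteq> m2 x"
  shows "mul.op Q (idem_at Q m1) (idem_at Q m2) = plus.unit Q"
proof -
  obtain P \<epsilon> g where P: "fin_gset G P" "gset_map G P \<O> \<epsilon>" "gset_map G P Q g"
    and ex: "\<And>x y. x \<in> pts \<O> \<Longrightarrow> y \<in> pts Q \<Longrightarrow> \<exists>p\<in>pts P. \<epsilon> p = x \<and> g p = y"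
    by (rule product_exists[OF free_orbit Q]) (rule that; assumption)
  have s: "g ` pts P = pts Q"
    using ex[of "num \<one>\<^bsub>G\<^esub>"] gset_mapD(1)[OF P(3)] by (auto simp: image_iff)
  let ?m1 = "\<lambda>a. m1 (g a)" and ?m2 = "\<lambda>a. m2 (g a)"
  have gm: "gset_map G P J ?m1" "gset_map G P J ?m2" using gset_map_comp[OF P(3)] m by auto
  note c = idem_at_closed[OF P(1) gm(1)] idem_at_closed[OF P(1) gm(2)]
  have "mul.op P (idem_at P ?m1) (idem_at P ?m2) = plus.unit P"
  proof (rule free_separation[OF P(1,2) mul.op_closed[OF P(1) c] plus.unit_closed[OF P(1)]])
    fix p assume p: "p \<in> pts P"
    have gp: "g p \<in> pts Q" by (rule gset_mapD(1)[OF P(3) p])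
    obtain a where a: "a \<in> carrier G" "m1 (g p) = \<pi> (num a)" using \<pi>_surj[OF gset_mapD(1)[OF gm(1) p]] by blast
    obtain b where b: "b \<in> carrier G" "m2 (g p) = \<pi> (num b)" using \<pi>_surj[OF gset_mapD(1)[OF gm(2) p]] by blast
    have "rp a \<noteq> rp b" using ne[OF gp] a b by auto
    then show "rs \<O> P (orbit_map P p) (mul.op P (idem_at P ?m1) (idem_at P ?m2)) = rs \<O> P (orbit_map P p) (plus.unit P)"
      using mul.rs_op[OF free_orbit P(1) orbit_map[OF P(1) p] c] plus.rs_unit[OF free_orbit P(1) orbit_map[OF P(1) p]]
        idem_at_orbit[OF P(1) gm(1) p] idem_at_orbit[OF P(1) gm(2) p] a b idem_at_point ract_eps_orthogonal[OF a(1) b(1)] by simp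
  qed
  then have "nm P Q g (plus.unit P) = mul.op Q (nm P Q g (idem_at P ?m1)) (nm P Q g (idem_at P ?m2))"
    using mul.F_op[OF P(1) Q P(3) c] by simp
  then show ?thesis
    using norm_zero[OF P(1) Q P(3) s] norm_idem_at(2)[OF Q P(1) m(1) P(3) s] norm_idem_at(2)[OF Q P(1) m(2) P(3) s] by simp
qed

section \<open>The idempotent has transfer one\<close>

text \<open>
  The transfer to \<open>G/e\<close> is the sum over the points of the fibre of translates of \<open>eps\<close>. At most one of
  these indicator functions is nonzero at a given element, as \<open>q\<close> and \<open>m\<close> together are injective.
\<close>

lemma \<phi>_transfer_idem_at:
  "fin_gset G C \<Longrightarrow> gset_map G C \<O> q \<Longrightarrow> gset_map G C J m \<Longrightarrow>
   (\<And>c c'. c \<in> pts C \<Longrightarrow> c' \<in> pts C \<Longrightarrow> q c = q c' \<Longrightarrow> m c = m c' \<Longrightarrow> c = c') \<Longrightarrow> x \<in> carrier G \<Longrightarrow>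
   \<phi> (tr C \<O> q (idem_at C m)) x =
     (if \<exists>c\<in>pts C. q c = num \<one>\<^bsub>G\<^esub> \<and> m c = num (rp (inv\<^bsub>G\<^esub> x)) then \<one>\<^bsub>S\<^esub> else \<zero>\<^bsub>S\<^esub>)"
proof (induction "card (pts C)" arbitrary: C rule: less_induct)
  case (less C)
  note C = less.prems(1) and q = less.prems(2) and m = less.prems(3) and inj = less.prems(4) and x = less.prems(5)
  note d = idem_at_closed[OF C m]
  show ?case
  proof (cases "pts C = {}")
    case True
    then show ?thesis using plus.F_from_empty[OF C True free_orbit d] \<phi>_zero x by simp
  next
    case False
    then obtain c C' where c: "c \<in> pts C" "q c = num \<one>\<^bsub>G\<^esub>" and cp: "coproduct G \<O> (orbit_map C c) C' id C"
      and C': "pts C' = pts C - orbit_map C c ` pts \<O>" "card (pts C') < card (pts C)"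
      using orbit_split[OF C q] by metis
    note D = coproductD[OF cp]
    have q': "gset_map G C' \<O> q" and m': "gset_map G C' J m" using gset_map_comp[OF D(5) q] gset_map_comp[OF D(5) m] by simp_all
    have qn: "q (orbit_map C c n) = n" if "n \<in> pts \<O>" for n
      using orbit_map_comp[OF q c(1) that] that c(2) by (auto simp: orbit_map_def)
    obtain g where g: "g \<in> carrier G" "m c = \<pi> (num g)" using \<pi>_surj[OF gset_mapD(1)[OF m c(1)]] by blast
    have "rs \<O> C (orbit_map C c) (idem_at C m) = ract g eps"
      using idem_at_orbit[OF C m c(1)] idem_at_point[OF g(1)] g(2) by simp
    then have 1: "tr \<O> \<O> (\<lambda>a. q (orbit_map C c a)) (rs \<O> C (orbit_map C c) (idem_at C m)) = ract g eps"
      using basic_id(3)[OF free_orbit qn ract_closed[OF g(1) eps(1)]] by simp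
    have 2: "rs C' C id (idem_at C m) = idem_at C' m" using rs_idem_at[OF C D(2) m D(5)] by simp
    have t: "tr C' \<O> q (idem_at C' m) \<in> Tob R \<O>" by (rule basic_closed(3)[OF D(2) free_orbit q' idem_at_closed[OF D(2) m']])
    have "tr C \<O> q (idem_at C m) = plus.op \<O> (ract g eps) (tr C' \<O> q (idem_at C' m))"
      using plus.fold_formula[OF cp free_orbit q d] 1 2 by simp
    then have "\<phi> (tr C \<O> q (idem_at C m)) x = \<phi> (ract g eps) x \<oplus>\<^bsub>S\<^esub> \<phi> (tr C' \<O> q (idem_at C' m)) x"
      using \<phi>_hom(3)[OF ract_closed[OF g(1) eps(1)] t] x by simp
    also have "\<phi> (tr C' \<O> q (idem_at C' m)) x =
        (if \<exists>c\<in>pts C'. q c = num \<one>\<^bsub>G\<^esub> \<and> m c = num (rp (inv\<^bsub>G\<^esub> x)) then \<one>\<^bsub>S\<^esub> else \<zero>\<^bsub>S\<^esub>)"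
      by (rule less.hyps[OF C'(2) D(2) q' m' inj x]) (use C' in auto)
    also have "\<phi> (ract g eps) x = (if m c = num (rp (inv\<^bsub>G\<^esub> x)) then \<one>\<^bsub>S\<^esub> else \<zero>\<^bsub>S\<^esub>)"
      using \<phi>_ract_eps[OF g(1) x] g x by (simp add: num_eq_iff)
    also have "(\<exists>c\<in>pts C'. q c = num \<one>\<^bsub>G\<^esub> \<and> m c = num (rp (inv\<^bsub>G\<^esub> x))) \<longleftrightarrow>
        (\<exists>c'\<in>pts C - {c}. q c' = num \<one>\<^bsub>G\<^esub> \<and> m c' = num (rp (inv\<^bsub>G\<^esub> x)))"
    proof -
      have "c' = c" if "c' \<in> orbit_map C c ` pts \<O>" "q c' = num \<one>\<^bsub>G\<^esub>" for c'
        using that qn orbit_map_one[OF C c(1)] by (metis imageE)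
      moreover have "c \<in> orbit_map C c ` pts \<O>"
        using orbit_map_one[OF C c(1)] by (metis G.one_closed free_orbit_simps(1) imageI)
      ultimately show ?thesis unfolding C'(1) by blast
    qed
    finally have e: "\<phi> (tr C \<O> q (idem_at C m)) x = (if m c = num (rp (inv\<^bsub>G\<^esub> x)) then \<one>\<^bsub>S\<^esub> else \<zero>\<^bsub>S\<^esub>) \<oplus>\<^bsub>S\<^esub>
        (if \<exists>c'\<in>pts C - {c}. q c' = num \<one>\<^bsub>G\<^esub> \<and> m c' = num (rp (inv\<^bsub>G\<^esub> x)) then \<one>\<^bsub>S\<^esub> else \<zero>\<^bsub>S\<^esub>)" .
    show ?thesis
    proof (cases "m c = num (rp (inv\<^bsub>G\<^esub> x))")
      case True
      then have nex: "\<not> (\<exists>c'\<in>pts C - {c}. q c' = num \<one>\<^bsub>G\<^esub> \<and> m c' = num (rp (inv\<^bsub>G\<^esub> x)))"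
        using inj[OF c(1)] c(2) by (metis DiffE singletonI)
      have ex: "\<exists>c\<in>pts C. q c = num \<one>\<^bsub>G\<^esub> \<and> m c = num (rp (inv\<^bsub>G\<^esub> x))" using True c by blast
      show ?thesis unfolding e if_P[OF True] if_not_P[OF nex] if_P[OF ex] by simp
    next
      case False
      then have "(\<exists>c'\<in>pts C - {c}. q c' = num \<one>\<^bsub>G\<^esub> \<and> m c' = num (rp (inv\<^bsub>G\<^esub> x))) \<longleftrightarrow>
          (\<exists>c\<in>pts C. q c = num \<one>\<^bsub>G\<^esub> \<and> m c = num (rp (inv\<^bsub>G\<^esub> x)))" by blast
      then show ?thesis using False e by auto
    qed
  qed
qed

text \<open>
  For \<open>P = G/e \<times> G/H\<close> every coset occurs, so the translates of \<open>eps\<close> add up to one.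
\<close>

lemma transfer_idem_at_free:
  assumes P: "fin_gset G P" "gset_map G P \<O> u" "gset_map G P J m"
    and ex: "\<And>x y. x \<in> pts \<O> \<Longrightarrow> y \<in> pts J \<Longrightarrow> \<exists>p\<in>pts P. u p = x \<and> m p = y"
    and inj: "\<And>p q. p \<in> pts P \<Longrightarrow> q \<in> pts P \<Longrightarrow> u p = u q \<Longrightarrow> m p = m q \<Longrightarrow> p = q"
  shows "tr P \<O> u (idem_at P m) = mul.unit \<O>"
proof (rule \<phi>_inj)
  show "tr P \<O> u (idem_at P m) \<in> Tob R \<O>" by (rule basic_closed(3)[OF P(1) free_orbit P(2) idem_at_closed[OF P(1,3)]])
  show "mul.unit \<O> \<in> Tob R \<O>" by (rule mul.unit_closed[OF free_orbit])
  fix g assume g: "g \<in> carrier G"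
  have c: "\<exists>c\<in>pts P. u c = num \<one>\<^bsub>G\<^esub> \<and> m c = num (rp (inv\<^bsub>G\<^esub> g))" by (rule ex) (use g in auto)
  have "\<phi> (tr P \<O> u (idem_at P m)) g = (if \<exists>c\<in>pts P. u c = num \<one>\<^bsub>G\<^esub> \<and> m c = num (rp (inv\<^bsub>G\<^esub> g)) then \<one>\<^bsub>S\<^esub> else \<zero>\<^bsub>S\<^esub>)"
    by (rule \<phi>_transfer_idem_at[OF P inj g])
  then show "\<phi> (tr P \<O> u (idem_at P m)) g = \<phi> (mul.unit \<O>) g"
    unfolding if_P[OF c] \<phi>_one using g by simp
qed

text \<open>
  If \<open>\<mu>\<close> is constant on the fibres of \<open>b\<close>, it descends to the base, and the norm is absorbed.
\<close>

lemma norm_idem_at_constant: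
  assumes D: "fin_gset G D" and E: "fin_gset G E" and b: "gset_map G E D b" "b ` pts E = pts D"
    and m: "gset_map G E J \<mu>" and const: "\<And>x y. x \<in> pts E \<Longrightarrow> y \<in> pts E \<Longrightarrow> b x = b y \<Longrightarrow> \<mu> x = \<mu> y"
  obtains \<nu> where "gset_map G D J \<nu>" "\<And>x. x \<in> pts E \<Longrightarrow> \<nu> (b x) = \<mu> x" "nm E D b (idem_at E \<mu>) = idem_at D \<nu>"
proof -
  define \<nu> where "\<nu> d = \<mu> (inv_into (pts E) b d)" for d
  have nb: "\<nu> (b x) = \<mu> x" if "x \<in> pts E" for x
    unfolding \<nu>_def by (rule const) (use that in \<open>auto simp: inv_into_into f_inv_into_f\<close>)
  have "\<nu> d \<in> pts J \<and> (\<forall>g\<in>carrier G. \<nu> (act D g d) = act J g (\<nu> d))" if "d \<in> pts D" for d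
  proof -
    have "d \<in> b ` pts E" using that b(2) by simp
    then obtain x where x: "x \<in> pts E" "d = b x" by blast
    have "\<nu> (act D g d) = act J g (\<nu> d)" if g: "g \<in> carrier G" for g
      using nb[OF fin_gsetD(3)[OF E g x(1)]] gset_mapD(2)[OF b(1) g x(1)] gset_mapD(2)[OF m g x(1)] nb[OF x(1)] x(2) by simp
    then show ?thesis using nb[OF x(1)] x(2) gset_mapD(1)[OF m x(1)] by simp
  qed
  then have n: "gset_map G D J \<nu>" by (auto simp only: gset_map_def Pi_iff)
  have "idem_at E \<mu> = idem_at E (\<lambda>x. \<nu> (b x))"
    using basic_cong(1)[OF E J m, of "\<lambda>x. \<nu> (b x)"] nb by simp
  then show thesis using that[OF n nb] norm_idem_at(2)[OF D E n b] by simp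
qed

text \<open>
  Write \<open>v\<close> for the pullback of the idempotent to \<open>E\<close> and \<open>N v\<close> for its norm. The norm along either projection of the fibre square
  takes the pullback of \<open>v\<close> back to \<open>v\<close>, so \<open>N v = N v \<cdot> N v\<close> is the norm from the fibre square of the product of the two
  pullbacks of \<open>v\<close>. On the part where \<open>\<mu>\<close> takes two different values this product is zero by orthogonality, and this part
  still surjects onto \<open>D\<close>. The square is needed because the two values may be attained in one orbit of a
  stabilizer, where \<open>N v\<close> is not visibly a product with the two orthogonal values as factors.
\<close>

lemma norm_idem_at_vanishes:
  assumes D: "fin_gset G D" and E: "fin_gset G E" and b: "gset_map G E D b" and m: "gset_map G E J \<mu>"
    and ne: "\<And>d. d \<in> pts D \<Longrightarrow> \<exists>x\<in>pts E. \<exists>y\<in>pts E. b x = d \<and> b y = d \<and> \<mu> x \<noteq> \<mu> y"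
  shows "nm E D b (idem_at E \<mu>) = plus.unit D"
proof -
  obtain Q u v where Q: "pullback G Q u v E b E b D" using pullback_exists[OF E E D b b] by blast
  note QD = pullbackD[OF Q]
  let ?\<mu>1 = "\<lambda>a. \<mu> (u a)" and ?\<mu>2 = "\<lambda>a. \<mu> (v a)" and ?k = "\<lambda>a. b (u a)"
  let ?w = "idem_at E \<mu>" and ?N = "nm E D b (idem_at E \<mu>)" and ?y = "mul.op Q (idem_at Q (\<lambda>a. \<mu> (u a))) (idem_at Q (\<lambda>a. \<mu> (v a)))"
  have m12: "gset_map G Q J ?\<mu>1" "gset_map G Q J ?\<mu>2" and k: "gset_map G Q D ?k"
    using gset_map_comp[OF QD(5) m] gset_map_comp[OF QD(6) m] gset_map_comp[OF QD(5) b] .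
  have w: "?w \<in> Tob R E" by (rule idem_at_closed[OF E m])
  note y12 = idem_at_closed[OF QD(1) m12(1)] idem_at_closed[OF QD(1) m12(2)]
  have y: "?y \<in> Tob R Q" by (rule mul.op_closed[OF QD(1) y12])
  have uv: "u ` pts Q = pts E" "v ` pts Q = pts E"
    using QD(11) gset_mapD(1)[OF QD(5)] gset_mapD(1)[OF QD(6)] by (auto simp: image_iff) metis+
  have "nm Q D ?k (idem_at Q ?\<mu>1) = ?N"
    using basic_comp(2)[OF QD(1) E D QD(5) b y12(1)] norm_idem_at(2)[OF E QD(1) m QD(5) uv(1)] by simp
  moreover have "nm Q D ?k (idem_at Q ?\<mu>2) = ?N"
    using basic_comp(2)[OF QD(1) E D QD(6) b y12(2)] norm_idem_at(2)[OF E QD(1) m QD(6) uv(2)]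
      basic_cong(2)[OF QD(1) D gset_map_comp[OF QD(6) b], of ?k] QD(9) by simp
  ultimately have N: "nm Q D ?k ?y = mul.op D ?N ?N" using mul.F_op[OF QD(1) D k y12] by simp
  have NN: "mul.op D ?N ?N = ?N"
    using mul.F_op[OF E D b w w] idem_at_square[OF E m] by simp
  \<comment> \<open>the part where the two values agree, which is split off\<close>
  define U where "U = {a \<in> pts Q. ?\<mu>1 a = ?\<mu>2 a}"
  have "invariant G Q U"
    using gset_mapD(2)[OF m12(1)] gset_mapD(2)[OF m12(2)] fin_gsetD(3)[OF QD(1)] by (auto simp: invariant_def U_def)
  note U = this and U' = invariant_compl[OF QD(1) this]
  let ?Q' = "sub_gset Q (pts Q - U)" and ?Q0 = "sub_gset Q U"
  have cp: "coproduct G ?Q0 id ?Q' id Q" by (rule coproduct_sub[OF QD(1) U])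
  note CD = coproductD[OF cp]
  have km: "gset_map G ?Q' J ?\<mu>1" "gset_map G ?Q' J ?\<mu>2" "gset_map G ?Q' D ?k" "gset_map G ?Q0 D ?k"
    using gset_map_comp[OF CD(5) m12(1)] gset_map_comp[OF CD(5) m12(2)] gset_map_comp[OF CD(5) k] gset_map_comp[OF CD(4) k] by simp_all
  have "rs ?Q' Q id ?y = mul.op ?Q' (idem_at ?Q' ?\<mu>1) (idem_at ?Q' ?\<mu>2)"
    using mul.rs_op[OF CD(2) QD(1) CD(5) y12] rs_idem_at[OF QD(1) CD(2) m12(1) CD(5)] rs_idem_at[OF QD(1) CD(2) m12(2) CD(5)] by simp
  also have "\<dots> = plus.unit ?Q'" by (rule idem_at_orthogonal[OF CD(2) km(1,2)]) (simp add: U_def)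
  finally have y': "rs ?Q' Q id ?y = plus.unit ?Q'" .
  have "pts D \<subseteq> ?k ` pts ?Q'"
  proof
    fix d assume "d \<in> pts D"
    then obtain x y where xy: "x \<in> pts E" "y \<in> pts E" "b x = d" "b y = d" "\<mu> x \<noteq> \<mu> y" using ne by blast
    then obtain p where p: "p \<in> pts Q" "u p = x" "v p = y" using QD(11)[OF xy(1,2)] by auto
    then have "p \<in> pts ?Q'" "d = ?k p" using xy by (auto simp: U_def)
    then show "d \<in> ?k ` pts ?Q'" by blast
  qed
  then have "?k ` pts ?Q' = pts D" using gset_mapD(1)[OF km(3)] by blast
  then have "nm ?Q' D ?k (rs ?Q' Q id ?y) = plus.unit D" unfolding y' by (rule norm_zero[OF CD(2) D km(3)])
  then have "nm Q D ?k ?y = mul.op D (nm ?Q0 D ?k (rs ?Q0 Q id ?y)) (plus.unit D)"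
    using mul.fold_formula[OF cp D k y] by simp
  also have "\<dots> = plus.unit D"
    using mul.op_comm[OF D _ plus.unit_closed[OF D]] mul_zero[OF D] basic_closed(2)[OF CD(1) D km(4) basic_closed(1)[OF CD(1) QD(1) CD(4) y]] by simp
  finally show ?thesis using N NN by simp
qed

text \<open>
  The transfer of the pullback of \<open>coset_idem\<close> from \<open>G/e \<times> G/H\<close> to \<open>G/e\<close> is \<open>1\<close>, hence so is its norm to the point. In the exponential diagram
  for this norm, \<open>D\<close> is the set of all maps from \<open>G/e\<close> to \<open>G/H\<close>. The constant maps form a copy of \<open>G/H\<close> on which the
  norm is \<open>coset_idem\<close>, and on the others the norm vanishes.
\<close>

lemma transfer_coset_idem: "tr J point_gset (\<lambda>_. 0) coset_idem = mul.unit point_gset"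
proof -
  let ?pt = point_gset and ?c = "\<lambda>_. 0 :: nat"
  obtain P u m where P: "fin_gset G P" "gset_map G P \<O> u" "gset_map G P J m"
    and ex: "\<And>x y. x \<in> pts \<O> \<Longrightarrow> y \<in> pts J \<Longrightarrow> \<exists>p\<in>pts P. u p = x \<and> m p = y"
    and inj: "\<And>p q. p \<in> pts P \<Longrightarrow> q \<in> pts P \<Longrightarrow> u p = u q \<Longrightarrow> m p = m q \<Longrightarrow> p = q"
    by (rule product_exists[OF free_orbit J]) (rule that; assumption)
  have O1: "num \<one>\<^bsub>G\<^esub> \<in> pts \<O>" by simp
  have opt: "gset_map G \<O> ?pt ?c" by (rule gset_map_point[OF free_orbit])
  obtain E e f' D r where X: "exponential G P u \<O> ?c ?pt E e f' D r"
    using exponential_exists[OF P(1) free_orbit point P(2) opt] by blast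
  have EP: "pullback G E (\<lambda>x. u (e x)) f' \<O> ?c D r ?pt" and e: "gset_map G E P e"
    and uni: "\<And>b s. b \<in> pts ?pt \<Longrightarrow> (\<forall>a\<in>pts \<O>. ?c a = b \<longrightarrow> s a \<in> pts P \<and> u (s a) = a) \<Longrightarrow>
       (\<exists>!d. d \<in> pts D \<and> r d = b \<and> (\<forall>x\<in>pts E. f' x = d \<longrightarrow> e x = s (u (e x))))"
    using X unfolding exponential_def by auto
  note ED = pullbackD[OF EP]
  let ?\<mu> = "\<lambda>x. m (e x)"
  have \<mu>: "gset_map G E J ?\<mu>" by (rule gset_map_comp[OF e P(3)])
  have r0: "r d = 0" if "d \<in> pts D" for d using gset_mapD(1)[OF ED(8) that] by simp
  have f's: "\<exists>x\<in>pts E. f' x = d" if "d \<in> pts D" for d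
    using ED(11)[OF O1 that] r0[OF that] by auto
  \<comment> \<open>there is exactly one map with constant value \<open>j\<close>: apply the universal property to the constant section\<close>
  have sec: "\<exists>!d. d \<in> pts D \<and> (\<forall>x\<in>pts E. f' x = d \<longrightarrow> ?\<mu> x = j)" if j: "j \<in> pts J" for j
  proof -
    define s where "s a = (SOME p. p \<in> pts P \<and> u p = a \<and> m p = j)" for a
    have s: "s a \<in> pts P \<and> u (s a) = a \<and> m (s a) = j" if "a \<in> pts \<O>" for a
      unfolding s_def by (rule someI_ex) (use ex[OF that j] in blast)
    have iff: "e x = s (u (e x)) \<longleftrightarrow> ?\<mu> x = j" if "x \<in> pts E" for x
      using s[OF gset_mapD(1)[OF ED(5) that]] inj[OF gset_mapD(1)[OF e that]] by metis
    have "\<exists>!d. d \<in> pts D \<and> r d = 0 \<and> (\<forall>x\<in>pts E. f' x = d \<longrightarrow> e x = s (u (e x)))"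
      by (rule uni) (use s in auto)
    then show ?thesis using iff r0 by (metis (no_types, lifting))
  qed
  \<comment> \<open>the constant maps\<close>
  define D0 where "D0 = {d \<in> pts D. \<forall>x\<in>pts E. \<forall>y\<in>pts E. f' x = d \<longrightarrow> f' y = d \<longrightarrow> ?\<mu> x = ?\<mu> y}"
  have "invariant G D D0"
    unfolding invariant_def
  proof (intro conjI ballI)
    show "D0 \<subseteq> pts D" by (auto simp: D0_def)
    fix g d assume g: "g \<in> carrier G" and d: "d \<in> D0"
    then have dD: "d \<in> pts D" by (simp add: D0_def)
    have "?\<mu> x = ?\<mu> y" if xy: "x \<in> pts E" "y \<in> pts E" "f' x = act D g d" "f' y = act D g d" for x y
    proof -
      let ?g = "inv\<^bsub>G\<^esub> g"
      have g': "?g \<in> carrier G" using g by simp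
      have "\<And>x y. x \<in> pts E \<Longrightarrow> y \<in> pts E \<Longrightarrow> f' x = d \<Longrightarrow> f' y = d \<Longrightarrow> ?\<mu> x = ?\<mu> y"
        using d unfolding D0_def by blast
      note const = this[OF fin_gsetD(3)[OF ED(1) g' xy(1)] fin_gsetD(3)[OF ED(1) g' xy(2)]]
      have "f' (act E ?g x) = d" "f' (act E ?g y) = d"
        using gset_mapD(2)[OF ED(6) g'] xy act_inverse(2)[OF ED(3) g dD] by simp_all
      then have "?\<mu> (act E ?g x) = ?\<mu> (act E ?g y)" by (rule const)
      then have "act J g (act J ?g (?\<mu> x)) = act J g (act J ?g (?\<mu> y))"
        using gset_mapD(2)[OF \<mu> g'] xy by simp
      then show ?thesis using act_inverse(3)[OF J g] gset_mapD(1)[OF \<mu>] xy by simp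
    qed
    then show "act D g d \<in> D0" using fin_gsetD(3)[OF ED(3) g dD] unfolding D0_def by blast
  qed
  note D0 = this
  let ?D0 = "sub_gset D D0" and ?D1 = "sub_gset D (pts D - D0)"
  have cp: "coproduct G ?D0 id ?D1 id D" by (rule coproduct_sub[OF ED(3) D0])
  note CD = coproductD[OF cp]
  define z where "z = rs E P e (idem_at P m)"
  have z: "z = idem_at E ?\<mu>" unfolding z_def by (rule rs_idem_at[OF P(1) ED(1) P(3) e])
  define N where "N = nm E D f' z"
  have zE: "z \<in> Tob R E" and N: "N \<in> Tob R D"
    unfolding N_def z using idem_at_closed[OF ED(1) \<mu>] basic_closed(2)[OF ED(1) ED(3) ED(6)] by auto
  \<comment> \<open>both parts of \<open>D\<close> are treated by base change of the norm along their inclusions\<close>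
  have piece: "\<exists>E' a b. fin_gset G E' \<and> gset_map G E' E a \<and> gset_map G E' D' b \<and>
      rs D' D id N = nm E' D' b (idem_at E' (\<lambda>x. ?\<mu> (a x))) \<and> (\<forall>x\<in>pts E'. f' (a x) = b x) \<and>
      (\<forall>x\<in>pts E. f' x \<in> pts D' \<longrightarrow> (\<exists>x'\<in>pts E'. a x' = x \<and> b x' = f' x))"
    if D': "fin_gset G D'" "gset_map G D' D id" for D'
  proof -
    obtain E' a b where E': "pullback G E' a b E f' D' id D" using pullback_exists[OF ED(1) D'(1) ED(3) ED(6) D'(2)] by blast
    note E'D = pullbackD[OF E']
    have "rs D' D id N = nm E' D' b (idem_at E' (\<lambda>x. ?\<mu> (a x)))"
      unfolding N_def using base_change(1)[OF E' zE] rs_idem_at[OF ED(1) E'D(1) \<mu> E'D(5)] z by simp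
    moreover have "\<forall>x\<in>pts E. f' x \<in> pts D' \<longrightarrow> (\<exists>x'\<in>pts E'. a x' = x \<and> b x' = f' x)"
      using E'D(11) by auto
    ultimately show ?thesis using E'D by (intro exI[of _ E'] exI[of _ a] exI[of _ b]) auto
  qed
  have one: "mul.unit ?pt = tr D ?pt r N"
  proof -
    have "mul.unit ?pt = nm \<O> ?pt ?c (mul.unit \<O>)" using mul.F_unit[OF free_orbit point opt] by simp
    also have "\<dots> = nm \<O> ?pt ?c (tr P \<O> u (idem_at P m))" by (simp only: transfer_idem_at_free[OF P ex inj])
    also have "\<dots> = tr D ?pt r N" unfolding N_def z_def by (rule norm_transfer[OF X idem_at_closed[OF P(1,3)]])
    finally show ?thesis .
  qed
  have vanish: "rs ?D1 D id N = plus.unit ?D1"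
  proof -
    obtain E' a b where E': "fin_gset G E'" "gset_map G E' E a" "gset_map G E' ?D1 b"
      "rs ?D1 D id N = nm E' ?D1 b (idem_at E' (\<lambda>x. ?\<mu> (a x)))"
      "\<forall>x\<in>pts E. f' x \<in> pts ?D1 \<longrightarrow> (\<exists>x'\<in>pts E'. a x' = x \<and> b x' = f' x)"
      using piece[OF CD(2,5)] by blast
    have "nm E' ?D1 b (idem_at E' (\<lambda>x. ?\<mu> (a x))) = plus.unit ?D1"
    proof (rule norm_idem_at_vanishes[OF CD(2) E'(1,3) gset_map_comp[OF E'(2) \<mu>]])
      fix d assume d: "d \<in> pts ?D1"
      then obtain x y where xy: "x \<in> pts E" "y \<in> pts E" "f' x = d" "f' y = d" "?\<mu> x \<noteq> ?\<mu> y"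
        by (auto simp: D0_def)
      obtain x' where x': "x' \<in> pts E'" "a x' = x" "b x' = d" using E'(5) xy d by metis
      obtain y' where y': "y' \<in> pts E'" "a y' = y" "b y' = d" using E'(5) xy d by metis
      show "\<exists>x\<in>pts E'. \<exists>y\<in>pts E'. b x = d \<and> b y = d \<and> ?\<mu> (a x) \<noteq> ?\<mu> (a y)"
        using x' y' xy(5) by blast
    qed
    then show ?thesis using E'(4) by simp
  qed
  have const: "tr ?D0 ?pt r (rs ?D0 D id N) = tr J ?pt ?c coset_idem"
  proof -
    obtain E' a b where E': "fin_gset G E'" "gset_map G E' E a" "gset_map G E' ?D0 b"
      "rs ?D0 D id N = nm E' ?D0 b (idem_at E' (\<lambda>x. ?\<mu> (a x)))" "\<forall>x\<in>pts E'. f' (a x) = b x"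
      "\<forall>x\<in>pts E. f' x \<in> pts ?D0 \<longrightarrow> (\<exists>x'\<in>pts E'. a x' = x \<and> b x' = f' x)"
      using piece[OF CD(1,4)] by blast
    have s: "b ` pts E' = pts ?D0"
    proof
      show "pts ?D0 \<subseteq> b ` pts E'"
      proof
        fix d assume d: "d \<in> pts ?D0"
        then have "d \<in> pts D" by (simp add: D0_def)
        then obtain x where "x \<in> pts E" "f' x = d" using f's by blast
        then have "\<exists>x'\<in>pts E'. a x' = x \<and> b x' = d" using E'(6) d by metis
        then show "d \<in> b ` pts E'" by (metis imageI)
      qed
    qed (use gset_mapD(1)[OF E'(3)] in auto)
    have "?\<mu> (a x) = ?\<mu> (a y)" if "x \<in> pts E'" "y \<in> pts E'" "b x = b y" for x y
      using that gset_mapD(1)[OF E'(3) that(1)] gset_mapD(1)[OF E'(2)] E'(5) by (auto simp: D0_def)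
    then obtain \<nu> where \<nu>: "gset_map G ?D0 J \<nu>" "\<And>x. x \<in> pts E' \<Longrightarrow> \<nu> (b x) = ?\<mu> (a x)"
      "nm E' ?D0 b (idem_at E' (\<lambda>x. ?\<mu> (a x))) = idem_at ?D0 \<nu>"
      using norm_idem_at_constant[OF CD(1) E'(1,3) s gset_map_comp[OF E'(2) \<mu>]] by metis
    have \<nu>f: "?\<mu> x = \<nu> d" if "d \<in> D0" "x \<in> pts E" "f' x = d" for x d
      using that E'(6) \<nu>(2) by (metis sub_gset_simps(1))
    have "bij_betw \<nu> (pts ?D0) (pts J)"
      unfolding bij_betw_def
    proof
      show "inj_on \<nu> (pts ?D0)"
      proof (rule inj_onI)
        fix d d' assume d: "d \<in> pts ?D0" "d' \<in> pts ?D0" "\<nu> d = \<nu> d'"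
        have "d \<in> pts D \<and> (\<forall>x\<in>pts E. f' x = d \<longrightarrow> ?\<mu> x = \<nu> d)" "d' \<in> pts D \<and> (\<forall>x\<in>pts E. f' x = d' \<longrightarrow> ?\<mu> x = \<nu> d)"
          using \<nu>f[of d] \<nu>f[of d'] d gset_mapD(1)[OF CD(4), of d] gset_mapD(1)[OF CD(4), of d'] by simp_all
        then show "d = d'" using sec[OF gset_mapD(1)[OF \<nu>(1) d(1)]] by blast
      qed
      have "pts J \<subseteq> \<nu> ` pts ?D0"
      proof
        fix j assume j: "j \<in> pts J"
        obtain d where d: "d \<in> pts D" "\<forall>x\<in>pts E. f' x = d \<longrightarrow> ?\<mu> x = j" using sec[OF j] by blast
        then have d0: "d \<in> D0" by (auto simp: D0_def)
        obtain x where x: "x \<in> pts E" "f' x = d" using f's[OF d(1)] by blast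
        have "j = \<nu> d" using \<nu>f[OF d0 x] d(2) x by simp
        then show "j \<in> \<nu> ` pts ?D0" using d0 by simp
      qed
      then show "\<nu> ` pts ?D0 = pts J" using gset_mapD(1)[OF \<nu>(1)] by blast
    qed
    then have t: "tr ?D0 J \<nu> (idem_at ?D0 \<nu>) = coset_idem" by (rule tr_bij[OF CD(1) J \<nu>(1) _ coset_idem])
    have "tr ?D0 ?pt r (rs ?D0 D id N) = tr ?D0 ?pt r (idem_at ?D0 \<nu>)" using E'(4) \<nu>(3) by simp
    also have "\<dots> = tr ?D0 ?pt ?c (idem_at ?D0 \<nu>)"
      by (rule fun_cong[OF basic_cong(3)[OF CD(1) point gset_map_point[OF CD(1)]]]) (use r0 in \<open>auto simp: D0_def\<close>)
    also have "\<dots> = tr J ?pt ?c (tr ?D0 J \<nu> (idem_at ?D0 \<nu>))"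
      by (rule basic_comp(3)[OF CD(1) J point \<nu>(1) gset_map_point[OF J] idem_at_closed[OF CD(1) \<nu>(1)], symmetric])
    finally show ?thesis unfolding t .
  qed
  have r1: "gset_map G ?D1 ?pt r" using gset_map_comp[OF CD(5) ED(8)] by simp
  have t: "tr J ?pt ?c coset_idem \<in> Tob R ?pt" by (rule basic_closed(3)[OF J point gset_map_point[OF J] coset_idem])
  have "tr D ?pt r N = plus.op ?pt (tr J ?pt ?c coset_idem) (plus.unit ?pt)"
    using plus.fold_formula[OF cp point ED(8) N] const vanish plus.F_unit[OF CD(2) point r1] by simp
  then show ?thesis
    using one plus.op_comm[OF point t plus.unit_closed[OF point]] plus.op_unit[OF point t] by simp
qed

section \<open>The summand of induced sets as an \<open>H\<close>-Tambara functor\<close>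

text \<open>
  Up to the factor on the left, the idempotent passes through restrictions because it is pulled back, through transfers by
  Frobenius reciprocity, and through norms because it absorbs its own norm.
\<close>

lemma absorb:
  assumes b: "is_bispan G (poly_bispan X p A f B q Y)" and mX: "gset_map G X J mX" and mY: "gset_map G Y J mY"
    and mA: "\<And>a. a \<in> pts A \<Longrightarrow> mX (p a) = mY (q (f a))" and x: "x \<in> Tob R X"
  shows "mul.op Y (idem_at Y mY) (Tmap R (bispan_class G (poly_bispan X p A f B q Y)) (mul.op X (idem_at X mX) x)) =
    mul.op Y (idem_at Y mY) (Tmap R (bispan_class G (poly_bispan X p A f B q Y)) x)"
proof -
  note D = b[unfolded is_bispan_poly]
  have X: "fin_gset G X" and A: "fin_gset G A" and B: "fin_gset G B" and Y: "fin_gset G Y"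
    and p: "gset_map G A X p" and f: "gset_map G A B f" and q: "gset_map G B Y q" using D by auto
  let ?mB = "\<lambda>b. mY (q b)"
  have mB: "gset_map G B J ?mB" by (rule gset_map_comp[OF q mY])
  note dX = idem_at_closed[OF X mX] and dB = idem_at_closed[OF B mB] and dY = idem_at_closed[OF Y mY]
  have px: "rs A X p x \<in> Tob R A" by (rule basic_closed(1)[OF A X p x])
  have pd: "rs A X p (idem_at X mX) = idem_at A (\<lambda>a. ?mB (f a))"
    using rs_idem_at[OF X A mX p] basic_cong(1)[OF A J gset_map_comp[OF f mB], of "\<lambda>a. mX (p a)"] mA by simp
  have dA: "idem_at A (\<lambda>a. ?mB (f a)) \<in> Tob R A" by (rule idem_at_closed[OF A gset_map_comp[OF f mB]])
  define N where "N = nm A B f (rs A X p x)"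
  have N: "N \<in> Tob R B" unfolding N_def by (rule basic_closed(2)[OF A B f px])
  have dN: "nm A B f (idem_at A (\<lambda>a. ?mB (f a))) \<in> Tob R B" by (rule basic_closed(2)[OF A B f dA])
  have tr1: "mul.op Y (idem_at Y mY) (tr B Y q z) = tr B Y q (mul.op B (idem_at B ?mB) z)" if z: "z \<in> Tob R B" for z
    using frobenius[OF B Y q z dY] rs_idem_at[OF Y B mY q] mul.op_comm[OF Y dY basic_closed(3)[OF B Y q z]] mul.op_comm[OF B dB z]
    by simp
  have "mul.op Y (idem_at Y mY) (Tmap R (bispan_class G (poly_bispan X p A f B q Y)) (mul.op X (idem_at X mX) x)) =
      mul.op Y (idem_at Y mY) (tr B Y q (mul.op B (nm A B f (idem_at A (\<lambda>a. ?mB (f a)))) N))"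
    using Tmap_poly[OF b mul.op_closed[OF X dX x]] mul.rs_op[OF A X p dX x] pd mul.F_op[OF A B f dA px] by (simp add: N_def)
  also have "\<dots> = tr B Y q (mul.op B (mul.op B (idem_at B ?mB) (nm A B f (idem_at A (\<lambda>a. ?mB (f a))))) N)"
    using tr1[OF mul.op_closed[OF B dN N]] mul.op_assoc[OF B dB dN N] by simp
  also have "\<dots> = mul.op Y (idem_at Y mY) (tr B Y q N)"
    using norm_idem_at(1)[OF B A mB f] tr1[OF N] by simp
  also have "tr B Y q N = Tmap R (bispan_class G (poly_bispan X p A f B q Y)) x"
    using Tmap_poly[OF b x] by (simp add: N_def)
  finally show ?thesis .
qed

abbreviation "ind_idem Y \<equiv> idem_at (Ind Y) coset_of"

definition cut :: "'g gset \<Rightarrow> 'v \<Rightarrow> 'v" where "cut Y x = mul.op (Ind Y) (ind_idem Y) x"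

definition T_ob :: "'g gset \<Rightarrow> 'v set" where "T_ob Y = {x \<in> Tob R (Ind Y). cut Y x = x}"

text \<open>
  On morphisms \<open>T\<close> is \<open>R\<close> on the induced bispan followed by multiplication with the idempotent. For
  restrictions and transfers this last step changes nothing, but a norm need not preserve the summand: the norm
  along \<open>\<emptyset> \<rightarrow> Y\<close>, for instance, is \<open>1\<close> before multiplication. The class of bispans is represented by any of its elements.
\<close>

definition T :: "('g, 'v) tambara" where
  "T = \<lparr>Tob = T_ob, Tmap = (\<lambda>C. let b = SOME b. b \<in> C in
     (\<lambda>x\<in>T_ob (src b). cut (tgt b) (Tmap R (bispan_class G (induced_bispan G H b)) x)))\<rparr>"

lemma Tob_T [simp]: "Tob T = T_ob" by (simp add: T_def)

lemma ind_idem: "fin_gset GH Y \<Longrightarrow> ind_idem Y \<in> Tob R (Ind Y)" "fin_gset GH Y \<Longrightarrow> mul.op (Ind Y) (ind_idem Y) (ind_idem Y) = ind_idem Y"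
  by (intro idem_at_closed idem_at_square Ind_gset coset_of_map; assumption)+

lemma cut_closed: "fin_gset GH Y \<Longrightarrow> x \<in> Tob R (Ind Y) \<Longrightarrow> cut Y x \<in> Tob R (Ind Y)"
  unfolding cut_def by (intro mul.op_closed Ind_gset ind_idem)

lemma cut_cut: "fin_gset GH Y \<Longrightarrow> x \<in> Tob R (Ind Y) \<Longrightarrow> cut Y (cut Y x) = cut Y x"
  unfolding cut_def using mul.op_assoc[OF Ind_gset ind_idem(1) ind_idem(1), of Y x] ind_idem(2) by simp

lemma cut_T_ob: "fin_gset GH Y \<Longrightarrow> x \<in> Tob R (Ind Y) \<Longrightarrow> cut Y x \<in> T_ob Y"
  by (simp add: T_ob_def cut_closed cut_cut)

lemma T_obD: "x \<in> T_ob Y \<Longrightarrow> x \<in> Tob R (Ind Y)" "x \<in> T_ob Y \<Longrightarrow> cut Y x = x" by (simp_all add: T_ob_def)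

lemma Tmap_T:
  assumes b: "is_bispan GH b"
  shows "Tmap T (bispan_class GH b) = (\<lambda>x\<in>T_ob (src b). cut (tgt b) (Tmap R (bispan_class G (induced_bispan G H b)) x))"
proof -
  let ?b = "SOME b'. b' \<in> bispan_class GH b"
  have "b \<in> bispan_class GH b" using b by (simp add: bispan_class_def bispan_iso_refl)
  then have "?b \<in> bispan_class GH b" by (rule someI)
  then have i: "bispan_iso GH b ?b" "is_bispan GH ?b" by (auto simp: bispan_class_def)
  have "bispan_class G (induced_bispan G H b) = bispan_class G (induced_bispan G H ?b)"
    using bispan_class_eq_iff[OF Ind_bispan[OF b] Ind_bispan[OF i(2)]] Ind_bispan_iso[OF i(1)] by simp
  moreover have "src ?b = src b" "tgt ?b = tgt b" using i(1) by (auto simp: bispan_iso_def)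
  ultimately show ?thesis unfolding T_def Let_def by simp
qed

lemma R_Ind_closed:
  assumes b: "is_bispan GH b" and x: "x \<in> Tob R (Ind (src b))"
  shows "Tmap R (bispan_class G (induced_bispan G H b)) x \<in> Tob R (Ind (tgt b))"
  using Tmap_in[OF Ind_bispan[OF b]] x by (simp add: induced_bispan_def)

text \<open>
  Functoriality of \<open>T\<close> comes from this: the idempotent between two composed bispans can be dropped.
\<close>

lemma cut_R_cut:
  assumes b: "is_bispan GH b" and x: "x \<in> Tob R (Ind (src b))"
  shows "cut (tgt b) (Tmap R (bispan_class G (induced_bispan G H b)) (cut (src b) x)) =
    cut (tgt b) (Tmap R (bispan_class G (induced_bispan G H b)) x)"
proof -
  let ?i = "induced_bispan G H b"
  have e: "?i = poly_bispan (Ind (src b)) (induced_map (legp b)) (Ind (apexA b)) (induced_map (legf b)) (Ind (apexB b))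
      (induced_map (legq b)) (Ind (tgt b))" by (simp add: induced_bispan_def poly_bispan_def)
  show ?thesis
    unfolding cut_def e
    by (rule absorb[OF Ind_bispan[OF b, unfolded e] coset_of_map coset_of_map _ x]) simp
qed

lemma Tmap_T_in:
  assumes b: "is_bispan GH b" and x: "x \<in> T_ob (src b)"
  shows "Tmap T (bispan_class GH b) x \<in> T_ob (tgt b)"
  unfolding Tmap_T[OF b] using x cut_T_ob[OF bispanD(2)[OF b] R_Ind_closed[OF b T_obD(1)[OF x]]] by simp

lemma T_basic:
  assumes A: "fin_gset GH A" and B: "fin_gset GH B" and f: "gset_map GH A B f"
  shows "x \<in> T_ob B \<Longrightarrow> Tres GH T A B f x = rs (Ind A) (Ind B) (induced_map f) x"
    "x \<in> T_ob A \<Longrightarrow> Tnorm GH T A B f x = cut B (nm (Ind A) (Ind B) (induced_map f) x)"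
    "x \<in> T_ob A \<Longrightarrow> Ttr GH T A B f x = tr (Ind A) (Ind B) (induced_map f) x"
proof -
  note bs = is_bispan_basic[OF A B f]
  note IA = Ind_gset[OF A] and IB = Ind_gset[OF B] and If = Ind_map[OF f]
  have cl: "bispan_class G (induced_bispan G H (res_bispan A B f)) = bispan_class G (res_bispan (Ind A) (Ind B) (induced_map f))"
    "bispan_class G (induced_bispan G H (norm_bispan A B f)) = bispan_class G (norm_bispan (Ind A) (Ind B) (induced_map f))"
    "bispan_class G (induced_bispan G H (tr_bispan A B f)) = bispan_class G (tr_bispan (Ind A) (Ind B) (induced_map f))"
  proof -
    have id: "induced_map id n = n" if "n \<in> pts (Ind Y)" for n and Y :: "'g gset" using that by (auto elim!: Ind_cases)
    show "bispan_class G (induced_bispan G H (res_bispan A B f)) = bispan_class G (res_bispan (Ind A) (Ind B) (induced_map f))"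
      "bispan_class G (induced_bispan G H (norm_bispan A B f)) = bispan_class G (norm_bispan (Ind A) (Ind B) (induced_map f))"
      "bispan_class G (induced_bispan G H (tr_bispan A B f)) = bispan_class G (tr_bispan (Ind A) (Ind B) (induced_map f))"
      unfolding basic_bispans_poly induced_bispan_def
      by (simp_all add: poly_bispan_def, fold poly_bispan_def)
        (intro bispan_iso_legs; use IA IB If in \<open>simp add: is_bispan_poly id\<close>)+
  qed
  show "Tnorm GH T A B f x = cut B (nm (Ind A) (Ind B) (induced_map f) x)" if x: "x \<in> T_ob A"
    unfolding Tnorm_def Tmap_T[OF bs(2)] cl using x by (simp add: norm_bispan_def)
  show "Tres GH T A B f x = rs (Ind A) (Ind B) (induced_map f) x" if x: "x \<in> T_ob B"
  proof -
    have "rs (Ind A) (Ind B) (induced_map f) (ind_idem B) = ind_idem A"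
      using rs_idem_at[OF IB IA coset_of_map If] by simp
    then have "cut A (rs (Ind A) (Ind B) (induced_map f) x) = rs (Ind A) (Ind B) (induced_map f) (cut B x)"
      unfolding cut_def using mul.rs_op[OF IA IB If ind_idem(1)[OF B] T_obD(1)[OF x]] by simp
    then show ?thesis unfolding Tres_def Tmap_T[OF bs(1)] cl using x T_obD(2)[OF x] by (simp add: res_bispan_def Tres_def)
  qed
  show "Ttr GH T A B f x = tr (Ind A) (Ind B) (induced_map f) x" if x: "x \<in> T_ob A"
  proof -
    have t: "tr (Ind A) (Ind B) (induced_map f) x \<in> Tob R (Ind B)" by (rule basic_closed(3)[OF IA IB If T_obD(1)[OF x]])
    have r: "rs (Ind A) (Ind B) (induced_map f) (ind_idem B) = ind_idem A"
      using rs_idem_at[OF IB IA coset_of_map If] by simp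
    have "cut B (tr (Ind A) (Ind B) (induced_map f) x) = mul.op (Ind B) (tr (Ind A) (Ind B) (induced_map f) x) (ind_idem B)"
      unfolding cut_def by (rule mul.op_comm[OF IB ind_idem(1)[OF B] t])
    also have "\<dots> = tr (Ind A) (Ind B) (induced_map f) (mul.op (Ind A) x (ind_idem A))"
      using frobenius[OF IA IB If T_obD(1)[OF x] ind_idem(1)[OF B]] r by simp
    also have "mul.op (Ind A) x (ind_idem A) = x" using T_obD[OF x] mul.op_comm[OF IA ind_idem(1)[OF A] T_obD(1)[OF x]] by (simp add: cut_def)
    finally show ?thesis unfolding Ttr_def Tmap_T[OF bs(3)] cl using x by (simp add: tr_bispan_def Ttr_def)
  qed
qed

lemma rs_T_ob:
  assumes A: "fin_gset GH A" and B: "fin_gset GH B" and f: "gset_map GH A B f" and x: "x \<in> T_ob B"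
  shows "rs (Ind A) (Ind B) (induced_map f) x \<in> T_ob A"
proof -
  have "Tres GH T A B f x \<in> T_ob A"
    unfolding Tres_def using Tmap_T_in[OF is_bispan_basic(1)[OF A B f], of x] x by (simp add: res_bispan_def)
  then show ?thesis using T_basic(1)[OF A B f x] by simp
qed

lemma T_terminal: "\<exists>z. T_ob gset_empty = {z}"
proof -
  note e = Ind_gset[OF GH_empty]
  have "plus.unit (Ind gset_empty) \<in> Tob R (Ind gset_empty)" by (rule plus.unit_closed[OF e])
  then have "cut gset_empty (plus.unit (Ind gset_empty)) \<in> T_ob gset_empty" by (rule cut_T_ob[OF GH_empty])
  moreover have "x = y" if "x \<in> T_ob gset_empty" "y \<in> T_ob gset_empty" for x y
    using empty_unique[OF e Ind_empty] T_obD(1) that by blast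
  ultimately show ?thesis by blast
qed

lemma T_products:
  assumes X: "fin_gset GH X" and Y: "fin_gset GH Y"
  shows "bij_betw (\<lambda>z. (Tres GH T X (gset_sum X Y) inl z, Tres GH T Y (gset_sum X Y) inr z)) (T_ob (gset_sum X Y)) (T_ob X \<times> T_ob Y)"
proof -
  let ?S = "gset_sum X Y"
  let ?i = "rs (Ind X) (Ind ?S) (induced_map inl)" and ?j = "rs (Ind Y) (Ind ?S) (induced_map inr)"
  have S: "fin_gset GH ?S" by (rule fin_gset_sum[OF X Y])
  note ci = Ind_coproduct[OF X Y]
  note CD = coproductD[OF ci]
  have "bij_betw (\<lambda>z. (?i z, ?j z)) (T_ob ?S) (T_ob X \<times> T_ob Y)"
    unfolding bij_betw_def
  proof
    show "inj_on (\<lambda>z. (?i z, ?j z)) (T_ob ?S)"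
      by (rule inj_onI) (use coproduct_unique[OF ci] T_obD(1) in auto)
    have "(x, y) \<in> (\<lambda>z. (?i z, ?j z)) ` T_ob ?S" if x: "x \<in> T_ob X" and y: "y \<in> T_ob Y" for x y
    proof -
      obtain z where z: "z \<in> Tob R (Ind ?S)" "?i z = x" "?j z = y" using coproduct_exists[OF ci T_obD(1)[OF x] T_obD(1)[OF y]] by metis
      have "?i (cut ?S z) = cut X x"
        unfolding cut_def using mul.rs_op[OF CD(1,3,4) ind_idem(1)[OF S] z(1)] rs_idem_at[OF CD(3,1) coset_of_map CD(4)] z(2) by simp
      moreover have "?j (cut ?S z) = cut Y y"
        unfolding cut_def using mul.rs_op[OF CD(2,3,5) ind_idem(1)[OF S] z(1)] rs_idem_at[OF CD(3,2) coset_of_map CD(5)] z(3) by simp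
      ultimately have "(x, y) = (?i (cut ?S z), ?j (cut ?S z))" using T_obD(2)[OF x] T_obD(2)[OF y] by simp
      then show ?thesis using cut_T_ob[OF S z(1)] by blast
    qed
    then show "(\<lambda>z. (?i z, ?j z)) ` T_ob ?S = T_ob X \<times> T_ob Y"
      using rs_T_ob[OF X S gset_map_sum(1)] rs_T_ob[OF Y S gset_map_sum(2)] by blast
  qed
  moreover have "(Tres GH T X ?S inl z, Tres GH T Y ?S inr z) = (?i z, ?j z)" if "z \<in> T_ob ?S" for z
    using T_basic(1)[OF X S gset_map_sum(1) that] T_basic(1)[OF Y S gset_map_sum(2) that] by simp
  ultimately show ?thesis by (simp cong: bij_betw_cong)
qed

lemma T_pair:
  assumes X: "fin_gset GH X" and x: "x \<in> T_ob X" and y: "y \<in> T_ob X"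
  shows "Tpair GH T X x y \<in> T_ob (gset_sum X X)"
    "rs (Ind X) (Ind (gset_sum X X)) (induced_map inl) (Tpair GH T X x y) = x"
    "rs (Ind X) (Ind (gset_sum X X)) (induced_map inr) (Tpair GH T X x y) = y"
proof -
  let ?S = "gset_sum X X" and ?p = "\<lambda>z. (Tres GH T X (gset_sum X X) inl z, Tres GH T X (gset_sum X X) inr z)"
  have S: "fin_gset GH ?S" by (rule fin_gset_sum[OF X X])
  note bij = T_products[OF X X]
  have "(x, y) \<in> ?p ` T_ob ?S" using bij x y by (simp add: bij_betw_def)
  then obtain z where z: "z \<in> T_ob ?S" "(x, y) = ?p z" by (rule imageE)
  have "Tpair GH T X x y = z"
    unfolding Tpair_def
  proof (rule the_equality)
    show "z \<in> Tob T ?S \<and> Tres GH T X ?S inl z = x \<and> Tres GH T X ?S inr z = y" using z by simp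
    show "w = z" if "w \<in> Tob T ?S \<and> Tres GH T X ?S inl w = x \<and> Tres GH T X ?S inr w = y" for w
      by (rule inj_onD[OF bij_betw_imp_inj_on[OF bij]]) (use that z in auto)
  qed
  then show "Tpair GH T X x y \<in> T_ob (gset_sum X X)"
    "rs (Ind X) (Ind (gset_sum X X)) (induced_map inl) (Tpair GH T X x y) = x"
    "rs (Ind X) (Ind (gset_sum X X)) (induced_map inr) (Tpair GH T X x y) = y"
    using z T_basic(1)[OF X S gset_map_sum(1) z(1)] T_basic(1)[OF X S gset_map_sum(2) z(1)] by simp_all
qed

lemma T_point: "Tpoint T \<in> T_ob gset_empty"
proof -
  obtain z where z: "T_ob gset_empty = {z}" using T_terminal by blast
  then have "Tpoint T = z" unfolding Tpoint_def by simp
  then show ?thesis using z by simp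
qed

text \<open>
  The ring \<open>T(X)\<close> is a summand of \<open>R(G \<times>\<^sub>H X)\<close>: the operations agree, and the unit is the idempotent.
\<close>

lemma T_ring:
  assumes X: "fin_gset GH X"
  shows "carrier (Tring GH T X) = T_ob X"
    "x \<in> T_ob X \<Longrightarrow> y \<in> T_ob X \<Longrightarrow> x \<oplus>\<^bsub>Tring GH T X\<^esub> y = plus.op (Ind X) x y"
    "x \<in> T_ob X \<Longrightarrow> y \<in> T_ob X \<Longrightarrow> x \<otimes>\<^bsub>Tring GH T X\<^esub> y = mul.op (Ind X) x y"
    "\<zero>\<^bsub>Tring GH T X\<^esub> = plus.unit (Ind X)" "\<one>\<^bsub>Tring GH T X\<^esub> = ind_idem X"
proof -
  let ?S = "gset_sum X X"
  have S: "fin_gset GH ?S" by (rule fin_gset_sum[OF X X])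
  note IX = Ind_gset[OF X] and IS = Ind_gset[OF S]
  have idX: "induced_map fold_map (induced_map inl n) = n" "induced_map fold_map (induced_map inr n) = n" if "n \<in> pts (Ind X)" for n
    using that by (auto elim!: Ind_cases)
  note c = Ind_coproduct[OF X X] and ff = Ind_map[OF gset_map_sum(3)[of GH X]]
  show "carrier (Tring GH T X) = T_ob X" by (simp add: Tring_def)
  have F: "F (Ind ?S) (Ind X) (induced_map fold_map) (Tpair GH T X x y) = tambara_fold.op G R F (Ind X) x y"
    if F: "tambara_fold G R F" and x: "x \<in> T_ob X" and y: "y \<in> T_ob X" for F x y
  proof -
    interpret F: tambara_fold G R F by (rule F)
    note T = T_pair[OF X x y]
    show ?thesis
      using F.fold_formula[OF c IX ff T_obD(1)[OF T(1)]] T(2,3) F.F_id[OF IX idX(1) T_obD(1)[OF x]] F.F_id[OF IX idX(2) T_obD(1)[OF y]]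
      by simp
  qed
  show "x \<oplus>\<^bsub>Tring GH T X\<^esub> y = plus.op (Ind X) x y" if x: "x \<in> T_ob X" and y: "y \<in> T_ob X"
    using F[OF plus.tambara_fold_axioms x y] T_basic(3)[OF S X gset_map_sum(3) T_pair(1)[OF X x y]] by (simp add: Tring_def)
  show "x \<otimes>\<^bsub>Tring GH T X\<^esub> y = mul.op (Ind X) x y" if x: "x \<in> T_ob X" and y: "y \<in> T_ob X"
  proof -
    have "x \<otimes>\<^bsub>Tring GH T X\<^esub> y = cut X (mul.op (Ind X) x y)"
      using F[OF mul.tambara_fold_axioms x y] T_basic(2)[OF S X gset_map_sum(3) T_pair(1)[OF X x y]] by (simp add: Tring_def)
    also have "\<dots> = mul.op (Ind X) x y"
      using mul.op_assoc[OF IX ind_idem(1)[OF X] T_obD(1)[OF x] T_obD(1)[OF y]] T_obD(2)[OF x] by (simp add: cut_def)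
    finally show ?thesis .
  qed
  have e: "gset_map GH gset_empty X id" by simp
  show "\<zero>\<^bsub>Tring GH T X\<^esub> = plus.unit (Ind X)"
    using T_basic(3)[OF GH_empty X e T_point] plus.F_from_empty[OF Ind_gset[OF GH_empty] Ind_empty IX T_obD(1)[OF T_point]]
    by (simp add: Tring_def)
  have "\<one>\<^bsub>Tring GH T X\<^esub> = cut X (mul.unit (Ind X))"
    using T_basic(2)[OF GH_empty X e T_point] mul.F_from_empty[OF Ind_gset[OF GH_empty] Ind_empty IX T_obD(1)[OF T_point]]
    by (simp add: Tring_def)
  then show "\<one>\<^bsub>Tring GH T X\<^esub> = ind_idem X"
    using mul.op_unit[OF IX ind_idem(1)[OF X]] mul.op_comm[OF IX ind_idem(1)[OF X] mul.unit_closed[OF IX]] by (simp add: cut_def)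
qed

text \<open>
  Negatives exist because \<open>T(X)\<close> is an ideal of the ring \<open>R(G \<times>\<^sub>H X)\<close>.
\<close>

lemma T_additive:
  assumes X: "fin_gset GH X"
  shows "group (add_monoid (Tring GH T X))"
proof -
  note IX = Ind_gset[OF X]
  interpret r: cring "Rg (Ind X)" by (rule Tring_cring[OF IX])
  have cut: "cut X x = ind_idem X \<otimes>\<^bsub>Rg (Ind X)\<^esub> x" for x by (simp add: cut_def)
  have dc: "ind_idem X \<in> carrier (Rg (Ind X))" using ind_idem(1)[OF X] by simp
  have T_ob: "x \<in> T_ob X \<longleftrightarrow> x \<in> carrier (Rg (Ind X)) \<and> ind_idem X \<otimes>\<^bsub>Rg (Ind X)\<^esub> x = x" for x
    by (simp add: T_ob_def cut_def)
  have plus: "x \<oplus>\<^bsub>Tring GH T X\<^esub> y = x \<oplus>\<^bsub>Rg (Ind X)\<^esub> y" if "x \<in> T_ob X" "y \<in> T_ob X" for x y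
    using T_ring(2)[OF X that] by simp
  have cl: "x \<oplus>\<^bsub>Rg (Ind X)\<^esub> y \<in> T_ob X" if "x \<in> T_ob X" "y \<in> T_ob X" for x y
    using that dc unfolding T_ob by (simp add: r.r_distr del: Tring_simps)
  have z: "\<zero>\<^bsub>Rg (Ind X)\<^esub> \<in> T_ob X" unfolding T_ob using dc by (simp del: Tring_simps)
  have m: "\<ominus>\<^bsub>Rg (Ind X)\<^esub> x \<in> T_ob X" if "x \<in> T_ob X" for x
    using that dc unfolding T_ob by (simp add: r.r_minus del: Tring_simps)
  have c: "carrier (Tring GH T X) = T_ob X" and zero: "\<zero>\<^bsub>Tring GH T X\<^esub> = \<zero>\<^bsub>Rg (Ind X)\<^esub>" using T_ring[OF X] by simp_all
  have car: "x \<in> carrier (Rg (Ind X))" if "x \<in> T_ob X" for x using that T_ob by blast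
  show ?thesis
  proof (rule groupI)
    show "x \<otimes>\<^bsub>add_monoid (Tring GH T X)\<^esub> y \<in> carrier (add_monoid (Tring GH T X))"
      if "x \<in> carrier (add_monoid (Tring GH T X))" "y \<in> carrier (add_monoid (Tring GH T X))" for x y
      using that c cl plus by (simp del: Tring_simps)
    show "\<one>\<^bsub>add_monoid (Tring GH T X)\<^esub> \<in> carrier (add_monoid (Tring GH T X))" using z c zero by (simp del: Tring_simps)
    show "x \<otimes>\<^bsub>add_monoid (Tring GH T X)\<^esub> y \<otimes>\<^bsub>add_monoid (Tring GH T X)\<^esub> w =
        x \<otimes>\<^bsub>add_monoid (Tring GH T X)\<^esub> (y \<otimes>\<^bsub>add_monoid (Tring GH T X)\<^esub> w)"
      if "x \<in> carrier (add_monoid (Tring GH T X))" "y \<in> carrier (add_monoid (Tring GH T X))" "w \<in> carrier (add_monoid (Tring GH T X))" for x y w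
      using that c cl plus car by (simp add: r.a_assoc del: Tring_simps)
    show "\<one>\<^bsub>add_monoid (Tring GH T X)\<^esub> \<otimes>\<^bsub>add_monoid (Tring GH T X)\<^esub> x = x"
      if "x \<in> carrier (add_monoid (Tring GH T X))" for x
      using that c z zero plus car by (simp del: Tring_simps)
    show "\<exists>y\<in>carrier (add_monoid (Tring GH T X)). y \<otimes>\<^bsub>add_monoid (Tring GH T X)\<^esub> x = \<one>\<^bsub>add_monoid (Tring GH T X)\<^esub>"
      if "x \<in> carrier (add_monoid (Tring GH T X))" for x
      by (rule bexI[of _ "\<ominus>\<^bsub>Rg (Ind X)\<^esub> x"]) (use that c m plus zero car in \<open>simp_all add: r.l_neg del: Tring_simps\<close>)
  qed
qed

theorem T_tambara: "tambara_functor GH T"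
proof (rule tambara_functor.intro)
  show "group GH" by (rule GH_group)
  show "finite (carrier GH)" using local.finite H.subset by (simp add: finite_subset)
  show "Tmap T (bispan_class GH b) \<in> Tob T (src b) \<rightarrow>\<^sub>E Tob T (tgt b)" if b: "is_bispan GH b" for b
    using Tmap_T_in[OF b] by (auto simp: Tmap_T[OF b])
  show "Tmap T (bispan_class GH (bispan_id X)) = (\<lambda>x\<in>Tob T X. x)" if X: "fin_gset GH X" for X
  proof -
    have b: "is_bispan GH (bispan_id X)" using X by (simp add: is_bispan_def bispan_id_def)
    have idm: "induced_map id n = n" if "n \<in> pts (Ind X)" for n using that by (auto elim!: Ind_cases)
    have "bispan_id X = res_bispan X X id" by (simp add: bispan_id_def res_bispan_def)
    then have "Tmap T (bispan_class GH (bispan_id X)) x = x" if x: "x \<in> T_ob X" for x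
      using T_basic(1)[OF X X gset_map_id(1) x] basic_id(1)[OF Ind_gset[OF X] idm T_obD(1)[OF x]] by (simp add: Tres_def)
    moreover have "Tmap T (bispan_class GH (bispan_id X)) \<in> extensional (T_ob X)"
      unfolding Tmap_T[OF b] by (simp add: bispan_id_def)
    ultimately show ?thesis
      by (intro extensionalityI[where A = "T_ob X"]) simp_all
  qed
  show "Tmap T (bispan_comp GH (bispan_class GH b1) (bispan_class GH b2)) =
      compose (Tob T (src b1)) (Tmap T (bispan_class GH b2)) (Tmap T (bispan_class GH b1))"
    if b: "is_bispan GH b1" "is_bispan GH b2" "tgt b1 = src b2" for b1 b2
  proof -
    obtain c where c: "bispan_composite GH b1 b2 c" using bispan_composite_exists[OF b] ..
    have D: "is_bispan GH c" "src c = src b1" "tgt c = tgt b2" using c unfolding bispan_composite_def by blast+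
    show ?thesis
      unfolding bispan_comp_class[OF c]
    proof (rule extensionalityI[where A = "T_ob (src b1)"])
      fix x assume x: "x \<in> T_ob (src b1)"
      let ?R = "\<lambda>b. Tmap R (bispan_class G (induced_bispan G H b))"
      have r1: "?R b1 x \<in> Tob R (Ind (src b2))" using R_Ind_closed[OF b(1) T_obD(1)[OF x]] b(3) by simp
      have "Tmap T (bispan_class GH b2) (Tmap T (bispan_class GH b1) x) = cut (tgt b2) (?R b2 (cut (src b2) (?R b1 x)))"
        using Tmap_T_in[OF b(1) x] x b(3) by (simp add: Tmap_T[OF b(1)] Tmap_T[OF b(2)])
      also have "\<dots> = cut (tgt b2) (?R b2 (?R b1 x))" by (rule cut_R_cut[OF b(2) r1])
      also have "?R b2 (?R b1 x) = ?R c x"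
        by (rule Tmap_composite[OF Ind_composite[OF c]]) (use T_obD(1)[OF x] in \<open>simp add: induced_bispan_def\<close>)
      finally show "Tmap T (bispan_class GH c) x = compose (Tob T (src b1)) (Tmap T (bispan_class GH b2)) (Tmap T (bispan_class GH b1)) x"
        using x D by (simp add: compose_def Tmap_T[OF D(1)])
    qed (use D in \<open>auto simp: Tmap_T[OF D(1)] compose_def\<close>)
  qed
  show "\<exists>z. Tob T gset_empty = {z}" using T_terminal by simp
  show "bij_betw (\<lambda>z. (Tres GH T X (gset_sum X Y) inl z, Tres GH T Y (gset_sum X Y) inr z)) (Tob T (gset_sum X Y)) (Tob T X \<times> Tob T Y)"
    if "fin_gset GH X" "fin_gset GH Y" for X Y using T_products[OF that] by simp
  show "group (add_monoid (Tring GH T X))" if "fin_gset GH X" for X by (rule T_additive[OF that])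
qed

section \<open>Comparison with the coinduced functor\<close>

text \<open>
  The comparison map \<open>R(X) \<rightarrow> T(res X)\<close>; its inverse \<open>\<theta>\<close> is a transfer.
\<close>

definition \<eta> :: "'g gset \<Rightarrow> 'v \<Rightarrow> 'v" where "\<eta> X x = cut X (rs (Ind X) X (pr X) x)"

definition \<theta> :: "'g gset \<Rightarrow> 'v \<Rightarrow> 'v" where "\<theta> X y = tr (Ind X) X (pr X) y"

lemma \<eta>_closed: "fin_gset G X \<Longrightarrow> x \<in> Tob R X \<Longrightarrow> \<eta> X x \<in> T_ob X"
  unfolding \<eta>_def by (intro cut_T_ob res_gset basic_closed Ind_G pr_map)

lemma \<theta>_closed: "fin_gset G X \<Longrightarrow> y \<in> T_ob X \<Longrightarrow> \<theta> X y \<in> Tob R X"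
  unfolding \<theta>_def by (intro basic_closed Ind_G pr_map T_obD)

text \<open>
  The bispan induced from the restriction of \<open>b\<close> is the base change of \<open>b\<close> along \<open>pr\<close>.
\<close>

lemma pr_natural:
  assumes b: "is_bispan G b" and x: "x \<in> Tob R (src b)"
  shows "rs (Ind (tgt b)) (tgt b) (pr (tgt b)) (Tmap R (bispan_class G b) x) =
    Tmap R (bispan_class G (induced_bispan G H b)) (rs (Ind (src b)) (src b) (pr (src b)) x)"
proof -
  let ?X = "src b" and ?Y = "tgt b" and ?A = "apexA b" and ?B = "apexB b"
  note D = bispanD[OF b]
  let ?p = "legp b" and ?f = "legf b" and ?q = "legq b"
  have x1: "rs ?A ?X ?p x \<in> Tob R ?A" by (rule basic_closed(1)[OF D(3,1,5) x])
  have x2: "nm ?A ?B ?f (rs ?A ?X ?p x) \<in> Tob R ?B" by (rule basic_closed(2)[OF D(3,4,6) x1])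
  have x0: "rs (Ind ?X) ?X (pr ?X) x \<in> Tob R (Ind ?X)" by (rule basic_closed(1)[OF Ind_G[OF D(1)] D(1) pr_map[OF D(1)] x])
  have b': "is_bispan G (poly_bispan ?X ?p ?A ?f ?B ?q ?Y)" using b is_bispan_as_poly[of b] by simp
  have i: "is_bispan G (induced_bispan G H b)" by (rule Ind_bispan[OF is_bispan_subgroup[OF H b]])
  have e: "induced_bispan G H b = poly_bispan (Ind ?X) (induced_map ?p) (Ind ?A) (induced_map ?f) (Ind ?B) (induced_map ?q) (Ind ?Y)"
    by (simp add: induced_bispan_def poly_bispan_def)
  have "rs (Ind ?A) ?A (pr ?A) (rs ?A ?X ?p x) = rs (Ind ?A) ?X (\<lambda>n. ?p (pr ?A n)) x"
    by (rule basic_comp(1)[OF Ind_G[OF D(3)] D(3,1) pr_map[OF D(3)] D(5) x])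
  also have "\<dots> = rs (Ind ?A) ?X (\<lambda>n. pr ?X (induced_map ?p n)) x"
    by (rule fun_cong[OF basic_cong(1)[OF Ind_G[OF D(3)] D(1) gset_map_comp[OF Ind_map[OF res_map[OF D(5)]] pr_map[OF D(1)]]]])
      (use pullbackD(9)[OF pullback_pr[OF D(3,1,5)]] in simp)
  also have "\<dots> = rs (Ind ?A) (Ind ?X) (induced_map ?p) (rs (Ind ?X) ?X (pr ?X) x)"
    by (rule basic_comp(1)[OF Ind_G[OF D(3)] Ind_G[OF D(1)] D(1) Ind_map[OF res_map[OF D(5)]] pr_map[OF D(1)] x, symmetric])
  finally have 1: "rs (Ind ?A) ?A (pr ?A) (rs ?A ?X ?p x) = rs (Ind ?A) (Ind ?X) (induced_map ?p) (rs (Ind ?X) ?X (pr ?X) x)" .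
  have "rs (Ind ?Y) ?Y (pr ?Y) (Tmap R (bispan_class G b) x) = rs (Ind ?Y) ?Y (pr ?Y) (tr ?B ?Y ?q (nm ?A ?B ?f (rs ?A ?X ?p x)))"
    using Tmap_poly[OF b' x] is_bispan_as_poly[of b] by simp
  also have "\<dots> = tr (Ind ?B) (Ind ?Y) (induced_map ?q) (rs (Ind ?B) ?B (pr ?B) (nm ?A ?B ?f (rs ?A ?X ?p x)))"
    by (rule base_change(2)[OF pullback_sym[OF pullback_pr[OF D(4,2,7)]] x2])
  also have "rs (Ind ?B) ?B (pr ?B) (nm ?A ?B ?f (rs ?A ?X ?p x)) =
      nm (Ind ?A) (Ind ?B) (induced_map ?f) (rs (Ind ?A) ?A (pr ?A) (rs ?A ?X ?p x))"
    by (rule base_change(1)[OF pullback_sym[OF pullback_pr[OF D(3,4,6)]] x1])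
  finally show ?thesis using Tmap_poly[OF i[unfolded e] x0] 1 e by simp
qed

lemma \<eta>_natural:
  assumes b: "is_bispan G b" and x: "x \<in> Tob R (src b)"
  shows "\<eta> (tgt b) (Tmap R (bispan_class G b) x) = Tmap (tambara_coind G H T) (bispan_class G b) (\<eta> (src b) x)"
proof -
  note D = bispanD[OF b] and b' = is_bispan_subgroup[OF H b]
  have x0: "rs (Ind (src b)) (src b) (pr (src b)) x \<in> Tob R (Ind (src b))" by (rule basic_closed(1)[OF Ind_G[OF D(1)] D(1) pr_map[OF D(1)] x])
  have "Tmap (tambara_coind G H T) (bispan_class G b) (\<eta> (src b) x) = Tmap T (bispan_class GH b) (\<eta> (src b) x)"
    by (simp add: tambara_coind_def res_class_bispan_class[OF H b])
  also have "\<dots> = cut (tgt b) (Tmap R (bispan_class G (induced_bispan G H b)) (cut (src b) (rs (Ind (src b)) (src b) (pr (src b)) x)))"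
    using \<eta>_closed[OF D(1) x] by (simp add: Tmap_T[OF b'] \<eta>_def)
  also have "\<dots> = cut (tgt b) (Tmap R (bispan_class G (induced_bispan G H b)) (rs (Ind (src b)) (src b) (pr (src b)) x))"
    by (rule cut_R_cut[OF b' x0])
  finally show ?thesis using pr_natural[OF b x] by (simp add: \<eta>_def)
qed

text \<open>
  By Frobenius reciprocity this is multiplication by the transfer of the idempotent, which is \<open>1\<close>.
\<close>

lemma \<theta>_\<eta>:
  assumes X: "fin_gset G X" and x: "x \<in> Tob R X"
  shows "\<theta> X (\<eta> X x) = x"
proof -
  note d = ind_idem(1)[OF res_gset[OF X]]
  have "tr (Ind X) X (pr X) (ind_idem X) = rs X point_gset (\<lambda>_. 0) (tr J point_gset (\<lambda>_. 0) coset_idem)"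
    by (rule base_change(2)[OF pullback_coset[OF X] coset_idem, symmetric])
  also have "\<dots> = mul.unit X" using mul.rs_unit[OF X point gset_map_point[OF X]] transfer_coset_idem by simp
  finally have 1: "tr (Ind X) X (pr X) (ind_idem X) = mul.unit X" .
  have "\<theta> X (\<eta> X x) = mul.op X (tr (Ind X) X (pr X) (ind_idem X)) x"
    unfolding \<theta>_def \<eta>_def cut_def by (rule frobenius[OF Ind_G[OF X] X pr_map[OF X] d x, symmetric])
  then show ?thesis using 1 mul.op_unit[OF X x] by simp
qed

text \<open>
  By base change, \<open>pr\<^sup>* (Tr y)\<close> is a transfer from the fibre square of \<open>pr\<close>. The diagonal, where the two cosets
  agree, contributes \<open>y\<close>; on its complement the two pullbacks of the idempotent are orthogonal.
\<close>

lemma \<eta>_\<theta>: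
  assumes X: "fin_gset G X" and y: "y \<in> T_ob X"
  shows "\<eta> X (\<theta> X y) = y"
proof -
  let ?I = "Ind X"
  note I = Ind_G[OF X] and d = ind_idem[OF res_gset[OF X]] and p = pr_map[OF X] and yI = T_obD(1)[OF y]
  have dy: "mul.op ?I (ind_idem X) y = y" using T_obD(2)[OF y] by (simp add: cut_def)
  obtain W u v where W: "pullback G W u v ?I (pr X) ?I (pr X) X" using pullback_exists[OF I I X p p] by blast
  note WD = pullbackD[OF W]
  let ?mu = "\<lambda>w. coset_of (u w)" and ?mv = "\<lambda>w. coset_of (v w)"
  have mu: "gset_map G W J ?mu" and mv: "gset_map G W J ?mv"
    using gset_map_comp[OF WD(5) coset_of_map] gset_map_comp[OF WD(6) coset_of_map] .
  define z where "z = rs W ?I u y"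
  have z: "z \<in> Tob R W" unfolding z_def by (rule basic_closed(1)[OF WD(1) I WD(5) yI])
  note du = idem_at_closed[OF WD(1) mu] and dv = idem_at_closed[OF WD(1) mv]
  have zu: "mul.op W (idem_at W ?mu) z = z"
    using mul.rs_op[OF WD(1) I WD(5) d(1) yI] rs_idem_at[OF I WD(1) coset_of_map WD(5)] dy by (simp add: z_def)
  \<comment> \<open>\<open>\<eta> X (\<theta> X y)\<close> is the transfer of \<open>k\<close> along \<open>v\<close>; \<open>U\<close> is the diagonal\<close>
  define k where "k = mul.op W (idem_at W ?mv) z"
  have k: "k \<in> Tob R W" unfolding k_def by (rule mul.op_closed[OF WD(1) dv z])
  have "\<eta> X (\<theta> X y) = mul.op ?I (ind_idem X) (tr W ?I v z)"
    unfolding \<eta>_def \<theta>_def cut_def base_change(2)[OF W yI] z_def ..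
  also have "\<dots> = mul.op ?I (tr W ?I v z) (ind_idem X)" by (rule mul.op_comm[OF I d(1) basic_closed(3)[OF WD(1) I WD(6) z]])
  also have "\<dots> = tr W ?I v (mul.op W z (idem_at W ?mv))"
    using frobenius[OF WD(1) I WD(6) z d(1)] rs_idem_at[OF I WD(1) coset_of_map WD(6)] by simp
  also have "mul.op W z (idem_at W ?mv) = k" unfolding k_def by (rule mul.op_comm[OF WD(1) z dv])
  finally have 1: "\<eta> X (\<theta> X y) = tr W ?I v k" .
  define U where "U = {w \<in> pts W. ?mu w = ?mv w}"
  have "invariant G W U"
    using gset_mapD(2)[OF mu] gset_mapD(2)[OF mv] fin_gsetD(3)[OF WD(1)] by (auto simp: invariant_def U_def)
  note U = this
  let ?W' = "sub_gset W (pts W - U)" and ?W0 = "sub_gset W U"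
  have cp: "coproduct G ?W0 id ?W' id W" by (rule coproduct_sub[OF WD(1) U])
  note CD = coproductD[OF cp]
  have m: "gset_map G ?W' J ?mu" "gset_map G ?W' J ?mv" "gset_map G ?W' ?I v" "gset_map G ?W0 ?I v" "gset_map G ?W0 ?I u" "gset_map G ?W0 J ?mv"
    using gset_map_comp[OF CD(5) mu] gset_map_comp[OF CD(5) mv] gset_map_comp[OF CD(5) WD(6)] gset_map_comp[OF CD(4) WD(6)]
      gset_map_comp[OF CD(4) WD(5)] gset_map_comp[OF CD(4) mv] by simp_all
  have "rs ?W' W id k = plus.unit ?W'"
  proof -
    have z': "rs ?W' W id z \<in> Tob R ?W'" by (rule basic_closed(1)[OF CD(2) WD(1) CD(5) z])
    note du' = idem_at_closed[OF CD(2) m(1)] and dv' = idem_at_closed[OF CD(2) m(2)]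
    have "k = mul.op W (mul.op W (idem_at W ?mv) (idem_at W ?mu)) z"
      unfolding k_def using mul.op_assoc[OF WD(1) dv du z] zu by simp
    then have "rs ?W' W id k = mul.op ?W' (mul.op ?W' (idem_at ?W' ?mv) (idem_at ?W' ?mu)) (rs ?W' W id z)"
      using mul.rs_op[OF CD(2) WD(1) CD(5) mul.op_closed[OF WD(1) dv du] z] mul.rs_op[OF CD(2) WD(1) CD(5) dv du]
        rs_idem_at[OF WD(1) CD(2) mu CD(5)] rs_idem_at[OF WD(1) CD(2) mv CD(5)] by simp
    moreover have "mul.op ?W' (idem_at ?W' ?mv) (idem_at ?W' ?mu) = plus.unit ?W'"
      by (rule idem_at_orthogonal[OF CD(2) m(2,1)]) (auto simp: U_def)
    ultimately show ?thesis using mul_zero[OF CD(2) z'] by (simp only:)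
  qed
  then have 2: "tr ?W' ?I v (rs ?W' W id k) = plus.unit ?I" using plus.F_unit[OF CD(2) I m(3)] by simp
  have uv: "u w = v w" if "w \<in> U" for w
  proof (rule pr_inj[OF X])
    have w: "w \<in> pts W" "?mu w = ?mv w" using that by (auto simp: U_def)
    show "u w \<in> pts ?I" "v w \<in> pts ?I" "pr X (u w) = pr X (v w)" "?mu w = ?mv w"
      by (rule gset_mapD(1)[OF WD(5) w(1)], rule gset_mapD(1)[OF WD(6) w(1)], rule WD(9)[OF w(1)], rule w(2))
  qed
  have "rs ?W0 W id k = rs ?W0 ?I v y"
  proof -
    have z0: "rs ?W0 W id z = rs ?W0 ?I v y"
      using basic_comp(1)[OF CD(1) WD(1) I CD(4) WD(5) yI] basic_cong(1)[OF CD(1) I m(4), of u] uv by (simp add: z_def)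
    have "rs ?W0 W id k = mul.op ?W0 (idem_at ?W0 ?mv) (rs ?W0 ?I v y)"
      unfolding k_def using mul.rs_op[OF CD(1) WD(1) CD(4) dv z] rs_idem_at[OF WD(1) CD(1) mv CD(4)] z0 by simp
    also have "\<dots> = rs ?W0 ?I v (mul.op ?I (ind_idem X) y)"
      using mul.rs_op[OF CD(1) I m(4) d(1) yI] rs_idem_at[OF I CD(1) coset_of_map m(4)] by simp
    finally show ?thesis using dy by simp
  qed
  moreover have "bij_betw v (pts ?W0) (pts ?I)"
    unfolding bij_betw_def
  proof
    show "inj_on v (pts ?W0)"
    proof (rule inj_onI)
      fix w w' assume w: "w \<in> pts ?W0" "w' \<in> pts ?W0" "v w = v w'"
      then have "u w = u w'" using uv[of w] uv[of w'] by simp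
      moreover have "w \<in> pts W" "w' \<in> pts W" using w by (auto simp: U_def)
      ultimately show "w = w'" using WD(10) w(3) by blast
    qed
    have "n \<in> v ` U" if n: "n \<in> pts ?I" for n
    proof -
      obtain w where w: "w \<in> pts W" "u w = n" "v w = n" using WD(11)[OF n n] by blast
      then have "w \<in> U" by (simp add: U_def)
      then show ?thesis using w(3) by blast
    qed
    then show "v ` pts ?W0 = pts ?I" using gset_mapD(1)[OF m(4)] by auto
  qed
  ultimately have 3: "tr ?W0 ?I v (rs ?W0 W id k) = y" using tr_bij[OF CD(1) I m(4) _ yI] by simp
  have "tr W ?I v k = plus.op ?I y (plus.unit ?I)" using plus.fold_formula[OF cp I WD(6) k] 2 3 by simp
  then show ?thesis using 1 plus.op_comm[OF I yI plus.unit_closed[OF I]] plus.op_unit[OF I yI] by simp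
qed

theorem coinduction_iso: "tambara_isomorphic G R (tambara_coind G H T)"
  unfolding tambara_isomorphic_def
proof (intro exI conjI)
  let ?C = "tambara_coind G H T"
  have C [simp]: "Tob ?C = T_ob" by (simp add: tambara_coind_def)
  show "tambara_hom G R ?C \<eta>"
    unfolding tambara_hom_def using \<eta>_closed \<eta>_natural by simp
  show "tambara_hom G ?C R \<theta>"
    unfolding tambara_hom_def
  proof (intro conjI allI impI ballI funcsetI)
    show "\<theta> X y \<in> Tob R X" if "fin_gset G X" "y \<in> Tob ?C X" for X y using \<theta>_closed that by simp
    fix b y assume b: "is_bispan G b" and y: "y \<in> Tob ?C (src b)"
    note D = bispanD[OF b]
    have y': "y \<in> T_ob (src b)" using y by simp
    have t: "\<theta> (src b) y \<in> Tob R (src b)" by (rule \<theta>_closed[OF D(1) y'])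
    have "Tmap ?C (bispan_class G b) y = \<eta> (tgt b) (Tmap R (bispan_class G b) (\<theta> (src b) y))"
      using \<eta>_natural[OF b t] \<eta>_\<theta>[OF D(1) y'] by simp
    then show "\<theta> (tgt b) (Tmap ?C (bispan_class G b) y) = Tmap R (bispan_class G b) (\<theta> (src b) y)"
      using \<theta>_\<eta>[OF D(2) Tmap_in[OF b t]] by simp
  qed
  show "\<forall>X. fin_gset G X \<longrightarrow> (\<forall>x\<in>Tob R X. \<theta> X (\<eta> X x) = x) \<and> (\<forall>y\<in>Tob ?C X. \<eta> X (\<theta> X y) = y)"
    using \<theta>_\<eta> \<eta>_\<theta> by simp
qed

section \<open>The underlying ring\<close>

abbreviation "pull_free \<equiv> rs \<O> (Ind OH) orbit_iso"

lemma pull_free: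
  "x \<in> Tob R (Ind OH) \<Longrightarrow> pull_free x \<in> Tob R \<O>"
  "x \<in> Tob R (Ind OH) \<Longrightarrow> y \<in> Tob R (Ind OH) \<Longrightarrow> pull_free x = pull_free y \<Longrightarrow> x = y"
  "x' \<in> Tob R \<O> \<Longrightarrow> \<exists>x\<in>Tob R (Ind OH). pull_free x = x'"
proof -
  note I = Ind_gset[OF OH]
  show "x \<in> Tob R (Ind OH) \<Longrightarrow> pull_free x \<in> Tob R \<O>" by (rule basic_closed(1)[OF free_orbit I orbit_iso])
  show "x \<in> Tob R (Ind OH) \<Longrightarrow> y \<in> Tob R (Ind OH) \<Longrightarrow> pull_free x = pull_free y \<Longrightarrow> x = y"
    using tr_bij[OF free_orbit I orbit_iso orbit_iso_bij] by metis
  let ?j = "inv_into (pts \<O>) orbit_iso"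
  have j: "gset_map G (Ind OH) \<O> ?j" by (rule gset_map_inv[OF free_orbit orbit_iso orbit_iso_bij])
  have js: "?j (orbit_iso n) = n" if "n \<in> pts \<O>" for n by (rule bij_betw_inv_into_left[OF orbit_iso_bij that])
  show "\<exists>x\<in>Tob R (Ind OH). pull_free x = x'" if x': "x' \<in> Tob R \<O>"
  proof
    show "rs (Ind OH) \<O> ?j x' \<in> Tob R (Ind OH)" by (rule basic_closed(1)[OF I free_orbit j x'])
    show "pull_free (rs (Ind OH) \<O> ?j x') = x'"
      using basic_comp(1)[OF free_orbit I free_orbit orbit_iso j x'] basic_id(1)[OF free_orbit js x'] by simp
  qed
qed

lemma pull_free_ind_idem: "pull_free (ind_idem OH) = eps"
  using rs_idem_at[OF Ind_gset[OF OH] free_orbit coset_of_map orbit_iso] rs_\<pi>_coset_idem by simp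

text \<open>
  The summand cut out by \<open>eps\<close> consists of the functions supported on \<open>H\<close>.
\<close>

lemma T_ob_OH:
  assumes x: "x \<in> Tob R (Ind OH)"
  shows "x \<in> T_ob OH \<longleftrightarrow> (\<forall>g\<in>carrier G. g \<notin> H \<longrightarrow> \<phi> (pull_free x) g = \<zero>\<^bsub>S\<^esub>)"
proof -
  note I = Ind_gset[OF OH] and ux = pull_free(1)[OF x]
  have eq: "pull_free (cut OH x) = mul.op \<O> eps (pull_free x)"
    unfolding cut_def using mul.rs_op[OF free_orbit I orbit_iso ind_idem(1)[OF OH] x] pull_free_ind_idem by simp
  have \<phi>e: "\<phi> (mul.op \<O> eps (pull_free x)) g = (if g \<in> H then \<phi> (pull_free x) g else \<zero>\<^bsub>S\<^esub>)" if "g \<in> carrier G" for g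
    using that \<phi>_hom(2)[OF eps(1) ux] \<phi>_carrier[OF ux that] by (simp add: eps(2))
  have "x \<in> T_ob OH \<longleftrightarrow> pull_free (cut OH x) = pull_free x"
    using pull_free(2)[OF cut_closed[OF OH x] x] x by (auto simp: T_ob_def)
  also have "\<dots> \<longleftrightarrow> (\<forall>g\<in>carrier G. \<phi> (mul.op \<O> eps (pull_free x)) g = \<phi> (pull_free x) g)"
    unfolding eq using \<phi>_inj[OF mul.op_closed[OF free_orbit eps(1) ux] ux] by auto
  finally show ?thesis using \<phi>e by auto
qed

text \<open>
  An equivariant function supported on \<open>H\<close> is determined by its value at the unit, which can be
  arbitrary. So evaluation at the unit is the isomorphism.
\<close>

theorem T_underlying: "G_ring_isomorphic GH (Tring GH T OH) (Taction GH T) S \<sigma>"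
  unfolding G_ring_isomorphic_def
proof (intro bexI ballI)
  let ?\<psi> = "\<lambda>x. \<phi> (pull_free x) \<one>\<^bsub>G\<^esub>"
  note I = Ind_gset[OF OH] and ring = T_ring[OF OH] and one = G.one_closed
  interpret \<sigma>: group_action GH "carrier S" \<sigma> using S by (simp add: G_ring_def)
  have \<sigma>1: "\<sigma> \<one>\<^bsub>G\<^esub> s = s" if "s \<in> carrier S" for s
    using \<sigma>.id_eq_one that by (metis G.one_closed monoid.select_convs(2) monoid.surjective monoid.update_convs(1) partial_object.update_convs(1) restrict_apply')
  show hom: "?\<psi> \<in> ring_iso (Tring GH T OH) S"
    unfolding ring_iso_def
  proof (intro CollectI conjI ring_hom_memI)
    show "?\<psi> x \<in> carrier S" if "x \<in> carrier (Tring GH T OH)" for x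
      using that ring(1) \<phi>_carrier[OF pull_free(1)[OF T_obD(1)] one] by simp
    fix x y assume "x \<in> carrier (Tring GH T OH)" "y \<in> carrier (Tring GH T OH)"
    then have xy: "x \<in> T_ob OH" "y \<in> T_ob OH" using ring(1) by auto
    note u = pull_free(1)[OF T_obD(1)[OF xy(1)]] pull_free(1)[OF T_obD(1)[OF xy(2)]]
    show "?\<psi> (x \<otimes>\<^bsub>Tring GH T OH\<^esub> y) = ?\<psi> x \<otimes>\<^bsub>S\<^esub> ?\<psi> y"
      using ring(3)[OF xy] mul.rs_op[OF free_orbit I orbit_iso T_obD(1)[OF xy(1)] T_obD(1)[OF xy(2)]] \<phi>_hom(2)[OF u] by simp
    show "?\<psi> (x \<oplus>\<^bsub>Tring GH T OH\<^esub> y) = ?\<psi> x \<oplus>\<^bsub>S\<^esub> ?\<psi> y"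
      using ring(2)[OF xy] plus.rs_op[OF free_orbit I orbit_iso T_obD(1)[OF xy(1)] T_obD(1)[OF xy(2)]] \<phi>_hom(3)[OF u] by simp
  next
    show "?\<psi> \<one>\<^bsub>Tring GH T OH\<^esub> = \<one>\<^bsub>S\<^esub>" using ring(5) pull_free_ind_idem eps(2) H.one_closed by simp
    show "bij_betw ?\<psi> (carrier (Tring GH T OH)) (carrier S)"
      unfolding ring(1) bij_betw_def
    proof
      show "inj_on ?\<psi> (T_ob OH)"
      proof (rule inj_onI)
        fix x y assume xy: "x \<in> T_ob OH" "y \<in> T_ob OH" and eq: "?\<psi> x = ?\<psi> y"
        note u = pull_free(1)[OF T_obD(1)[OF xy(1)]] pull_free(1)[OF T_obD(1)[OF xy(2)]]
        have "\<phi> (pull_free x) g = \<phi> (pull_free y) g" if g: "g \<in> carrier G" for g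
        proof (cases "g \<in> H")
          case True
          then show ?thesis using \<phi>_equivariant[OF u(1) True one] \<phi>_equivariant[OF u(2) True one] eq g by simp
        next
          case False
          then show ?thesis using T_ob_OH[OF T_obD(1)[OF xy(1)]] T_ob_OH[OF T_obD(1)[OF xy(2)]] xy g by simp
        qed
        then show "x = y" by (intro pull_free(2)[OF T_obD(1)[OF xy(1)] T_obD(1)[OF xy(2)]] \<phi>_inj[OF u])
      qed
      have "s \<in> ?\<psi> ` T_ob OH" if s: "s \<in> carrier S" for s
      proof -
        \<comment> \<open>the function supported on \<open>H\<close> with value \<open>s\<close> at the unit\<close>
        define f where "f = (\<lambda>g\<in>carrier G. if g \<in> H then \<sigma> g s else \<zero>\<^bsub>S\<^esub>)"
        have mem: "h \<otimes>\<^bsub>G\<^esub> g \<in> H \<longleftrightarrow> g \<in> H" if "h \<in> H" "g \<in> carrier G" for h g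
          using that by (metis H.m_closed H.m_inv_closed G.inv_solve_left H.mem_carrier G.m_closed)
        have \<sigma>c: "\<sigma> h s \<in> carrier S" if "h \<in> H" for h using \<sigma>.element_image[of h s] that s by simp
        have "f (h \<otimes>\<^bsub>G\<^esub> g) = \<sigma> h (f g)" if hg: "h \<in> H" "g \<in> carrier G" for h g
          using \<sigma>.composition_rule[of s h g] s hg mem[OF hg] ring_hom_zero[OF \<sigma>_hom[OF hg(1)] S.ring_axioms S.ring_axioms]
          by (auto simp: f_def)
        then have "f \<in> coind_carrier G H S \<sigma>" using \<sigma>c by (auto simp: coind_carrier_def f_def)
        then obtain x' where x': "x' \<in> Tob R \<O>" "\<phi> x' = f" using \<phi>_surj by blast
        obtain x where x: "x \<in> Tob R (Ind OH)" "pull_free x = x'" using pull_free(3)[OF x'(1)] by blast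
        have "x \<in> T_ob OH" unfolding T_ob_OH[OF x(1)] using x x' by (simp add: f_def)
        moreover have "?\<psi> x = s" using x x' \<sigma>1[OF s] H.one_closed by (simp add: f_def)
        ultimately show ?thesis by blast
      qed
      then show "?\<psi> ` T_ob OH = carrier S" using \<phi>_carrier[OF pull_free(1)[OF T_obD(1)] one] by blast
    qed
  qed
  fix h x assume "h \<in> carrier GH" "x \<in> carrier (Tring GH T OH)"
  then have h: "h \<in> H" and x: "x \<in> T_ob OH" using ring(1) by auto
  note u = pull_free(1)[OF T_obD(1)[OF x]]
  let ?r = "induced_map (right_mult GH h)"
  have r: "gset_map G (Ind OH) (Ind OH) ?r" by (rule Ind_map[OF right_mult_H[OF h]])
  have hG: "h \<in> carrier G" using h by simp
  have "pull_free (Taction GH T h x) = rs \<O> (Ind OH) (\<lambda>n. ?r (orbit_iso n)) x"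
    unfolding Taction_def T_basic(1)[OF OH OH right_mult_H[OF h] x]
    by (rule basic_comp(1)[OF free_orbit I I orbit_iso r T_obD(1)[OF x]])
  also have "\<dots> = rs \<O> (Ind OH) (\<lambda>n. orbit_iso (right_mult G h n)) x"
    by (rule fun_cong[OF basic_cong(1)[OF free_orbit I gset_map_comp[OF right_mult[OF hG] orbit_iso]]])
      (use h inv_rep in \<open>auto simp: G.m_assoc\<close>)
  also have "\<dots> = ract h (pull_free x)"
    unfolding Taction_def by (rule basic_comp(1)[OF free_orbit free_orbit I right_mult[OF hG] orbit_iso T_obD(1)[OF x], symmetric])
  finally have "\<phi> (pull_free (Taction GH T h x)) = coind_action G h (\<phi> (pull_free x))" using equivariant[OF hG u] by simp
  then show "?\<psi> (Taction GH T h x) = \<sigma> h (?\<psi> x)"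
    using \<phi>_equivariant[OF u h one] hG by (simp add: coind_action_def)
qed

end

theorem theorem1:
  fixes G :: "('g, 'm) monoid_scheme"
    and H :: "'g set"
    and R :: "('g, 'v) tambara"
    and S :: "('s, 'k) ring_scheme"
    and \<sigma> :: "'g \<Rightarrow> 's \<Rightarrow> 's"
  assumes "group G" and "finite (carrier G)"
    and "subgroup H G"
    and "tambara_functor G R"
    and "G_ring (G\<lparr>carrier := H\<rparr>) S \<sigma>"
    and "G_ring_isomorphic G (Tring G R (free_orbit G)) (Taction G R)
           (coind_ring G H S \<sigma>) (coind_action G)"
  shows "\<exists>T :: ('g, 'v) tambara.
           tambara_functor (G\<lparr>carrier := H\<rparr>) T \<and>
           G_ring_isomorphic (G\<lparr>carrier := H\<rparr>)
             (Tring (G\<lparr>carrier := H\<rparr>) T (free_orbit (G\<lparr>carrier := H\<rparr>)))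
             (Taction (G\<lparr>carrier := H\<rparr>) T) S \<sigma> \<and>
           tambara_isomorphic G R (tambara_coind G H T)"
proof -
  obtain \<phi> where \<phi>: "\<phi> \<in> ring_iso (Tring G R (free_orbit G)) (coind_ring G H S \<sigma>)"
    "\<forall>g\<in>carrier G. \<forall>x\<in>carrier (Tring G R (free_orbit G)). \<phi> (Taction G R g x) = coind_action G g (\<phi> x)"
    using assms(6) unfolding G_ring_isomorphic_def by blast
  interpret tambara_functor G R by fact
  interpret coinduced_ring G R H S \<sigma> \<phi>
    by (intro coinduced_ring.intro coinduced_ring_axioms.intro assms \<phi>(1)) (use \<phi>(2) in simp)
  show ?thesis using T_tambara T_underlying coinduction_iso by blast
qed

end
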